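(* Fix positive integers $(k(n), n\ge 1)$ with $k(n)\le n$ for all $n$, and for $n\ge 1$ let $M_n$ be the number of vertices of the largest connected component of the invasion percolation forest $F(\mathrm{K}_n,[k(n)])$ on the randomly-weighted complete graph $\mathrm{K}_n$ with starting set $[k(n)]=\{1,\ldots,k(n)\}$. \begin{itemize} \item If $k(n)/n^{1/3}\to 0$ as $n\to\infty$, then $M_n/n\to 1$ in probability. \item If $k(n)/n^{1/3}\to\infty$ as $n\to\infty$, then $M_n/n\to 0$ in probability. \end{itemize}
   Context: $[n]:=\{1,\ldots,n\}$. $\mathrm{K}_n$ is the randomly-weighted complete graph: vertex set $[n]$, edge set $\binom{[n]}{2}$ (all 2-element subsets of $[n]$), with independent Uniform$[0,1]$ edge weights $(U(e), e\in\binom{[n]}{2})$ (almost surely distinct). Invasion percolation. Let $G=(v(G),e(G),\mathrm{w})$ be a finite connected graph with injective edge weights $\mathrm{w}:e(G)\to(0,\infty)$ and let $\mathcal{S}\subseteq v(G)$ be a nonempty starting set. Set $\mathcal{S}_0=\mathcal{S}$. For $1\le i\le |v(G)|-|\mathcal{S}|$, let $e_i=uv$ be the smallest-weight edge of $G$ with $u\in\mathcal{S}_{i-1}$ and $v\notin\mathcal{S}_{i-1}$, let $v_i=v$, and let $\mathcal{S}_i=\mathcal{S}_{i-1}\cup\{v_i\}$. The invasion percolation forest $F(G,\mathcal{S})$ is the subgraph of $G$ with vertex set $v(G)$ and edge set $\{e_i: 1\le i\le |v(G)|-|\mathcal{S}|\}$; it is a forest with $|\mathcal{S}|$ connected components,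 each containing exactly one element of $\mathcal{S}$. *)

theory Defs
  imports "HOL-Probability.Probability" "HOL-Library.Ramsey"
begin

text \<open>A weighted graph is given by a vertex set \<open>V\<close>, a set \<open>E\<close> of two-element subsets of \<open>V\<close>, and
  a weight function \<open>w\<close> on sets of vertices, of which only the values on \<open>E\<close> matter.\<close>

definition boundary_edges :: "'v set set \<Rightarrow> 'v set \<Rightarrow> 'v set set" where
  "boundary_edges E S = {e \<in> E. \<exists>u v. e = {u, v} \<and> u \<in> S \<and> v \<notin> S}"

text \<open>If the weights are not injective, \<open>arg_min_on\<close> picks some edge of minimal weight; the choice
  depends only on the set of minimal edges. For the random weights below, this concerns only a null event.\<close>

definition next_edge :: "'v set set \<Rightarrow> ('v set \<Rightarrow> real) \<Rightarrow> 'v set \<Rightarrow> 'v set" where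
  "next_edge E w S = arg_min_on w (boundary_edges E S)"

definition next_vertex :: "'v set set \<Rightarrow> ('v set \<Rightarrow> real) \<Rightarrow> 'v set \<Rightarrow> 'v" where
  "next_vertex E w S = (THE v. v \<in> next_edge E w S \<and> v \<notin> S)"

primrec invaded :: "'v set set \<Rightarrow> ('v set \<Rightarrow> real) \<Rightarrow> 'v set \<Rightarrow> nat \<Rightarrow> 'v set" where
  "invaded E w S 0 = S"
| "invaded E w S (Suc i) = invaded E w S i \<union> {next_vertex E w (invaded E w S i)}"

text \<open>The edge set of \<open>F(G, S)\<close>; its vertex set is \<open>V\<close>.\<close>

definition invasion_forest :: "'v set \<Rightarrow> 'v set set \<Rightarrow> ('v set \<Rightarrow> real) \<Rightarrow> 'v set \<Rightarrow> 'v set set" where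
  "invasion_forest V E w S =
     {next_edge E w (invaded E w S (i - 1)) | i. 1 \<le> i \<and> i \<le> card V - card S}"

definition components_of_graph :: "'v set \<Rightarrow> 'v set set \<Rightarrow> 'v set set" where
  "components_of_graph V E = {{v \<in> V. (u, v) \<in> {(x, y). {x, y} \<in> E}\<^sup>*} | u. u \<in> V}"

definition largest_component_size :: "'v set \<Rightarrow> 'v set set \<Rightarrow> nat" where
  "largest_component_size V E = Max (card ` components_of_graph V E)"

definition complete_edges :: "nat \<Rightarrow> nat set set" where
  "complete_edges n = nsets {1..n} 2"

definition iid_uniform_weights :: "'a measure \<Rightarrow> nat \<Rightarrow> (nat set \<Rightarrow> 'a \<Rightarrow> real) \<Rightarrow> bool" where
  "iid_uniform_weights P n U \<longleftrightarrow>
     prob_space P \<and>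
     prob_space.indep_vars P (\<lambda>_. borel) U (complete_edges n) \<and>
     (\<forall>e \<in> complete_edges n. distr P borel (U e) = uniform_measure lborel {0..1})"

definition max_tree_size :: "nat \<Rightarrow> nat \<Rightarrow> (nat set \<Rightarrow> 'a \<Rightarrow> real) \<Rightarrow> 'a \<Rightarrow> nat" where
  "max_tree_size n k U \<omega> =
     largest_component_size {1..n}
       (invasion_forest {1..n} (complete_edges n) (\<lambda>e. U e \<omega>) {1..k})"

text \<open>Convergence in probability of \<open>X 1, X 2, \<dots>\<close> to a constant, where each \<open>X n\<close> may live on its own
  probability space. Measurability is included because \<open>measure\<close> is \<open>0\<close> on non-measurable sets.\<close>

definition converges_in_prob :: "(nat \<Rightarrow> 'a measure) \<Rightarrow> (nat \<Rightarrow> 'a \<Rightarrow> real) \<Rightarrow> real \<Rightarrow> bool" where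
  "converges_in_prob P X c \<longleftrightarrow>
     (\<forall>n\<ge>1. X n \<in> borel_measurable (P n)) \<and>
     (\<forall>\<epsilon>>0. (\<lambda>n. measure (P n) {\<omega> \<in> space (P n). \<bar>X n \<omega> - c\<bar> > \<epsilon>}) \<longlonglongrightarrow> 0)"

end

theory Submission
  imports Defs
begin

text \<open>Since \<open>F(S)\<close> consists of the edges whose endpoints are not joined by lighter edges in the graph with
  \<open>S\<close> contracted, \<open>F(T) \<subseteq> F(S)\<close> for \<open>S \<subseteq> T\<close>. Fix a level \<open>p = (1 - \<epsilon>) / n\<close>, reveal the set \<open>X\<close> of edges
  of weight at most \<open>p\<close>, and let \<open>D\<close> be the union of the components of \<open>X\<close> that contain a source. If \<open>T\<close>
  is a union of components of \<open>X\<close>, exchanging the weights of two edges from \<open>T\<close> to the same outside vertex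
  changes neither the law nor the forest \<open>F(T)\<close> outside \<open>T\<close>. Hence a vertex outside \<open>T\<close> enters \<open>T\<close> at a
  uniform point, and two vertices that enter \<open>T\<close> from different outside vertices do so independently.

  Few sources: with \<open>\<epsilon> = n powr (-1/3)\<close> there is a component \<open>L\<close> of order \<open>n powr (2/3)\<close>, much larger than \<open>D\<close>, hence without
  sources. Entering \<open>L \<union> D\<close> in \<open>L\<close> means belonging to the tree that contains \<open>L\<close>, so this tree captures
  almost everything.

  Many sources: with \<open>\<epsilon> = sqrt (k / n)\<close> the set \<open>D\<close> has order \<open>\<epsilon> n\<close>. If \<open>u\<close> and \<open>v\<close> are in the same tree, their
  paths to the source first meet in some component \<open>K\<close> of \<open>X\<close>, and both enter \<open>K \<union> D\<close> in \<open>K\<close>. This has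
  probability at most \<open>(|K| / |D|)\<^sup>2\<close>, and the sum over \<open>K\<close> has order \<open>(n / \<epsilon>) / (\<epsilon> n)\<^sup>2 = 1 / (n \<epsilon>\<^sup>3)\<close>.\<close>

text \<open>The exponent \<open>1 / 3\<close> is where two sizes balance. With few sources |D| has
  mean at most \<open>k / \<epsilon>\<close>, so its ratio to |L| has order
  \<open>k / n powr (1 / 3)\<close>; with many, \<open>n * \<epsilon> ^ 3\<close> is the power 3/2
  of that quotient. The components contracted into \<open>T\<close> must be whole: both exchanged
  edges then have weight above \<open>p\<close>, so the exchange leaves \<open>X\<close> unchanged
  and one may condition on \<open>X\<close>. \<open>D\<close> is always included, because
  \<open>F(T) \<subseteq> F(S)\<close> requires \<open>S \<subseteq> T\<close>. Two vertices with a
  common exit vertex enter at the same point, so independence is available only at a component where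
  the paths first meet. The sizes of \<open>D\<close> and \<open>L\<close> come from an exact
  generating identity instead of an exploration process, and for \<open>L\<close> no second moment
  is computed: about \<open>n powr (1 / 3)\<close> auxiliary vertices have a joint cluster of order
  \<open>n powr (2 / 3)\<close>, while components smaller than \<open>t\<close> contribute only
  order \<open>sqrt t\<close> to the mean cluster size of a vertex, so not all components can be
  small.\<close>

definition adj :: "'v set set \<Rightarrow> 'v rel" where
  "adj X = {(x, y). {x, y} \<in> X}"

definition cluster :: "'v set set \<Rightarrow> 'v set \<Rightarrow> 'v set" where
  "cluster X S = (adj X)\<^sup>* `` S"

definition below :: "'v set set \<Rightarrow> ('v set \<Rightarrow> real) \<Rightarrow> real \<Rightarrow> 'v set set" where
  "below E w t = {e \<in> E. w e < t}"

text \<open>Kruskal's description of a minimum spanning forest: \<open>S \<times> S\<close>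
  contracts the starting set, and nothing refers to the order of invasion. This exposes the
  dependence on \<open>S\<close> and on single weights, which the greedy process hides.\<close>

definition kruskal :: "'v set set \<Rightarrow> ('v set \<Rightarrow> real) \<Rightarrow> 'v set \<Rightarrow> 'v set set" where
  "kruskal E w S =
     {e \<in> E. \<forall>x y. e = {x, y} \<longrightarrow> (x, y) \<notin> (adj (below E w (w e)) \<union> S \<times> S)\<^sup>*}"

section \<open>Reachability, with and without a contracted set\<close>

lemma adj_sym: "(x, y) \<in> adj X \<longleftrightarrow> (y, x) \<in> adj X"
  by (simp add: adj_def insert_commute)

lemma sym_adj: "sym (adj X)"
  by (auto simp: sym_def adj_sym)

lemma adj_mono: "X \<subseteq> Y \<Longrightarrow> adj X \<subseteq> adj Y"
  by (auto simp: adj_def)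

lemma rtrancl_adj_mono: "X \<subseteq> Y \<Longrightarrow> (x, y) \<in> (adj X)\<^sup>* \<Longrightarrow> (x, y) \<in> (adj Y)\<^sup>*"
  using rtrancl_mono[OF adj_mono] by blast

lemma rtrancl_adj_sym: "(x, y) \<in> (adj X)\<^sup>* \<Longrightarrow> (y, x) \<in> (adj X)\<^sup>*"
  by (rule symD[OF sym_rtrancl[OF sym_adj]])

lemma rtrancl_adj_Un_sym: "(x, y) \<in> (adj X \<union> S \<times> S)\<^sup>* \<Longrightarrow> (y, x) \<in> (adj X \<union> S \<times> S)\<^sup>*"
  by (rule symD[OF sym_rtrancl[OF sym_Un[OF sym_adj]]]) (auto simp: sym_def)

lemma rtrancl_crossing:
  assumes "(a, b) \<in> R\<^sup>*" "a \<in> A" "b \<notin> A"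
  shows "\<exists>x y. (x, y) \<in> R \<and> x \<in> A \<and> y \<notin> A"
  using assms by (induction rule: rtrancl_induct) blast+

lemma rtrancl_closed:
  assumes "(a, b) \<in> R\<^sup>*" "a \<in> A" "\<And>x y. (x, y) \<in> R \<Longrightarrow> x \<in> A \<Longrightarrow> y \<in> A"
  shows "b \<in> A"
  using rtrancl_crossing[OF assms(1,2)] assms(3) by blast

text \<open>Cut the walk at its first and its last jump inside \<open>T\<close>; the part between
  them can be forgotten.\<close>

lemma rtrancl_Un_Times:
  assumes "(a, b) \<in> (R \<union> T \<times> T)\<^sup>*"
  shows "(a, b) \<in> R\<^sup>* \<or> (\<exists>t\<in>T. \<exists>t'\<in>T. (a, t) \<in> R\<^sup>* \<and> (t', b) \<in> R\<^sup>*)"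
  using assms
proof (induction rule: rtrancl_induct)
  case (step y z)
  from step.hyps(2) show ?case
  proof
    assume "(y, z) \<in> R"
    with step.IH show ?case by (meson rtrancl.rtrancl_into_rtrancl)
  next
    assume "(y, z) \<in> T \<times> T"
    with step.IH show ?case by blast
  qed
qed simp

lemma kruskal_antimono: "S \<subseteq> T \<Longrightarrow> kruskal E w T \<subseteq> kruskal E w S"
proof -
  assume "S \<subseteq> T"
  then have "(adj X \<union> S \<times> S)\<^sup>* \<subseteq> (adj X \<union> T \<times> T)\<^sup>*" for X
    by (intro rtrancl_mono) auto
  then show ?thesis unfolding kruskal_def by fast
qed

lemma kruskal_subset: "kruskal E w S \<subseteq> E"
  by (auto simp: kruskal_def)

lemma adj_nsetsD: "X \<subseteq> nsets V 2 \<Longrightarrow> (x, y) \<in> adj X \<Longrightarrow> x \<in> V \<and> y \<in> V \<and> x \<noteq> y"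
proof -
  assume "X \<subseteq> nsets V 2" "(x, y) \<in> adj X"
  then have "{x, y} \<in> nsets V 2" unfolding adj_def by blast
  then show ?thesis by simp
qed

subsection \<open>Clusters\<close>

lemma cluster_subset: "X \<subseteq> nsets V 2 \<Longrightarrow> S \<subseteq> V \<Longrightarrow> cluster X S \<subseteq> V"
proof
  fix y assume "X \<subseteq> nsets V 2" "S \<subseteq> V" "y \<in> cluster X S"
  then show "y \<in> V"
    using rtrancl_closed[of _ y "adj X" V] adj_nsetsD[of X V] unfolding cluster_def by blast
qed

lemma subset_cluster: "S \<subseteq> cluster X S"
  by (auto simp: cluster_def)

lemma cluster_mono: "X \<subseteq> Y \<Longrightarrow> cluster X S \<subseteq> cluster Y S"
  unfolding cluster_def by (intro Image_mono rtrancl_mono adj_mono) simp_all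

lemma mem_cluster_singleton: "y \<in> cluster X {x} \<longleftrightarrow> (x, y) \<in> (adj X)\<^sup>*"
  by (simp add: cluster_def)

lemma self_mem_cluster: "x \<in> cluster X {x}"
  by (simp add: cluster_def)

lemma cluster_step: "x \<in> cluster X S \<Longrightarrow> (x, y) \<in> (adj X)\<^sup>* \<Longrightarrow> y \<in> cluster X S"
  unfolding cluster_def by (meson Image_iff rtrancl_trans)

lemma cluster_singleton_eq: "y \<in> cluster X {x} \<Longrightarrow> cluster X {y} = cluster X {x}"
  unfolding set_eq_iff mem_cluster_singleton by (meson rtrancl_adj_sym rtrancl_trans)

lemma cluster_eq_UN: "cluster X S = (\<Union>s\<in>S. cluster X {s})"
  by (auto simp: cluster_def)

lemma cluster_eqI:
  assumes "S \<subseteq> A" "A \<subseteq> cluster X S" "\<And>x y. x \<in> A \<Longrightarrow> y \<notin> A \<Longrightarrow> {x, y} \<notin> X"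
  shows "cluster X S = A"
proof
  show "cluster X S \<subseteq> A"
  proof
    fix y assume "y \<in> cluster X S"
    then obtain s where "s \<in> S" "(s, y) \<in> (adj X)\<^sup>*" by (auto simp: cluster_def)
    then show "y \<in> A"
    proof (elim rtrancl_closed)
      show "b \<in> A" if "(a, b) \<in> adj X" "a \<in> A" for a b
        using assms(3)[of a b] that by (auto simp: adj_def)
    qed (use assms(1) in blast)
  qed
qed (rule assms)

subsection \<open>Invasion percolation as a rooted forest\<close>

text \<open>\<open>rank v\<close> is the step at which \<open>v\<close> is invaded and
  \<open>{v, par v}\<close> the edge used. \<open>cut_min\<close> is the greedy choice at that step:
  the vertices of smaller rank are those already invaded, and a pair across this cut has distinct
  ranks, hence is an edge of the complete graph.\<close>

locale invasion_tree =
  fixes V S :: "'v set" and w :: "'v set \<Rightarrow> real" and par :: "'v \<Rightarrow> 'v" and rank :: "'v \<Rightarrow> nat"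
  assumes finite_V: "finite V" and S_subset: "S \<subseteq> V"
    and par_in: "v \<in> V - S \<Longrightarrow> par v \<in> V"
    and rank_par: "v \<in> V - S \<Longrightarrow> rank (par v) < rank v"
    and rank_S: "v \<in> S \<Longrightarrow> rank v = 0"
    and rank_inj: "inj_on rank (V - S)"
    and cut_min: "\<lbrakk>v \<in> V - S; x \<in> V; y \<in> V; rank x < rank v; rank v \<le> rank y\<rbrakk>
                    \<Longrightarrow> w {v, par v} \<le> w {x, y}"
begin

abbreviation "E \<equiv> nsets V 2"
abbreviation "F \<equiv> (\<lambda>v. {v, par v}) ` (V - S)"
abbreviation "anc \<equiv> {(v, par v) |v. v \<in> V - S}"

lemma par_edge: "v \<in> V - S \<Longrightarrow> {v, par v} \<in> E"
  using par_in[of v] rank_par[of v] by auto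

text \<open>The walk has to leave the set of vertices invaded before \<open>v\<close>. Jumps within
  \<open>S\<close> stay inside that set, as sources have rank 0, so it leaves through an edge
  lighter than \<open>t\<close>, and the edge of \<open>v\<close> is no heavier than any edge
  leaving the set.\<close>

lemma cut_path:
  assumes v: "v \<in> V - S" and a: "a \<in> V" "rank a < rank v"
    and path: "(a, v) \<in> (adj (below E w t) \<union> S \<times> S)\<^sup>*"
  shows "w {v, par v} < t"
proof -
  let ?A = "{x \<in> V. rank x < rank v}"
  have S: "S \<subseteq> ?A"
    using S_subset rank_S rank_par[OF v] by fastforce
  obtain x y where xy: "(x, y) \<in> adj (below E w t) \<union> S \<times> S" "x \<in> ?A" "y \<notin> ?A"
    using rtrancl_crossing[OF path, of ?A] a by auto
  with S have "{x, y} \<in> below E w t" by (auto simp: adj_def)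
  then have "w {x, y} < t" "y \<in> V" by (auto simp: below_def)
  with cut_min[OF v, of x y] xy show ?thesis by auto
qed

text \<open>Minimax property of invasion: the edge through which a vertex is invaded does not exceed
  the bottleneck of any path from a source.\<close>

lemma source_path:
  assumes "v \<in> V - S" "s \<in> S" "(s, v) \<in> (adj (below E w t))\<^sup>*"
  shows "w {v, par v} < t"
proof (rule cut_path[OF assms(1)])
  show "s \<in> V" using assms S_subset by auto
  show "rank s < rank v" using rank_S[OF assms(2)] rank_par[OF assms(1)] by simp
  show "(s, v) \<in> (adj (below E w t) \<union> S \<times> S)\<^sup>*"
    using assms(3) rtrancl_mono[of "adj (below E w t)" "adj (below E w t) \<union> S \<times> S"] by auto
qed

lemma F_subset_kruskal: "F \<subseteq> kruskal E w S"
proof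
  fix e assume "e \<in> F"
  then obtain v where v: "v \<in> V - S" "e = {v, par v}" by auto
  have no: "(par v, v) \<notin> (adj (below E w (w e)) \<union> S \<times> S)\<^sup>*"
    using cut_path[OF v(1), of "par v" "w e"] par_in[OF v(1)] rank_par[OF v(1)] v by auto
  have "(x, y) \<notin> (adj (below E w (w e)) \<union> S \<times> S)\<^sup>*" if "e = {x, y}" for x y
  proof -
    have "x = v \<and> y = par v \<or> x = par v \<and> y = v" using that v(2) by (auto simp: doubleton_eq_iff)
    then show ?thesis using no rtrancl_adj_Un_sym by metis
  qed
  then show "e \<in> kruskal E w S"
    using par_edge v by (auto simp: kruskal_def)
qed

text \<open>The classes of \<open>x\<close> and \<open>y\<close> cannot both stay unmerged by forest edges of weight at most
  \<open>w {x, y}\<close>: the class that is entered last would be entered through an edge heavier than a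
  boundary edge that was already available.\<close>

lemma edge_connected_by_lighter_F:
  assumes xy: "{x, y} \<in> E"
  shows "(x, y) \<in> (adj {f \<in> F. w f \<le> w {x, y}} \<union> S \<times> S)\<^sup>*"
proof (rule ccontr)
  define R where "R = adj {f \<in> F. w f \<le> w {x, y}} \<union> S \<times> S"
  have symR: "(a, b) \<in> R\<^sup>* \<Longrightarrow> (b, a) \<in> R\<^sup>*" for a b
    unfolding R_def by (rule rtrancl_adj_Un_sym)
  define cl where "cl a = {b. (a, b) \<in> R\<^sup>*}" for a
  assume "(x, y) \<notin> (adj {f \<in> F. w f \<le> w {x, y}} \<union> S \<times> S)\<^sup>*"
  then have nxy: "(x, y) \<notin> R\<^sup>*" by (simp add: R_def)
  have FE: "F \<subseteq> E" using par_edge by auto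
  have RV: "a \<in> V \<Longrightarrow> (a, b) \<in> R \<Longrightarrow> b \<in> V" for a b
  proof -
    assume "a \<in> V" "(a, b) \<in> R"
    then consider "{a, b} \<in> F" | "b \<in> S" unfolding R_def adj_def by blast
    then show "b \<in> V"
    proof cases
      case 1
      then have "{a, b} \<in> E" using FE by (rule rev_subsetD)
      then show ?thesis by simp
    qed (use S_subset in auto)
  qed
  have clV: "a \<in> V \<Longrightarrow> cl a \<subseteq> V" for a
  proof
    fix b assume "a \<in> V" "b \<in> cl a"
    then show "b \<in> V" using rtrancl_closed[of a b R V] RV unfolding cl_def by blast
  qed
  \<comment> \<open>\<open>m\<close> and \<open>m'\<close> are the earliest invaded vertices of the
    two classes. Stating the claim for \<open>a\<close>, \<open>b\<close> instead of
    \<open>x\<close>, \<open>y\<close> allows the assumption that \<open>m\<close> comes no later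
    than \<open>m'\<close>.\<close>
  have key: False
    if ab: "{a, b} = {x, y}" and m: "m \<in> cl a" "\<And>c. c \<in> cl a \<Longrightarrow> rank m \<le> rank c"
      and m': "m' \<in> cl b" "\<And>c. c \<in> cl b \<Longrightarrow> rank m' \<le> rank c" and le: "rank m \<le> rank m'" for a b m m'
  proof -
    have V: "a \<in> V" "b \<in> V" using xy ab by (auto simp: doubleton_eq_iff)
    have nab: "(a, b) \<notin> R\<^sup>*" using ab nxy symR by (auto simp: doubleton_eq_iff)
    have mb: "m' \<in> V" "m \<in> V" using clV V m m' by auto
    have disj: "cl a \<inter> cl b = {}"
    proof (rule ccontr)
      assume "cl a \<inter> cl b \<noteq> {}"
      then obtain c where "(a, c) \<in> R\<^sup>*" "(b, c) \<in> R\<^sup>*" by (auto simp: cl_def)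
      then have "(a, b) \<in> R\<^sup>*" using symR rtrancl_trans by metis
      with nab show False ..
    qed
    have m'S: "m' \<notin> S"
    proof
      assume s: "m' \<in> S"
      have "m \<in> S"
      proof (rule ccontr)
        assume "m \<notin> S"
        with mb have "0 < rank m" using rank_par[of m] by auto
        with le rank_S[OF s] show False by simp
      qed
      with s have "(m, m') \<in> R" by (auto simp: R_def)
      with m(1) have "m' \<in> cl a" unfolding cl_def by (auto intro: rtrancl.rtrancl_into_rtrancl)
      with m'(1) disj show False by auto
    qed
    with mb have m'VS: "m' \<in> V - S" by simp
    have lt: "rank m < rank m'"
    proof (rule ccontr)
      assume "\<not> rank m < rank m'"
      with le have eq: "rank m = rank m'" by simp
      then have "m \<notin> S" using rank_S rank_par[OF m'VS] by fastforce
      with rank_inj eq mb m'S have "m = m'" by (auto simp: inj_on_def)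
      with m m' disj show False by auto
    qed
    have heavy: "w {m', par m'} > w {x, y}"
    proof (rule ccontr)
      assume "\<not> w {m', par m'} > w {x, y}"
      with m'VS have "(m', par m') \<in> R" by (auto simp: R_def adj_def)
      with m'(1) have "par m' \<in> cl b" by (auto simp: cl_def intro: rtrancl.rtrancl_into_rtrancl)
      with m'(2) rank_par[OF m'VS] show False by fastforce
    qed
    let ?A = "{c \<in> V. rank c < rank m'}"
    have cross: "w {c, d} > w {x, y}" if "c \<in> ?A" "d \<in> V" "d \<notin> ?A" for c d
      using cut_min[OF m'VS, of c d] heavy that by auto
    have bA: "b \<notin> ?A" using m'(2)[of b] by (auto simp: cl_def)
    show False
    \<comment> \<open>\<open>b\<close> lies outside the cut. If \<open>a\<close> lies inside,
      \<open>{a, b}\<close> itself crosses; if not, the class of \<open>a\<close>, which has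
      \<open>m\<close> inside, crosses through an edge of weight at most \<open>w {x, y}\<close>.
      Both contradict \<open>cross\<close>.\<close>
    proof (cases "a \<in> ?A")
      case True
      from cross[OF True V(2) bA] ab show False by simp
    next
      case False
      have "(m, a) \<in> R\<^sup>*" using m(1) symR by (auto simp: cl_def)
      from rtrancl_crossing[OF this, of ?A] lt mb False
      obtain c d where cd: "(c, d) \<in> R" "c \<in> ?A" "d \<notin> ?A" by auto
      have "d \<in> V" using RV cd by auto
      have "S \<subseteq> ?A" using S_subset rank_S lt by fastforce
      with cd have "(c, d) \<in> adj {f \<in> F. w f \<le> w {x, y}}" by (auto simp: R_def)
      then have "w {c, d} \<le> w {x, y}" by (auto simp: adj_def)
      with cross[OF cd(2) \<open>d \<in> V\<close> cd(3)] show False by simp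
    qed
  qed
  have "\<exists>m\<in>cl a. \<forall>c\<in>cl a. rank m \<le> rank c" for a
  proof -
    have "a \<in> cl a" by (simp add: cl_def)
    then show ?thesis
      using exists_least_iff[of "\<lambda>i. \<exists>m\<in>cl a. rank m = i"] by (metis linorder_not_less)
  qed
  then obtain m m' where m: "m \<in> cl x" "\<And>c. c \<in> cl x \<Longrightarrow> rank m \<le> rank c"
    and m': "m' \<in> cl y" "\<And>c. c \<in> cl y \<Longrightarrow> rank m' \<le> rank c" by metis
  show False
    using key[of x y m m'] key[of y x m' m] m m' by (cases "rank m \<le> rank m'") (auto simp: insert_commute)
qed

text \<open>By injectivity an edge outside \<open>F\<close> is strictly heavier than the forest
  edges of weight at most its own. These already join its endpoints, up to jumps in
  \<open>S\<close>, so it fails the Kruskal test.\<close>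

lemma kruskal_eq_F:
  assumes inj: "inj_on w E"
  shows "kruskal E w S = F"
proof
  show "kruskal E w S \<subseteq> F"
  proof
    fix e assume e: "e \<in> kruskal E w S"
    then have eE: "e \<in> E" by (simp add: kruskal_def)
    then obtain x y where xy: "e = {x, y}" by (elim nsets2_E)
    show "e \<in> F"
    proof (rule ccontr)
      assume "e \<notin> F"
      then have "{f \<in> F. w f \<le> w e} \<subseteq> below E w (w e)"
        using par_edge inj eE by (force simp: below_def inj_on_def order_less_le)
      then have "adj {f \<in> F. w f \<le> w e} \<union> S \<times> S \<subseteq> adj (below E w (w e)) \<union> S \<times> S"
        using adj_mono by blast
      then have "(x, y) \<in> (adj (below E w (w e)) \<union> S \<times> S)\<^sup>*"
        using edge_connected_by_lighter_F[of x y] eE xy rtrancl_mono by blast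
      with e xy show False by (auto simp: kruskal_def)
    qed
  qed
qed (rule F_subset_kruskal)

lemma anc_rank: "(u, v) \<in> anc\<^sup>* \<Longrightarrow> u = v \<or> rank v < rank u"
proof (induction rule: rtrancl_induct)
  case (step y z)
  then show ?case using rank_par[of y] by auto
qed simp

lemma anc_in_V: "(u, v) \<in> anc\<^sup>* \<Longrightarrow> u \<in> V \<Longrightarrow> v \<in> V"
  by (erule rtrancl_closed) (use par_in in auto)

lemma anc_first: "(u, v) \<in> anc\<^sup>* \<Longrightarrow> u \<noteq> v \<Longrightarrow> u \<in> V - S \<and> (par u, v) \<in> anc\<^sup>*"
  by (erule converse_rtranclE) auto

lemma anc_last: "(u, v) \<in> anc\<^sup>* \<Longrightarrow> u \<noteq> v \<Longrightarrow> \<exists>g\<in>V - S. (u, g) \<in> anc\<^sup>* \<and> par g = v"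
  by (erule rtranclE) auto

text \<open>Walk along the path one edge at a time: the common ancestor changes only when the walk
  climbs from it to its parent.\<close>

lemma common_ancestor:
  assumes "(u, v) \<in> (adj F)\<^sup>*"
  shows "\<exists>c. (u, c) \<in> anc\<^sup>* \<and> (v, c) \<in> anc\<^sup>*"
  using assms
proof (induction rule: rtrancl_induct)
  case base
  show ?case by blast
next
  case (step y z)
  then obtain c where c: "(u, c) \<in> anc\<^sup>*" "(y, c) \<in> anc\<^sup>*" by blast
  from step.hyps(2) obtain x where x: "x \<in> V - S" "{y, z} = {x, par x}"
    by (auto simp: adj_def)
  then consider "y = x" "z = par x" | "z = x" "y = par x" by (auto simp: doubleton_eq_iff)
  then show ?case
  proof cases
    case 1
    show ?thesis
    proof (cases "y = c")
      case True
      then have "(u, z) \<in> anc\<^sup>*" using c 1 x by (auto intro: rtrancl.rtrancl_into_rtrancl)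
      then show ?thesis by blast
    next
      case False
      then show ?thesis using anc_first[OF c(2)] 1 c by auto
    qed
  next
    case 2
    then have "(z, y) \<in> anc" using x by auto
    then show ?thesis using c by (meson converse_rtrancl_into_rtrancl)
  qed
qed

end

section \<open>From the greedy process to ranks and parents\<close>

lemma next_edge_properties:
  fixes w :: "'v set \<Rightarrow> real"
  assumes fin: "finite V" and I: "I \<subseteq> V" "I \<noteq> {}" "I \<noteq> V"
  shows "\<exists>x\<in>I. next_edge (nsets V 2) w I = {x, next_vertex (nsets V 2) w I}"
    and "next_vertex (nsets V 2) w I \<in> V - I"
    and "\<lbrakk>x \<in> I; y \<in> V - I\<rbrakk> \<Longrightarrow> w (next_edge (nsets V 2) w I) \<le> w {x, y}"
proof -
  let ?B = "boundary_edges (nsets V 2) I"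
  have B: "{x, y} \<in> ?B" if "x \<in> I" "y \<in> V - I" for x y
    using that I by (auto simp: boundary_edges_def)
  have finB: "finite ?B" using finite_imp_finite_nsets[OF fin] by (simp add: boundary_edges_def)
  have neB: "?B \<noteq> {}" using B I by blast
  have e: "next_edge (nsets V 2) w I \<in> ?B"
    unfolding next_edge_def by (rule arg_min_if_finite(1)[OF finB neB])
  then obtain x y where xy: "next_edge (nsets V 2) w I = {x, y}" "x \<in> I" "y \<notin> I"
    by (auto simp: boundary_edges_def)
  have "{x, y} \<in> nsets V 2" using e xy by (auto simp: boundary_edges_def)
  then have yV: "y \<in> V" by simp
  have nv: "next_vertex (nsets V 2) w I = y"
    unfolding next_vertex_def using xy by auto
  show "\<exists>x\<in>I. next_edge (nsets V 2) w I = {x, next_vertex (nsets V 2) w I}" using xy nv by auto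
  show "next_vertex (nsets V 2) w I \<in> V - I" using nv yV xy by auto
  show "w (next_edge (nsets V 2) w I) \<le> w {x, y}" if "x \<in> I" "y \<in> V - I" for x y
    unfolding next_edge_def by (rule arg_min_least[OF finB neB B[OF that]])
qed

lemma invasion_tree_exists:
  fixes w :: "'v set \<Rightarrow> real"
  assumes fin: "finite V" and S: "S \<subseteq> V" "S \<noteq> {}"
  obtains par rank where "invasion_tree V S w par rank"
    "invasion_forest V (nsets V 2) w S = (\<lambda>v. {v, par v}) ` (V - S)"
proof -
  define I where "I = invaded (nsets V 2) w S"
  define N where "N = card V - card S"
  define nv where "nv i = next_vertex (nsets V 2) w (I i)" for i
  define ne where "ne i = next_edge (nsets V 2) w (I i)" for i
  have I0: "I 0 = S" by (simp add: I_def)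
  have Isuc: "I (Suc i) = insert (nv i) (I i)" for i by (simp add: I_def nv_def)
  have card_le: "card S \<le> card V" by (rule card_mono[OF fin S(1)])
  have inv: "S \<subseteq> I i \<and> I i \<subseteq> V \<and> card (I i) = card S + i" if "i \<le> N" for i
    using that
  proof (induction i)
    case 0
    then show ?case using S by (simp add: I0)
  next
    case (Suc i)
    then have IH: "S \<subseteq> I i" "I i \<subseteq> V" "card (I i) = card S + i" by auto
    have "I i \<noteq> V" using IH Suc.prems card_le by (auto simp: N_def)
    then have "nv i \<in> V - I i" using next_edge_properties(2)[OF fin IH(2), of w] S IH by (auto simp: nv_def)
    then show ?case using IH finite_subset[OF IH(2) fin] by (auto simp: Isuc)
  qed
  have neq: "I i \<subseteq> V \<and> I i \<noteq> {} \<and> I i \<noteq> V" if "i < N" for i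
    using inv[of i] that S card_le by (auto simp: N_def)
  have nvV: "nv i \<in> V - I i" if "i < N" for i
    using next_edge_properties(2)[OF fin, of "I i"] neq[OF that] by (auto simp: nv_def)
  have nex: "\<exists>x\<in>I i. ne i = {x, nv i}" if "i < N" for i
    using next_edge_properties(1)[OF fin, of "I i"] neq[OF that] by (auto simp: nv_def ne_def)
  have nemin: "w (ne i) \<le> w {x, y}" if "i < N" "x \<in> I i" "y \<in> V - I i" for i x y
    using next_edge_properties(3)[OF fin, of "I i"] neq[OF that(1)] that by (auto simp: ne_def)
  have IN: "I N = V" using inv[of N] card_le card_subset_eq[OF fin, of "I N"] by (simp add: N_def)
  have Imono: "i \<le> j \<Longrightarrow> I i \<subseteq> I j" for i j
    by (rule lift_Suc_mono_le[of I]) (auto simp: Isuc)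
  define rank where "rank v = (LEAST i. v \<in> I i)" for v
  have rank_mem: "v \<in> I (rank v)" if "v \<in> V" for v
    unfolding rank_def using that IN by (metis LeastI)
  have rank_le: "v \<in> I i \<Longrightarrow> rank v \<le> i" for v i
    unfolding rank_def by (rule Least_le)
  have rank_iff: "v \<in> I i \<longleftrightarrow> rank v \<le> i" if "v \<in> V" for v i
    using rank_mem[OF that] rank_le Imono by blast
  have rank_nv: "rank (nv i) = Suc i" if "i < N" for i
  proof -
    have "nv i \<in> V" "nv i \<notin> I i" using nvV[OF that] by auto
    then have "\<not> rank (nv i) \<le> i" using rank_iff by blast
    moreover have "rank (nv i) \<le> Suc i" by (rule rank_le) (simp add: Isuc)
    ultimately show ?thesis by simp
  qed
  have new: "\<exists>i<N. v = nv i \<and> rank v = Suc i" if v: "v \<in> V - S" for v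
  proof -
    have "rank v \<noteq> 0" using v rank_mem[of v] I0 by (metis DiffD1 DiffD2)
    then obtain i where i: "rank v = Suc i" using not0_implies_Suc by blast
    have "rank v \<le> N" using rank_le v IN by auto
    then have "i < N" using i by simp
    moreover have "v \<in> I (Suc i)" "v \<notin> I i" using rank_iff[of v] v i by auto
    ultimately show ?thesis using i by (auto simp: Isuc)
  qed
  have nvS: "nv i \<in> V - S" if "i < N" for i
    using nvV[OF that] inv[of i] that by auto
  \<comment> \<open>A vertex of rank \<open>Suc i\<close> is added by step \<open>i\<close>, so its
    edge and its parent are read off at index \<open>rank v - 1\<close>.\<close>
  define par where "par v = (SOME x. x \<in> I (rank v - 1) \<and> ne (rank v - 1) = {x, v})" for v
  have par: "par v \<in> I i \<and> ne i = {v, par v}" if "i < N" "v = nv i" for i v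
  proof -
    have "par v \<in> I (rank v - 1) \<and> ne (rank v - 1) = {par v, v}"
      unfolding par_def by (rule someI_ex) (use nex[OF that(1)] that rank_nv in auto)
    then show ?thesis using that rank_nv by (auto simp: insert_commute)
  qed
  have tree: "invasion_tree V S w par rank"
  proof
    show "par v \<in> V" if "v \<in> V - S" for v
      using new[OF that] par neq by blast
    show "rank (par v) < rank v" if "v \<in> V - S" for v
      using new[OF that] par rank_le by fastforce
    show "rank v = 0" if "v \<in> S" for v
      using rank_le[of v 0] that I0 by simp
    show "inj_on rank (V - S)"
      using new by (intro inj_onI) (metis nat.inject)
    show "w {v, par v} \<le> w {x, y}"
      if "v \<in> V - S" "x \<in> V" "y \<in> V" "rank x < rank v" "rank v \<le> rank y" for v x y
    proof -
      obtain i where i: "i < N" "v = nv i" "rank v = Suc i" using new[OF \<open>v \<in> V - S\<close>] by auto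
      have "x \<in> I i" "y \<in> V - I i" using rank_iff that i by auto
      then show ?thesis using nemin[OF i(1)] par[OF i(1,2)] by auto
    qed
  qed (use fin S in auto)
  have "invasion_forest V (nsets V 2) w S = {ne (i - 1) |i. 1 \<le> i \<and> i \<le> N}"
    by (simp add: invasion_forest_def ne_def I_def N_def)
  also have "\<dots> = ne ` {..<N}"
  proof (intro equalityI subsetI)
    fix e assume "e \<in> {ne (i - 1) |i. 1 \<le> i \<and> i \<le> N}"
    then obtain i where "e = ne (i - 1)" "1 \<le> i" "i \<le> N" by auto
    then show "e \<in> ne ` {..<N}" by (intro image_eqI[of _ _ "i - 1"]) auto
  next
    fix e assume "e \<in> ne ` {..<N}"
    then obtain i where "e = ne i" "i < N" by auto
    then show "e \<in> {ne (i - 1) |i. 1 \<le> i \<and> i \<le> N}" by (intro CollectI exI[of _ "Suc i"]) auto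
  qed
  also have "\<dots> = (\<lambda>v. {v, par v}) ` (V - S)"
  proof (intro equalityI subsetI)
    fix e assume "e \<in> ne ` {..<N}"
    then show "e \<in> (\<lambda>v. {v, par v}) ` (V - S)" using par nvS by auto
  next
    fix e assume "e \<in> (\<lambda>v. {v, par v}) ` (V - S)"
    then show "e \<in> ne ` {..<N}" using new par by fastforce
  qed
  finally show ?thesis using tree that by blast
qed

subsection \<open>Entering a set of vertices\<close>

text \<open>\<open>z\<close> is the last vertex outside \<open>T\<close>, and \<open>b\<close> the first one inside, on the path from \<open>u\<close> in the
  invasion forest started from \<open>T\<close>.\<close>

definition enters ::
  "'v set set \<Rightarrow> ('v set \<Rightarrow> real) \<Rightarrow> 'v set \<Rightarrow> 'v \<Rightarrow> 'v \<Rightarrow> 'v \<Rightarrow> bool" where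
  "enters E w T u z b \<longleftrightarrow>
     u \<notin> T \<and> z \<notin> T \<and> b \<in> T \<and> {z, b} \<in> kruskal E w T \<and>
     (u, z) \<in> {(x, y). x \<notin> T \<and> y \<notin> T \<and> {x, y} \<in> kruskal E w T}\<^sup>*"

lemma enters_exists:
  assumes fin: "finite V" and T: "T \<subseteq> V" "T \<noteq> {}" and inj: "inj_on w (nsets V 2)"
    and u: "u \<in> V - T"
  shows "\<exists>z\<in>V - T. \<exists>b\<in>T. enters (nsets V 2) w T u z b"
proof -
  obtain par rank where "invasion_tree V T w par rank"
    using invasion_tree_exists[OF fin T] by metis
  then interpret invasion_tree V T w par rank .
  let ?R = "{(x, y). x \<notin> T \<and> y \<notin> T \<and> {x, y} \<in> kruskal E w T}"
  have k: "{v, par v} \<in> kruskal E w T" if "v \<in> V - T" for v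
    using that kruskal_eq_F[OF inj] by auto
  show ?thesis using u
  proof (induction "rank u" arbitrary: u rule: less_induct)
    case less
    show ?case
    proof (cases "par u \<in> T")
      case True
      then have "enters E w T u u (par u)" using k[OF less.prems] less.prems by (simp add: enters_def)
      then show ?thesis using True less.prems by blast
    next
      case False
      then have pu: "par u \<in> V - T" using par_in[OF less.prems] by simp
      then obtain z b where zb: "z \<in> V - T" "b \<in> T" "enters E w T (par u) z b"
        using less.hyps[OF rank_par[OF less.prems] pu] by blast
      have "(u, par u) \<in> ?R" using False less.prems k by auto
      then have "enters E w T u z b"
        using zb(3) less.prems unfolding enters_def by (auto intro: converse_rtrancl_into_rtrancl)
      then show ?thesis using zb by blast
    qed
  qed
qed

lemma enters_in:
  assumes "enters (nsets V 2) w T u z b"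
  shows "z \<in> V - T" "b \<in> T"
proof -
  have "{z, b} \<in> nsets V 2" using assms kruskal_subset unfolding enters_def by blast
  then show "z \<in> V - T" "b \<in> T" using assms by (auto simp: enters_def)
qed

text \<open>Two exit vertices \<open>z\<close>, \<open>z'\<close> are joined by a forest walk
  outside \<open>T\<close>. As \<open>par z\<close> lies in \<open>T\<close>, such a walk never
  leaves the descendants of \<open>z\<close>, so \<open>z'\<close> descends from \<open>z\<close>;
  but \<open>par z'\<close> is in \<open>T\<close> as well, which forces \<open>z' = z\<close>. The
  entry point is then the parent.\<close>

lemma enters_unique:
  assumes fin: "finite V" and T: "T \<subseteq> V" "T \<noteq> {}" and inj: "inj_on w (nsets V 2)"
    and en: "enters (nsets V 2) w T u z b" "enters (nsets V 2) w T u z' b'"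
  shows "z' = z \<and> b' = b"
proof -
  obtain par rank where "invasion_tree V T w par rank"
    using invasion_tree_exists[OF fin T] by metis
  then interpret invasion_tree V T w par rank .
  let ?R = "{(x, y). x \<notin> T \<and> y \<notin> T \<and> {x, y} \<in> kruskal E w T}"
  have par_eq: "b = par z" if en: "enters E w T u z b" for z b
  proof -
    have "{z, b} \<in> F" using en kruskal_eq_F[OF inj] by (simp add: enters_def)
    then show ?thesis using en by (auto simp: enters_def doubleton_eq_iff)
  qed
  have symR: "sym ?R" by (auto simp: sym_def insert_commute)
  have zz: "(z, z') \<in> ?R\<^sup>*"
  proof -
    have "(z, u) \<in> ?R\<^sup>*" using en(1) symD[OF sym_rtrancl[OF symR]] by (simp add: enters_def)
    moreover have "(u, z') \<in> ?R\<^sup>*" using en(2) by (simp add: enters_def)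
    ultimately show ?thesis by (rule rtrancl_trans)
  qed
  have pz: "par z \<in> T" using par_eq[OF en(1)] en(1) by (simp add: enters_def)
  have "(z', z) \<in> anc\<^sup>*"
    using zz
  proof (induction rule: rtrancl_induct)
    case (step x y)
    then have "{x, y} \<in> F" "x \<notin> T" "y \<notin> T" using kruskal_eq_F[OF inj] by auto
    then obtain v where v: "v \<in> V - T" "{x, y} = {v, par v}" by auto
    then consider "x = v" "y = par v" | "y = v" "x = par v" by (auto simp: doubleton_eq_iff)
    then show ?case
    proof cases
      case 1
      then have "x \<noteq> z" using pz \<open>y \<notin> T\<close> by auto
      then show ?thesis using anc_first[OF step.IH] 1 by simp
    next
      case 2
      then have "(y, x) \<in> anc" using v by auto
      then show ?thesis using step.IH by (rule converse_rtrancl_into_rtrancl)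
    qed
  qed simp
  moreover have "par z' \<in> T" using par_eq[OF en(2)] en(2) by (simp add: enters_def)
  ultimately have "z' = z"
    using anc_first[of z' z] anc_first[of "par z'" z] en(1) by (auto simp: enters_def)
  then show ?thesis using par_eq en by metis
qed

text \<open>A path in the forest started from \<open>T\<close> survives in the one started from the
  smaller set \<open>S\<close>, so entry points for contracted sets speak about the original
  trees.\<close>

lemma enters_connected:
  assumes "enters E w T u z b" "S \<subseteq> T"
  shows "(u, b) \<in> (adj (kruskal E w S))\<^sup>*"
proof -
  have "{(x, y). x \<notin> T \<and> y \<notin> T \<and> {x, y} \<in> kruskal E w T} \<subseteq> adj (kruskal E w S)"
    using kruskal_antimono[OF assms(2), of E w] by (auto simp: adj_def)
  then have "(u, z) \<in> (adj (kruskal E w S))\<^sup>*"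
    using assms(1) rtrancl_mono unfolding enters_def by blast
  moreover have "(z, b) \<in> adj (kruskal E w S)"
    using assms kruskal_antimono[OF assms(2), of E w] by (auto simp: enters_def adj_def)
  ultimately show ?thesis by (rule rtrancl_into_rtrancl)
qed

subsection \<open>Exchanging two edges into a set\<close>

locale edge_exchange =
  fixes E :: "'v set set" and T :: "'v set" and w :: "'v set \<Rightarrow> real" and a a' z :: 'v
  assumes aT: "a \<in> T" "a' \<in> T" and zT: "z \<notin> T" and aE: "{a, z} \<in> E" "{a', z} \<in> E"
begin

abbreviation "w' \<equiv> w \<circ> Transposition.transpose {a, z} {a', z}"

lemma w'_simps: "w' {a, z} = w {a', z}" "w' {a', z} = w {a, z}"
  "e \<noteq> {a, z} \<Longrightarrow> e \<noteq> {a', z} \<Longrightarrow> w' e = w e"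
  by (auto simp: Transposition.transpose_def)

text \<open>After contraction of \<open>T\<close> the edges \<open>{a, z}\<close> and
  \<open>{a', z}\<close> are parallel. At each level it only matters whether one of them is light,
  and this does not change when their weights are swapped. The general \<open>v\<close>,
  \<open>v'\<close> serve both inclusions.\<close>

lemma connected_subset:
  assumes "\<And>e. e \<noteq> {a, z} \<Longrightarrow> e \<noteq> {a', z} \<Longrightarrow> v' e = v e" "v' {a, z} = v {a', z}" "v' {a', z} = v {a, z}"
  shows "(adj (below E v' t) \<union> T \<times> T)\<^sup>* \<subseteq> (adj (below E v t) \<union> T \<times> T)\<^sup>*"
proof (rule rtrancl_subset_rtrancl, rule subsetI)
  let ?R = "adj (below E v t) \<union> T \<times> T"
  have sw: "(c, z) \<in> ?R\<^sup>* \<and> (z, c) \<in> ?R\<^sup>*"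
    if "{c', z} \<in> below E v t" "c \<in> T" "c' \<in> T" for c c'
  proof -
    have "(c, c') \<in> ?R" "(c', c) \<in> ?R" "(c', z) \<in> ?R" "(z, c') \<in> ?R"
      using that by (auto simp: adj_def insert_commute)
    then show ?thesis by (meson converse_rtrancl_into_rtrancl r_into_rtrancl)
  qed
  fix xy assume "xy \<in> adj (below E v' t) \<union> T \<times> T"
  then show "xy \<in> ?R\<^sup>*"
  proof
    assume "xy \<in> T \<times> T" then show ?thesis by auto
  next
    assume "xy \<in> adj (below E v' t)"
    then obtain x y where xy: "xy = (x, y)" "{x, y} \<in> E" "v' {x, y} < t" by (auto simp: adj_def below_def)
    consider "{x, y} = {a, z}" | "{x, y} = {a', z}" | "{x, y} \<noteq> {a, z}" "{x, y} \<noteq> {a', z}" by blast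
    then show ?thesis
    proof cases
      case 1
      then have "{a', z} \<in> below E v t" using xy assms(2) aE by (auto simp: below_def)
      then show ?thesis using sw[of a' a] 1 xy(1) aT by (auto simp: doubleton_eq_iff)
    next
      case 2
      then have "{a, z} \<in> below E v t" using xy assms(3) aE by (auto simp: below_def)
      then show ?thesis using sw[of a a'] 2 xy(1) aT by (auto simp: doubleton_eq_iff)
    next
      case 3
      then have "{x, y} \<in> below E v t" using xy assms(1)[of "{x, y}"] by (simp add: below_def)
      then show ?thesis using xy(1) by (auto simp: adj_def)
    qed
  qed
qed

lemma connected_eq:
  "(adj (below E w' t) \<union> T \<times> T)\<^sup>* = (adj (below E w t) \<union> T \<times> T)\<^sup>*"
  using connected_subset[of w' w] connected_subset[of w w'] w'_simps by (intro equalityI) simp_all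

lemma kruskal_other:
  "e \<noteq> {a, z} \<Longrightarrow> e \<noteq> {a', z} \<Longrightarrow> e \<in> kruskal E w' T \<longleftrightarrow> e \<in> kruskal E w T"
  unfolding kruskal_def mem_Collect_eq connected_eq using w'_simps(3)[of e] by simp

lemma kruskal_exchanged:
  assumes "{a', z} \<in> kruskal E w T"
  shows "{a, z} \<in> kruskal E w' T"
proof -
  let ?R = "adj (below E w (w {a', z})) \<union> T \<times> T"
  have no: "(a', z) \<notin> ?R\<^sup>*" using assms by (simp add: kruskal_def)
  have no': "(x, y) \<notin> ?R\<^sup>*" if "{a, z} = {x, y}" for x y
  proof
    assume R: "(x, y) \<in> ?R\<^sup>*"
    have "(a, z) \<in> ?R\<^sup>*"
      using that R rtrancl_adj_Un_sym[OF R] by (auto simp: doubleton_eq_iff)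
    moreover have "(a', a) \<in> ?R" using aT by simp
    ultimately show False using no converse_rtrancl_into_rtrancl by metis
  qed
  show ?thesis
    unfolding kruskal_def mem_Collect_eq connected_eq w'_simps(1)
    by (intro conjI allI impI aE no')
qed

text \<open>A forest edge with both ends outside \<open>T\<close> is not one of the exchanged edges,
  so the path up to the exit vertex is unaffected. Only the entry edge moves, from \<open>a'\<close>
  to \<open>a\<close>, and only if the exit vertex is \<open>z\<close>.\<close>

lemma enters_exchanged:
  assumes "enters E w T u z0 b" and zb: "z0 \<noteq> z \<and> b' = b \<or> z0 = z \<and> b = a' \<and> b' = a"
  shows "enters E w' T u z0 b'"
proof -
  have R: "{(x, y). x \<notin> T \<and> y \<notin> T \<and> {x, y} \<in> kruskal E w' T} =
      {(x, y). x \<notin> T \<and> y \<notin> T \<and> {x, y} \<in> kruskal E w T}"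
  proof -
    have "{x, y} \<in> kruskal E w' T \<longleftrightarrow> {x, y} \<in> kruskal E w T" if "x \<notin> T" "y \<notin> T" for x y
      using that aT by (intro kruskal_other) (auto simp: doubleton_eq_iff)
    then show ?thesis by blast
  qed
  have "{z0, b'} \<in> kruskal E w' T"
    using zb
  proof
    assume z0: "z0 \<noteq> z \<and> b' = b"
    then have "{z0, b} \<noteq> {a, z}" "{z0, b} \<noteq> {a', z}"
      using assms(1) aT zT by (auto simp: enters_def doubleton_eq_iff)
    then show ?thesis using assms(1) z0 kruskal_other by (simp add: enters_def)
  next
    assume "z0 = z \<and> b = a' \<and> b' = a"
    then show ?thesis using assms(1) kruskal_exchanged by (simp add: enters_def insert_commute)
  qed
  moreover have "b' \<in> T" using zb assms(1) aT by (auto simp: enters_def)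
  ultimately show ?thesis using assms(1) by (simp add: enters_def R)
qed

end

subsection \<open>Trees of the forest and clusters of light edges\<close>

context invasion_tree
begin

context
  fixes p :: real and X :: "'v set set" and D :: "'v set"
  assumes X: "X = {e \<in> E. w e \<le> p}" and D: "D = cluster X S"
begin

lemma X_subset_below: "p < t \<Longrightarrow> X \<subseteq> below E w t"
  by (auto simp: X below_def)

text \<open>\<open>source_path\<close> is applied at the level of the entering weight itself: if
  that weight exceeded \<open>p\<close>, all edges of \<open>X\<close> would be strictly below
  it.\<close>

lemma source_cluster_par:
  assumes h: "h \<in> D" "h \<in> V - S"
  shows "{h, par h} \<in> X"
proof -
  obtain s where s: "s \<in> S" "(s, h) \<in> (adj X)\<^sup>*" using h D by (auto simp: cluster_def)
  have "w {h, par h} \<le> p"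
  proof (rule ccontr)
    assume "\<not> w {h, par h} \<le> p"
    then have "X \<subseteq> below E w (w {h, par h})" by (intro X_subset_below) simp
    from source_path[OF h(2) s(1) rtrancl_adj_mono[OF this s(2)]] show False by simp
  qed
  then show ?thesis using par_edge[OF h(2)] by (simp add: X)
qed

lemma source_cluster_anc:
  assumes "(h, y) \<in> anc\<^sup>*" "h \<in> D"
  shows "y \<in> D \<and> y \<in> cluster X {h}"
  using assms(1)
proof (induction rule: rtrancl_induct)
  case base
  then show ?case using assms by (simp add: self_mem_cluster)
next
  case (step x y)
  then have "(x, y) \<in> adj X" using source_cluster_par[of x] by (auto simp: adj_def)
  then show ?case using step.IH D cluster_step[of x X _ y] by auto
qed

text \<open>Each ancestor in turn is reached from \<open>s\<close> below \<open>t\<close>, so by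
  \<open>source_path\<close> its own edge is below \<open>t\<close> as well.\<close>

lemma lighter_anc:
  assumes "s \<in> S" "(s, h) \<in> (adj (below E w t))\<^sup>*" "(h, y) \<in> anc\<^sup>*"
  shows "(h, y) \<in> (adj (below E w t))\<^sup>*"
proof -
  have "(h, y) \<in> (adj (below E w t))\<^sup>* \<and> (s, y) \<in> (adj (below E w t))\<^sup>*"
    using assms(3)
  proof (induction rule: rtrancl_induct)
    case base
    then show ?case using assms by simp
  next
    case (step x y)
    then have x: "x \<in> V - S" "y = par x" by auto
    from source_path[OF x(1) assms(1)] step.IH have "w {x, y} < t" using x by simp
    then have "(x, y) \<in> adj (below E w t)" using par_edge[OF x(1)] x by (simp add: adj_def below_def)
    then show ?case using step.IH by (meson rtrancl_into_rtrancl)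
  qed
  then show ?thesis ..
qed

text \<open>Ranks decrease along ancestors, so \<open>x\<close> is where the path of
  \<open>u\<close> first meets the component \<open>K\<close> of \<open>x\<close>. The edges of the
  path before \<open>x\<close> must survive the contraction of \<open>K \<union> D\<close>. A
  lighter shortcut from \<open>h\<close> to \<open>par h\<close> would enter and leave
  \<open>K \<union> D\<close>. It cannot enter via \<open>D\<close>, as then a source would reach
  \<open>h\<close> below the weight of its own edge; so it joins \<open>h\<close> to
  \<open>x\<close>, and either way of leaving joins \<open>x\<close> to \<open>par h\<close>, which
  closes a lighter path that the original forest forbids.\<close>

lemma enters_along_ancestors:
  assumes inj: "inj_on w E" and u: "u \<in> V" "(u, x) \<in> anc\<^sup>*" "u \<noteq> x"
    and first: "\<And>y. (u, y) \<in> anc\<^sup>* \<Longrightarrow> y \<in> cluster X {x} \<Longrightarrow> rank y \<le> rank x"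
  shows "\<exists>g. enters E w (cluster X {x} \<union> D) u g x \<and> (u, g) \<in> anc\<^sup>* \<and> rank x < rank g"
proof -
  define K where "K = cluster X {x}"
  define T where "T = K \<union> D"
  obtain g where g: "g \<in> V - S" "(u, g) \<in> anc\<^sup>*" "par g = x" using anc_last[OF u(2,3)] by auto
  have rg: "rank x < rank g" using rank_par[OF g(1)] g(3) by simp
  have SD: "S \<subseteq> D" by (simp add: D subset_cluster)
  have xK: "x \<in> K" by (simp add: K_def self_mem_cluster)
  have gx: "(g, x) \<in> anc" using g by auto
  have Tclosed: "h \<in> T" if "(h, t) \<in> (adj X)\<^sup>*" "t \<in> T" for h t
    using that cluster_step[of t X _ h] rtrancl_adj_sym[OF that(1)] by (auto simp: T_def K_def D)
  have out: "h \<in> V - S \<and> h \<notin> T \<and> (par h, x) \<in> anc\<^sup>*"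
    if h: "(u, h) \<in> anc\<^sup>*" "(h, g) \<in> anc\<^sup>*" for h
  proof -
    have hx: "(h, x) \<in> anc\<^sup>*" using h(2) gx by (rule rtrancl_into_rtrancl)
    have "rank g \<le> rank h" using anc_rank[OF h(2)] by auto
    then have lt: "rank x < rank h" using rg by simp
    have "h \<notin> K" using first[OF h(1)] lt by (auto simp: K_def)
    moreover have "h \<notin> D"
    proof
      assume "h \<in> D"
      then have "x \<in> cluster X {h}" using source_cluster_anc[OF hx] by simp
      then have "cluster X {h} = K" using cluster_singleton_eq K_def by metis
      with \<open>h \<notin> K\<close> self_mem_cluster[of h X] show False by simp
    qed
    ultimately have "h \<notin> T" by (simp add: T_def)
    moreover have "h \<noteq> x" using lt by auto
    ultimately show ?thesis using anc_first[OF hx] by simp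
  qed
  have kr: "{h, par h} \<in> kruskal E w T" if h: "(u, h) \<in> anc\<^sup>*" "(h, g) \<in> anc\<^sup>*" for h
  proof -
    have hVS: "h \<in> V - S" and hT: "h \<notin> T" and px: "(par h, x) \<in> anc\<^sup>*" using out[OF h] by auto
    define R where "R = adj (below E w (w {h, par h}))"
    have symR: "(c, d) \<in> R\<^sup>* \<Longrightarrow> (d, c) \<in> R\<^sup>*" for c d unfolding R_def by (rule rtrancl_adj_sym)
    have "{h, par h} \<in> kruskal E w S" using F_subset_kruskal hVS by auto
    then have nS: "(h, par h) \<notin> (R \<union> S \<times> S)\<^sup>*" by (simp add: kruskal_def R_def)
    then have nR: "(h, par h) \<notin> R\<^sup>*" using rtrancl_mono[of R "R \<union> S \<times> S"] by blast
    have nh: "(s, h) \<notin> R\<^sup>*" if "s \<in> S" for s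
      using source_path[OF hVS that, of "w {h, par h}"] by (auto simp: R_def)
    have "(h, par h) \<notin> (R \<union> T \<times> T)\<^sup>*"
    proof
      assume "(h, par h) \<in> (R \<union> T \<times> T)\<^sup>*"
      then obtain t t' where t: "t \<in> T" "t' \<in> T" "(h, t) \<in> R\<^sup>*" "(t', par h) \<in> R\<^sup>*"
        using rtrancl_Un_Times nR by metis
      \<comment> \<open>At a weight of at most \<open>p\<close> the shortcut would lie in
        \<open>X\<close> and put \<open>h\<close> into \<open>T\<close>. Above \<open>p\<close> all
        of \<open>X\<close> counts as lighter, so components can be traversed freely.\<close>
      have "p < w {h, par h}"
      proof (rule ccontr)
        assume "\<not> p < w {h, par h}"
        then have "below E w (w {h, par h}) \<subseteq> X" by (auto simp: X below_def)
        then have "(h, t) \<in> (adj X)\<^sup>*" using t(3) rtrancl_adj_mono unfolding R_def by metis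
        then show False using Tclosed t(1) hT by blast
      qed
      then have XR: "(c, d) \<in> (adj X)\<^sup>* \<Longrightarrow> (c, d) \<in> R\<^sup>*" for c d
        unfolding R_def by (intro rtrancl_adj_mono[OF X_subset_below])
      have DR: "\<exists>s\<in>S. (s, c) \<in> R\<^sup>*" if "c \<in> D" for c
        using that XR unfolding D cluster_def by blast
      have KR: "(x, c) \<in> R\<^sup>*" if "c \<in> K" for c
        using that XR by (simp add: K_def mem_cluster_singleton)
      have "t \<notin> D" using DR[of t] nh symR[OF t(3)] rtrancl_trans by metis
      then have tK: "t \<in> K" using t(1) by (simp add: T_def)
      have hx: "(h, x) \<in> R\<^sup>*" using t(3) symR[OF KR[OF tK]] by (rule rtrancl_trans)
      \<comment> \<open>If the shortcut leaves through \<open>D\<close>, a source reaches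
        \<open>par h\<close> by lighter edges, and then the tree edges from \<open>par h\<close> up
        to \<open>x\<close> are lighter too.\<close>
      have "(x, par h) \<in> R\<^sup>*"
      proof (cases "t' \<in> K")
        case True
        then show ?thesis using KR t(4) rtrancl_trans by metis
      next
        case False
        then have "t' \<in> D" using t(2) by (simp add: T_def)
        then obtain s where s: "s \<in> S" "(s, t') \<in> R\<^sup>*" using DR by blast
        then have "(s, par h) \<in> R\<^sup>*" using t(4) rtrancl_trans by metis
        then have "(par h, x) \<in> R\<^sup>*" using lighter_anc[OF s(1) _ px] by (simp add: R_def)
        then show ?thesis by (rule symR)
      qed
      with hx nR show False using rtrancl_trans by metis
    qed
    moreover have "(par h, h) \<notin> (R \<union> T \<times> T)\<^sup>*"
      using calculation rtrancl_adj_Un_sym unfolding R_def by metis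
    ultimately show ?thesis
      using par_edge[OF hVS] unfolding kruskal_def R_def by (auto simp: doubleton_eq_iff insert_commute)
  qed
  have "(u, h) \<in> {(c, d). c \<notin> T \<and> d \<notin> T \<and> {c, d} \<in> kruskal E w T}\<^sup>*"
    if h: "(u, h) \<in> anc\<^sup>*" "(h, g) \<in> anc\<^sup>*" for h
    using that
  proof (induction rule: rtrancl_induct)
    case (step y z)
    then have yg: "(y, g) \<in> anc\<^sup>*" by (meson converse_rtrancl_into_rtrancl)
    have uz: "(u, z) \<in> anc\<^sup>*" using step.hyps by (rule rtrancl_into_rtrancl)
    have "z = par y" using step.hyps(2) by auto
    then have "(y, z) \<in> {(c, d). c \<notin> T \<and> d \<notin> T \<and> {c, d} \<in> kruskal E w T}"
      using out[OF step.hyps(1) yg] out[OF uz step.prems] kr[OF step.hyps(1) yg] by auto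
    with step.IH[OF yg] show ?case by (rule rtrancl_into_rtrancl)
  qed simp
  from this[OF g(2)] have "enters E w T u g x"
    using out[OF g(2)] out[of u] g kr[OF g(2)] xK by (auto simp: enters_def T_def)
  then show ?thesis using g rg by (auto simp: T_def K_def)
qed

text \<open>\<open>x\<close> is the first vertex on the path of \<open>u\<close> whose component
  \<open>K\<close> contains an ancestor of \<open>v\<close>, and \<open>y\<close> is the first
  ancestor of \<open>v\<close> in \<open>K\<close>. In the first three cases \<open>u\<close> or
  \<open>v\<close> itself lies in \<open>K\<close>; in the last one both paths enter
  \<open>K\<close> from outside.\<close>

lemma same_tree_cases:
  assumes inj: "inj_on w E" and uv: "u \<in> V" "v \<in> V" "(u, v) \<in> (adj F)\<^sup>*"
  shows "v \<in> cluster X {u} \<or>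
    (\<exists>z. \<exists>b\<in>cluster X {u}. enters E w (cluster X {u} \<union> D) v z b) \<or>
    (\<exists>z. \<exists>b\<in>cluster X {v}. enters E w (cluster X {v} \<union> D) u z b) \<or>
    (\<exists>K\<in>(\<lambda>x. cluster X {x}) ` V. \<exists>z z'. z \<noteq> z' \<and>
      (\<exists>b\<in>K. \<exists>b'\<in>K. enters E w (K \<union> D) u z b \<and> enters E w (K \<union> D) v z' b'))"
    (is "_ \<or> ?B \<or> ?C \<or> ?D")
proof -
  obtain c where c: "(u, c) \<in> anc\<^sup>*" "(v, c) \<in> anc\<^sup>*" using common_ancestor[OF uv(3)] by blast
  define met where "met x \<longleftrightarrow> (\<exists>y. (v, y) \<in> anc\<^sup>* \<and> y \<in> cluster X {x})" for x
  have max: "\<exists>x. (u, x) \<in> anc\<^sup>* \<and> Q x \<and> (\<forall>y. (u, y) \<in> anc\<^sup>* \<longrightarrow> Q y \<longrightarrow> rank y \<le> rank x)"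
    if "(u, a) \<in> anc\<^sup>*" "Q a" for u a Q
  proof -
    have "\<exists>x. ((u, x) \<in> anc\<^sup>* \<and> Q x) \<and> (\<forall>y. (u, y) \<in> anc\<^sup>* \<and> Q y \<longrightarrow> rank y \<le> rank x)"
    proof (rule ex_has_greatest_nat)
      show "(u, a) \<in> anc\<^sup>* \<and> Q a" using that by simp
      show "\<forall>y. (u, y) \<in> anc\<^sup>* \<and> Q y \<longrightarrow> rank y < Suc (rank u)" using anc_rank by fastforce
    qed
    then show ?thesis by blast
  qed
  have "met c" using c by (auto simp: met_def self_mem_cluster)
  then obtain x where x: "(u, x) \<in> anc\<^sup>*" "met x"
      "\<And>y. (u, y) \<in> anc\<^sup>* \<Longrightarrow> met y \<Longrightarrow> rank y \<le> rank x"
    using max[of u c met] c by blast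
  define K where "K = cluster X {x}"
  obtain y where y: "(v, y) \<in> anc\<^sup>*" "y \<in> K" "\<And>y'. (v, y') \<in> anc\<^sup>* \<Longrightarrow> y' \<in> K \<Longrightarrow> rank y' \<le> rank y"
    using max[of v _ "\<lambda>y. y \<in> K"] x(2) unfolding met_def K_def by blast
  have Ky: "K = cluster X {y}" using y(2) cluster_singleton_eq K_def by metis
  have xK: "x \<in> K" by (simp add: K_def self_mem_cluster)
  have firstx: "rank x' \<le> rank x" if "(u, x') \<in> anc\<^sup>*" "x' \<in> cluster X {x}" for x'
  proof (rule x(3)[OF that(1)])
    have "cluster X {x'} = K" using that(2) cluster_singleton_eq K_def by metis
    then show "met x'" using y unfolding met_def by blast
  qed
  have eu: "\<exists>g. enters E w (K \<union> D) u g x \<and> (u, g) \<in> anc\<^sup>* \<and> rank x < rank g" if "u \<noteq> x"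
    unfolding K_def by (rule enters_along_ancestors[OF inj uv(1) x(1) that firstx])
  have ev: "\<exists>g. enters E w (K \<union> D) v g y \<and> (v, g) \<in> anc\<^sup>* \<and> rank y < rank g" if "v \<noteq> y"
    unfolding Ky by (rule enters_along_ancestors[OF inj uv(2) y(1) that]) (use y(3) Ky in auto)
  show ?thesis
  proof (cases "u = x")
    case True
    show ?thesis
    proof (cases "v = y")
      case False
      then obtain g where "enters E w (K \<union> D) v g y" using ev by blast
      moreover have "K = cluster X {u}" using True by (simp add: K_def)
      ultimately have ?B using y(2) by metis
      then show ?thesis by simp
    qed (use True y(2) in \<open>simp add: K_def\<close>)
  next
    case ux: False
    then obtain g where g: "enters E w (K \<union> D) u g x" "(u, g) \<in> anc\<^sup>*" "rank x < rank g"
      using eu by blast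
    show ?thesis
    proof (cases "v = y")
      case True
      then have "K = cluster X {v}" using Ky by simp
      then have ?C using g(1) xK by metis
      then show ?thesis by simp
    next
      case False
      then obtain g' where g': "enters E w (K \<union> D) v g' y" "(v, g') \<in> anc\<^sup>*" using ev by blast
      \<comment> \<open>\<open>g\<close> precedes \<open>x\<close> on the path of \<open>u\<close>,
        so its component contains no ancestor of \<open>v\<close>. As \<open>g'\<close> is such an
        ancestor, the exit vertices differ.\<close>
      have "\<not> met g" using x(3)[OF g(2)] g(3) by auto
      then have "g \<noteq> g'" using g'(2) by (auto simp: met_def self_mem_cluster)
      moreover have "K \<in> (\<lambda>x. cluster X {x}) ` V" using anc_in_V[OF x(1) uv(1)] by (auto simp: K_def)
      ultimately have ?D
        using g(1) g'(1) xK y(2) by (intro bexI[of _ K] exI[of _ g] exI[of _ g'] conjI) auto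
      then show ?thesis by simp
    qed
  qed
qed

text \<open>For adjacent \<open>y\<close>, \<open>y'\<close> in \<open>L\<close>, forest edges of
  weight at most \<open>p\<close> join them unless the connection jumps between sources, and this
  would connect \<open>L\<close> to a source within \<open>X\<close>. So a source-free component
  lies in one tree, and entering it means joining that tree.\<close>

lemma cluster_same_tree:
  assumes inj: "inj_on w E" and L: "L = cluster X {x}" "x \<in> V" "L \<inter> S = {}"
    and T: "S \<subseteq> T" and v: "v \<in> L \<or> (\<exists>z. \<exists>b\<in>L. enters E w T v z b)"
  shows "(x, v) \<in> (adj F)\<^sup>*"
proof -
  have conn: "(x, b) \<in> (adj F)\<^sup>*" if "b \<in> L" for b
  proof -
    have "(x, b) \<in> (adj X)\<^sup>*" using that by (simp add: L mem_cluster_singleton)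
    then show ?thesis
    proof (induction rule: rtrancl_induct)
      case (step y y')
      then have yy: "{y, y'} \<in> E" "w {y, y'} \<le> p" by (auto simp: adj_def X)
      let ?G = "{f \<in> F. w f \<le> w {y, y'}}"
      have "F \<subseteq> E" using F_subset_kruskal kruskal_subset by (rule subset_trans)
      then have GX: "?G \<subseteq> X" using yy by (auto simp: X)
      have "(y, y') \<in> (adj ?G)\<^sup>*"
      proof (rule ccontr)
        assume "(y, y') \<notin> (adj ?G)\<^sup>*"
        then obtain t where t: "t \<in> S" "(y, t) \<in> (adj ?G)\<^sup>*"
          using rtrancl_Un_Times[OF edge_connected_by_lighter_F[OF yy(1)]] by blast
        have "(x, t) \<in> (adj X)\<^sup>*"
          using step.hyps(1) rtrancl_adj_mono[OF GX t(2)] by (rule rtrancl_trans)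
        then show False using t(1) L by (auto simp: mem_cluster_singleton)
      qed
      then have "(y, y') \<in> (adj F)\<^sup>*" by (rule rtrancl_adj_mono[rotated]) auto
      with step.IH show ?case by (rule rtrancl_trans)
    qed simp
  qed
  show ?thesis
    using v
  proof
    assume "\<exists>z. \<exists>b\<in>L. enters E w T v z b"
    then obtain z b where b: "b \<in> L" "enters E w T v z b" by blast
    have "(v, b) \<in> (adj F)\<^sup>*" using enters_connected[OF b(2) T] kruskal_eq_F[OF inj] by simp
    then show ?thesis using conn[OF b(1)] by (meson rtrancl_adj_sym rtrancl_trans)
  qed (rule conn)
qed

end

end

subsection \<open>Binomial random graphs as finite sums\<close>

text \<open>The probability that a binomial random subset of \<open>E\<close> equals
  \<open>X\<close>. Finite sums keep the random-graph estimates free of measure theory;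
  \<open>Pr_light\<close> makes the connection.\<close>

definition gnp :: "'e set \<Rightarrow> real \<Rightarrow> 'e set \<Rightarrow> real" where
  "gnp E p X = p ^ card X * (1 - p) ^ card (E - X)"

lemma gnp_nonneg: "0 \<le> p \<Longrightarrow> p \<le> 1 \<Longrightarrow> 0 \<le> gnp E p X"
  by (simp add: gnp_def)

lemma sum_Pow_power_card:
  fixes x y :: real
  assumes "finite A"
  shows "(\<Sum>X\<in>Pow A. x ^ card X * y ^ card (A - X)) = (x + y) ^ card A"
  using prod_add[OF assms, of "\<lambda>_. x" "\<lambda>_. y"] by simp

lemma sum_gnp: "finite E \<Longrightarrow> (\<Sum>X\<in>Pow E. gnp E p X) = 1"
  by (simp add: gnp_def sum_Pow_power_card)

text \<open>Independence of disjoint sets of edges, as a Fubini formula.\<close>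

lemma sum_gnp_Un:
  assumes fin: "finite E1" "finite E2" and disj: "E1 \<inter> E2 = {}"
  shows "(\<Sum>X\<in>Pow (E1 \<union> E2). gnp (E1 \<union> E2) p X * f X) =
    (\<Sum>X1\<in>Pow E1. \<Sum>X2\<in>Pow E2. gnp E1 p X1 * gnp E2 p X2 * f (X1 \<union> X2))"
proof -
  have "(\<Sum>X\<in>Pow (E1 \<union> E2). gnp (E1 \<union> E2) p X * f X) =
      (\<Sum>(X1, X2)\<in>Pow E1 \<times> Pow E2. gnp E1 p X1 * gnp E2 p X2 * f (X1 \<union> X2))"
  proof (rule sum.reindex_bij_witness[of _ "\<lambda>(X1, X2). X1 \<union> X2" "\<lambda>X. (X \<inter> E1, X \<inter> E2)"])
    fix X assume X: "X \<in> Pow (E1 \<union> E2)"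
    have "finite X" using X fin by (auto intro: finite_subset)
    have c1: "card X = card (X \<inter> E1) + card (X \<inter> E2)"
    proof -
      have "card ((X \<inter> E1) \<union> (X \<inter> E2)) = card (X \<inter> E1) + card (X \<inter> E2)"
        using \<open>finite X\<close> disj by (intro card_Un_disjoint) auto
      moreover have "(X \<inter> E1) \<union> (X \<inter> E2) = X" using X by auto
      ultimately show ?thesis by simp
    qed
    have c2: "card ((E1 \<union> E2) - X) = card (E1 - X \<inter> E1) + card (E2 - X \<inter> E2)"
    proof -
      have "card ((E1 - X \<inter> E1) \<union> (E2 - X \<inter> E2)) = card (E1 - X \<inter> E1) + card (E2 - X \<inter> E2)"
        using fin disj by (intro card_Un_disjoint) auto
      moreover have "(E1 - X \<inter> E1) \<union> (E2 - X \<inter> E2) = (E1 \<union> E2) - X" by auto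
      ultimately show ?thesis by simp
    qed
    have "X \<inter> E1 \<union> X \<inter> E2 = X" using X by auto
    then show "(case (X \<inter> E1, X \<inter> E2) of (X1, X2) \<Rightarrow> gnp E1 p X1 * gnp E2 p X2 * f (X1 \<union> X2))
        = gnp (E1 \<union> E2) p X * f X"
      by (simp add: gnp_def c1 c2 power_add)
  qed (use disj in auto)
  then show ?thesis by (simp add: sum.cartesian_product)
qed

lemma sum_gnp_avoid:
  assumes fin: "finite E" and C: "C \<subseteq> E"
  shows "(\<Sum>X\<in>Pow E. gnp E p X * (if X \<inter> C = {} then c else 0)) = c * (1 - p) ^ card C"
proof -
  have E: "E = (E - C) \<union> C" using C by auto
  have fC: "finite C" using fin C by (rule rev_finite_subset)
  have "(\<Sum>X\<in>Pow E. gnp E p X * (if X \<inter> C = {} then c else 0)) =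
     (\<Sum>X1\<in>Pow (E - C). \<Sum>X2\<in>Pow C. gnp (E - C) p X1 * gnp C p X2 * (if (X1 \<union> X2) \<inter> C = {} then c else 0))"
    using sum_gnp_Un[of "E - C" C p "\<lambda>X. if X \<inter> C = {} then c else 0"] fin fC E by auto
  also have "\<dots> = (\<Sum>X1\<in>Pow (E - C). gnp (E - C) p X1 * (c * (1 - p) ^ card C))"
  proof (rule sum.cong[OF refl])
    fix X1 assume X1: "X1 \<in> Pow (E - C)"
    have "(\<Sum>X2\<in>Pow C. gnp (E - C) p X1 * gnp C p X2 * (if (X1 \<union> X2) \<inter> C = {} then c else 0)) =
       (\<Sum>X2\<in>Pow C. if X2 = {} then gnp (E - C) p X1 * gnp C p {} * c else 0)"
      by (rule sum.cong[OF refl]) (use X1 in auto)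
    also have "\<dots> = gnp (E - C) p X1 * gnp C p {} * c"
      using fC by (subst sum.delta) auto
    finally show "(\<Sum>X2\<in>Pow C. gnp (E - C) p X1 * gnp C p X2 * (if (X1 \<union> X2) \<inter> C = {} then c else 0))
      = gnp (E - C) p X1 * (c * (1 - p) ^ card C)" by (simp add: gnp_def)
  qed
  also have "\<dots> = c * (1 - p) ^ card C"
    using sum_gnp[of "E - C" p] fin by (simp flip: sum_distrib_right)
  finally show ?thesis .
qed

text \<open>The edges from \<open>B\<close> to the cluster of \<open>S\<close> in the graph without \<open>B\<close> are independent of that
  cluster. Averaging the following identity over \<open>B\<close> gives the law of the cluster size.\<close>

lemma cluster_avoid_identity:
  assumes fin: "finite V" and S: "S \<subseteq> V" and B: "B \<subseteq> V - S" and p: "p < 1"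
  defines "E \<equiv> nsets V 2"
  shows "(\<Sum>X\<in>Pow E. gnp E p X *
     (if cluster X S \<inter> B = {} then inverse ((1 - p) ^ (card (cluster X S) * card B)) else 0)) = 1"
proof -
  \<comment> \<open>\<open>E1\<close> is the edge set of the graph without \<open>B\<close>, which
    determines the cluster \<open>A\<close> below; \<open>E2\<close> is revealed afterwards.\<close>
  define E1 where "E1 = {e \<in> E. e \<inter> B = {}}"
  define E2 where "E2 = {e \<in> E. e \<inter> B \<noteq> {}}"
  have finE: "finite E" unfolding E_def by (rule finite_imp_finite_nsets[OF fin])
  have E12: "E1 \<union> E2 = E" "E1 \<inter> E2 = {}" "finite E1" "finite E2"
    using finE by (auto simp: E1_def E2_def)
  have E1V: "E1 \<subseteq> nsets (V - B) 2" by (auto simp: E1_def E_def nsets_def)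
  define cut where "cut A = (\<lambda>(a, b). {a, b}) ` (A \<times> B)" for A
  define h where "h X = (if cluster X S \<inter> B = {}
    then inverse ((1 - p) ^ (card (cluster X S) * card B)) else 0)" for X
  have inner: "(\<Sum>X2\<in>Pow E2. gnp E1 p X1 * gnp E2 p X2 * h (X1 \<union> X2)) = gnp E1 p X1"
    if X1: "X1 \<in> Pow E1" for X1
  proof -
    define A where "A = cluster X1 S"
    have AV: "A \<subseteq> V - B"
      unfolding A_def by (rule cluster_subset) (use X1 E1V S B in auto)
    have cutE: "cut A \<subseteq> E2"
      using AV B by (auto simp: cut_def E2_def E_def)
    have "inj_on (\<lambda>(a, b). {a, b}) (A \<times> B)"
      using AV by (auto simp: inj_on_def doubleton_eq_iff)
    then have card_cut: "card (cut A) = card A * card B"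
      by (simp add: cut_def card_image card_cartesian_product)
    define c where "c = inverse ((1 - p) ^ (card A * card B))"
    \<comment> \<open>Given \<open>X1\<close>, the full cluster avoids \<open>B\<close> exactly when
      no edge between \<open>A\<close> and \<open>B\<close> is present, and then it is
      \<open>A\<close> itself. The factor \<open>c\<close> is the inverse of that probability, so it
      cancels on averaging over \<open>X2\<close>.\<close>
    have h_eq: "h (X1 \<union> X2) = (if X2 \<inter> cut A = {} then c else 0)" if X2: "X2 \<in> Pow E2" for X2
    proof (cases "X2 \<inter> cut A = {}")
      case True
      have "cluster (X1 \<union> X2) S = A"
      proof (rule cluster_eqI)
        show "S \<subseteq> A" by (simp add: A_def subset_cluster)
        show "A \<subseteq> cluster (X1 \<union> X2) S" unfolding A_def by (rule cluster_mono) simp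
        fix x y assume xy: "x \<in> A" "y \<notin> A"
        have "{x, y} \<notin> X1"
        proof
          assume "{x, y} \<in> X1"
          then have "(x, y) \<in> (adj X1)\<^sup>*" by (auto simp: adj_def)
          with xy cluster_step[of x X1 S y] show False by (simp add: A_def)
        qed
        moreover have "{x, y} \<notin> X2"
        proof
          assume e: "{x, y} \<in> X2"
          then have "{x, y} \<inter> B \<noteq> {}" using X2 by (auto simp: E2_def)
          moreover have "x \<notin> B" using AV xy by auto
          ultimately have "{x, y} \<in> cut A" using xy by (auto simp: cut_def)
          with e True show False by auto
        qed
        ultimately show "{x, y} \<notin> X1 \<union> X2" by simp
      qed
      then show ?thesis using True AV by (auto simp: h_def c_def)
    next
      case False
      then obtain a b where ab: "a \<in> A" "b \<in> B" "{a, b} \<in> X2" by (auto simp: cut_def)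
      have "a \<in> cluster (X1 \<union> X2) S"
        using ab(1) cluster_mono[of X1 "X1 \<union> X2" S] by (auto simp: A_def)
      moreover have "(a, b) \<in> (adj (X1 \<union> X2))\<^sup>*" using ab by (auto simp: adj_def)
      ultimately have "b \<in> cluster (X1 \<union> X2) S" by (rule cluster_step)
      then show ?thesis using False ab by (auto simp: h_def)
    qed
    have "(\<Sum>X2\<in>Pow E2. gnp E1 p X1 * gnp E2 p X2 * h (X1 \<union> X2)) =
        gnp E1 p X1 * (\<Sum>X2\<in>Pow E2. gnp E2 p X2 * (if X2 \<inter> cut A = {} then c else 0))"
      unfolding sum_distrib_left by (rule sum.cong[OF refl]) (simp add: h_eq)
    also have "\<dots> = gnp E1 p X1 * (c * (1 - p) ^ card (cut A))"
      using sum_gnp_avoid[OF E12(4) cutE] by simp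
    also have "\<dots> = gnp E1 p X1" using p by (simp add: c_def card_cut)
    finally show ?thesis .
  qed
  have "(\<Sum>X\<in>Pow E. gnp E p X * h X) =
      (\<Sum>X1\<in>Pow E1. \<Sum>X2\<in>Pow E2. gnp E1 p X1 * gnp E2 p X2 * h (X1 \<union> X2))"
    using sum_gnp_Un[OF E12(3,4,2), of p h] by (simp only: E12(1))
  also have "\<dots> = (\<Sum>X1\<in>Pow E1. gnp E1 p X1)" by (rule sum.cong[OF refl inner])
  finally show ?thesis using sum_gnp[OF E12(3)] by (simp add: h_def)
qed

section \<open>Cluster sizes in the binomial graph near criticality\<close>

locale binomial_graph =
  fixes V :: "'v set" and p :: real
  assumes finite_V: "finite V" and p: "0 \<le> p" "p < 1"
begin

abbreviation "E \<equiv> nsets V 2"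
abbreviation "n \<equiv> card V"

definition avg :: "('v set set \<Rightarrow> real) \<Rightarrow> real" where
  "avg f = (\<Sum>X\<in>Pow E. gnp E p X * f X)"

lemma finite_E: "finite E"
  by (rule finite_imp_finite_nsets[OF finite_V])

lemma avg_mono: "(\<And>X. X \<subseteq> E \<Longrightarrow> f X \<le> g X) \<Longrightarrow> avg f \<le> avg g"
  unfolding avg_def using p by (intro sum_mono mult_left_mono) (auto simp: gnp_nonneg)

lemma avg_const: "avg (\<lambda>_. c) = c"
  using sum_gnp[OF finite_E, of p] by (simp add: avg_def flip: sum_distrib_right)

lemma avg_cmult: "avg (\<lambda>X. c * f X) = c * avg f"
  by (simp add: avg_def sum_distrib_left mult_ac)

lemma avg_add: "avg (\<lambda>X. f X + g X) = avg f + avg g"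
  by (simp add: avg_def sum.distrib distrib_left)

lemma avg_diff: "avg (\<lambda>X. f X - g X) = avg f - avg g"
  by (simp add: avg_def sum_subtractf right_diff_distrib)

lemma avg_sum: "avg (\<lambda>X. \<Sum>i\<in>I. f i X) = (\<Sum>i\<in>I. avg (f i))"
  unfolding avg_def sum_distrib_left by (rule sum.swap)

lemma avg_cong: "(\<And>X. X \<subseteq> E \<Longrightarrow> f X = g X) \<Longrightarrow> avg f = avg g"
  unfolding avg_def by (intro sum.cong) auto

lemma card_cluster_le:
  assumes "X \<subseteq> E" "S \<subseteq> V"
  shows "card (cluster X S) \<le> n"
  by (rule card_mono[OF finite_V cluster_subset[OF assms]])

text \<open>Sum \<open>cluster_avoid_identity\<close> over all \<open>B \<subseteq> V - S\<close>
  with weights \<open>z ^ card B\<close>. For fixed \<open>X\<close> only sets avoiding the cluster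
  contribute, and the binomial theorem evaluates both sides. With its free parameter
  \<open>z\<close> this exact formula plays the part of a moment generating function of the cluster
  size.\<close>

lemma cluster_transform:
  assumes S: "S \<subseteq> V"
  shows "avg (\<lambda>X. (1 + z / (1 - p) ^ card (cluster X S)) ^ (n - card (cluster X S))) =
    (1 + z) ^ (n - card S)"
proof -
  have fS: "finite (V - S)" using finite_V by simp
  have "avg (\<lambda>X. \<Sum>B\<in>Pow (V - S). z ^ card B * (if cluster X S \<inter> B = {}
      then inverse ((1 - p) ^ (card (cluster X S) * card B)) else 0)) = (\<Sum>B\<in>Pow (V - S). z ^ card B)"
    using cluster_avoid_identity[OF finite_V S _ p(2)]
    by (simp add: avg_sum avg_cmult) (simp add: avg_def)
  also have "\<dots> = (1 + z) ^ (n - card S)"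
    using sum_Pow_power_card[OF fS, of z 1] card_Diff_subset[OF finite_subset[OF S finite_V] S]
    by (simp add: add.commute)
  finally have 1: "avg (\<lambda>X. \<Sum>B\<in>Pow (V - S). z ^ card B * (if cluster X S \<inter> B = {}
      then inverse ((1 - p) ^ (card (cluster X S) * card B)) else 0)) = (1 + z) ^ (n - card S)" .
  have "avg (\<lambda>X. (1 + z / (1 - p) ^ card (cluster X S)) ^ (n - card (cluster X S))) =
     avg (\<lambda>X. \<Sum>B\<in>Pow (V - S). z ^ card B * (if cluster X S \<inter> B = {}
      then inverse ((1 - p) ^ (card (cluster X S) * card B)) else 0))"
  proof (rule avg_cong)
    fix X assume X: "X \<subseteq> E"
    let ?C = "cluster X S" and ?M = "card (cluster X S)"
    have C: "?C \<subseteq> V" "S \<subseteq> ?C" using cluster_subset[OF X S] subset_cluster[of S X] by auto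
    have fC: "finite ?C" using finite_subset[OF C(1) finite_V] .
    have "(\<Sum>B\<in>Pow (V - S). z ^ card B * (if ?C \<inter> B = {} then inverse ((1 - p) ^ (?M * card B)) else 0)) =
        (\<Sum>B\<in>Pow (V - ?C). (z / (1 - p) ^ ?M) ^ card B)"
    proof (rule sum.mono_neutral_cong_right)
      show "finite (Pow (V - S))" using finite_V by simp
      show "Pow (V - ?C) \<subseteq> Pow (V - S)" using C by auto
      show "\<forall>B\<in>Pow (V - S) - Pow (V - ?C). z ^ card B *
          (if ?C \<inter> B = {} then inverse ((1 - p) ^ (?M * card B)) else 0) = 0" by auto
      fix B assume "B \<in> Pow (V - ?C)"
      then have "?C \<inter> B = {}" by auto
      then show "z ^ card B * (if ?C \<inter> B = {} then inverse ((1 - p) ^ (?M * card B)) else 0)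
          = (z / (1 - p) ^ ?M) ^ card B"
        by (simp add: power_divide power_mult divide_inverse power_mult_distrib power_inverse)
    qed
    also have "\<dots> = (1 + z / (1 - p) ^ ?M) ^ (n - ?M)"
      using sum_Pow_power_card[of "V - ?C" "z / (1 - p) ^ ?M" 1] finite_V card_Diff_subset[OF fC C(1)]
      by (simp add: add.commute)
    finally show "(1 + z / (1 - p) ^ ?M) ^ (n - ?M) = (\<Sum>B\<in>Pow (V - S). z ^ card B *
        (if ?C \<inter> B = {} then inverse ((1 - p) ^ (?M * card B)) else 0))" ..
  qed
  then show ?thesis using 1 by simp
qed

text \<open>The linear coefficient in \<open>z\<close> of the previous formula, obtained from
  singletons \<open>B\<close>.\<close>

lemma cluster_complement_mean:
  assumes S: "S \<subseteq> V"
  shows "avg (\<lambda>X. (real n - real (card (cluster X S))) / (1 - p) ^ card (cluster X S)) = real n - real (card S)"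
proof -
  have fS: "finite (V - S)" using finite_V by simp
  have "avg (\<lambda>X. \<Sum>v\<in>V - S. if cluster X S \<inter> {v} = {}
      then inverse ((1 - p) ^ (card (cluster X S) * card {v})) else 0) = (\<Sum>v\<in>V - S. 1)"
    unfolding avg_sum avg_def
    by (rule sum.cong[OF refl], rule cluster_avoid_identity[OF finite_V S _ p(2)]) auto
  also have "\<dots> = real n - real (card S)"
    using card_Diff_subset[OF finite_subset[OF S finite_V] S] card_mono[OF finite_V S] by simp
  finally have 1: "avg (\<lambda>X. \<Sum>v\<in>V - S. if cluster X S \<inter> {v} = {}
      then inverse ((1 - p) ^ (card (cluster X S) * card {v})) else 0) = real n - real (card S)" .
  have "avg (\<lambda>X. (real n - real (card (cluster X S))) / (1 - p) ^ card (cluster X S)) =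
     avg (\<lambda>X. \<Sum>v\<in>V - S. if cluster X S \<inter> {v} = {}
      then inverse ((1 - p) ^ (card (cluster X S) * card {v})) else 0)"
  proof (rule avg_cong)
    fix X assume X: "X \<subseteq> E"
    let ?C = "cluster X S" and ?M = "card (cluster X S)"
    have C: "?C \<subseteq> V" "S \<subseteq> ?C" using cluster_subset[OF X S] subset_cluster[of S X] by auto
    have fC: "finite ?C" using finite_subset[OF C(1) finite_V] .
    have "(\<Sum>v\<in>V - S. if ?C \<inter> {v} = {} then inverse ((1 - p) ^ (?M * card {v})) else 0) =
        (\<Sum>v\<in>V - ?C. inverse ((1 - p) ^ ?M))"
      by (rule sum.mono_neutral_cong_right) (use C finite_V in auto)
    also have "\<dots> = (real n - real ?M) / (1 - p) ^ ?M"
      using card_Diff_subset[OF fC C(1)] card_mono[OF finite_V C(1)] by (simp add: divide_inverse)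
    finally show "(real n - real ?M) / (1 - p) ^ ?M =
      (\<Sum>v\<in>V - S. if ?C \<inter> {v} = {} then inverse ((1 - p) ^ (?M * card {v})) else 0)" ..
  qed
  then show ?thesis using 1 by simp
qed

lemma bernoulli_power: "1 - real j * p \<le> (1 - p) ^ j"
  using Bernoulli_inequality[of "- p" j] p by simp

text \<open>Bernoulli's inequality bounds the term averaged in
  \<open>cluster_complement_mean\<close> by \<open>n - \<epsilon> * j\<close> for a cluster of size
  \<open>j\<close>; its exact mean \<open>n - card S\<close> then bounds the mean of
  \<open>j\<close>.\<close>

lemma cluster_mean:
  assumes S: "S \<subseteq> V" and n: "n > 0" and eps: "0 < \<epsilon>" "\<epsilon> \<le> 1" and pe: "p = (1 - \<epsilon>) / real n"
  shows "avg (\<lambda>X. real (card (cluster X S))) \<le> real (card S) / \<epsilon>"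
proof -
  have "real n - real (card S) \<le> avg (\<lambda>X. real n - \<epsilon> * real (card (cluster X S)))"
    unfolding cluster_complement_mean[OF S, symmetric]
  proof (rule avg_mono)
    fix X assume "X \<subseteq> E"
    define j where "j = card (cluster X S)"
    have jn: "j \<le> n" unfolding j_def by (rule card_cluster_le[OF \<open>X \<subseteq> E\<close> S])
    have en: "\<epsilon> * real j \<le> real n" using eps jn mult_mono[of \<epsilon> 1 "real j" "real n"] by simp
    have "real n - real j \<le> (real n - \<epsilon> * real j) * (1 - real j * p)"
    proof -
      have "(real n - \<epsilon> * real j) * (1 - real j * p) = real n - real j + \<epsilon> * (1 - \<epsilon>) * real j ^ 2 / real n"
        using n by (simp add: pe field_simps power2_eq_square)
      then show ?thesis using eps by simp
    qed
    also have "\<dots> \<le> (real n - \<epsilon> * real j) * (1 - p) ^ j"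
      using bernoulli_power en by (intro mult_left_mono) auto
    finally have "(real n - real j) / (1 - p) ^ j \<le> real n - \<epsilon> * real j"
      using p by (simp add: pos_divide_le_eq)
    then show "(real n - real (card (cluster X S))) / (1 - p) ^ card (cluster X S)
        \<le> real n - \<epsilon> * real (card (cluster X S))"
      by (simp add: j_def)
  qed
  also have "\<dots> = real n - \<epsilon> * avg (\<lambda>X. real (card (cluster X S)))"
    by (simp add: avg_diff avg_const avg_cmult)
  finally show ?thesis using eps by (simp add: field_simps)
qed

text \<open>The factor \<open>1 / (1 - p) ^ j\<close> raises the base by about
  \<open>z * p * j\<close>, the smaller exponent \<open>n - j\<close> costs about
  \<open>z * j\<close>, and for \<open>n * p\<close> near 1 the two cancel to first order. The
  remainders are \<open>\<epsilon>\<close> from the subcritical \<open>p\<close>, \<open>z\<close>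
  from dividing by \<open>1 + z\<close>, and \<open>j / n\<close> twice: from \<open>n - j\<close>
  in place of \<open>n\<close>, and from the square of \<open>A\<close>.\<close>

lemma transform_lower:
  assumes n: "n > 0" and j: "j \<le> n" and eps: "0 \<le> \<epsilon>" "\<epsilon> \<le> 1" and pe: "p = (1 - \<epsilon>) / real n"
    and z: "0 < z" "z \<le> 1"
  shows "(1 + z) ^ n * exp (- (z * real j * (\<epsilon> + z + 2 * real j / real n))) \<le> (1 + z / (1 - p) ^ j) ^ (n - j)"
proof -
  \<comment> \<open>The relative gain of the base:
    \<open>(1 + z) * (1 + A) = 1 + z * (1 + p * real j)\<close>.\<close>
  define A where "A = z * p * real j / (1 + z)"
  have p1: "p \<le> 1 / real n" using eps n by (simp add: pe divide_right_mono)
  have pj: "p * real j \<le> real j / real n" using p1 mult_right_mono[of p "1 / real n" "real j"] by simp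
  have "real j / real n \<le> 1" using j n by simp
  with pj have pj1: "p * real j \<le> 1" by linarith
  have A0: "0 \<le> A" using z p by (simp add: A_def)
  have Az: "A \<le> z * (p * real j)"
    using z p by (simp add: A_def field_simps mult_left_mono)
  have A1: "A \<le> 1" using Az z pj1 mult_mono[of z 1 "p * real j" 1] p by simp
  have base: "(1 + z) * exp (A - A\<^sup>2) \<le> 1 + z / (1 - p) ^ j"
  proof -
    have "(1 - p) ^ j * (1 + p * real j) \<le> exp (- p) ^ j * exp (p * real j)"
      using exp_ge_add_one_self[of "- p"] exp_ge_add_one_self[of "p * real j"] p
      by (intro mult_mono power_mono) auto
    also have "\<dots> = 1" by (simp flip: exp_of_nat_mult exp_add)
    finally have "1 + p * real j \<le> 1 / (1 - p) ^ j" using p by (simp add: field_simps)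
    then have "z * (1 + p * real j) \<le> z / (1 - p) ^ j"
      using z mult_left_mono[of "1 + p * real j" "1 / (1 - p) ^ j" z] by simp
    moreover have "(1 + z) * (1 + A) = 1 + z * (1 + p * real j)"
      using z by (simp add: A_def field_simps)
    moreover have "exp (A - A\<^sup>2) \<le> 1 + A"
    proof -
      have "A - A\<^sup>2 \<le> ln (1 + A)" using ln_one_plus_pos_lower_bound[OF A0 A1] .
      then show ?thesis using A0 by (simp add: ln_ge_iff)
    qed
    ultimately show ?thesis using z mult_left_mono[of "exp (A - A\<^sup>2)" "1 + A" "1 + z"] by simp
  qed
  have expo: "- (z * real j * (\<epsilon> + z + 2 * real j / real n)) \<le> real (n - j) * (A - A\<^sup>2) - real j * z"
  proof -
    have npj: "real (n - j) * p = (1 - \<epsilon>) * (1 - real j / real n)"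
      using n j by (simp add: pe of_nat_diff field_simps)
    have npj0: "0 \<le> real (n - j) * p" "real (n - j) * p \<le> 1"
    proof -
      show "0 \<le> real (n - j) * p" using p by simp
      have "real (n - j) * p \<le> real n * (1 / real n)" using p p1 by (intro mult_mono) auto
      then show "real (n - j) * p \<le> 1" using n by simp
    qed
    have "1 - \<epsilon> - real j / real n - z \<le> real (n - j) * p - z"
      proof -
      have "(1 - \<epsilon>) * (1 - real j / real n) = 1 - \<epsilon> - real j / real n + \<epsilon> * (real j / real n)"
        by (simp only: left_diff_distrib right_diff_distrib mult_1_left mult_1_right)
      moreover have "0 \<le> \<epsilon> * (real j / real n)" using eps by simp
      ultimately show ?thesis unfolding npj by linarith
    qed
    also have "\<dots> \<le> real (n - j) * p - z * (real (n - j) * p)"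
      using z npj0 mult_left_mono[of "real (n - j) * p" 1 z] by simp
    also have "\<dots> = real (n - j) * p * (1 - z)" by (simp add: algebra_simps)
    also have "\<dots> \<le> real (n - j) * p * (1 / (1 + z))"
    proof -
      have "(1 - z) * (1 + z) \<le> 1" by (simp add: algebra_simps)
      then have "1 - z \<le> 1 / (1 + z)" using z by (simp add: field_simps)
      then show ?thesis using npj0 by (intro mult_left_mono)
    qed
    finally have "z * real j * (1 - \<epsilon> - real j / real n - z) \<le> z * real j * (real (n - j) * p * (1 / (1 + z)))"
      using z by (intro mult_left_mono) auto
    also have "\<dots> = real (n - j) * A" by (simp add: A_def field_simps)
    finally have 1: "z * real j * (1 - \<epsilon> - real j / real n - z) \<le> real (n - j) * A" .
    have "real (n - j) * A\<^sup>2 \<le> real n * (z * (real j / real n))\<^sup>2"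
    proof (intro mult_mono power_mono)
      show "A \<le> z * (real j / real n)" using Az pj z mult_left_mono[OF pj, of z] by simp
    qed (use A0 in auto)
    also have "\<dots> = z * real j * (z * (real j / real n))"
      using n by (simp add: power2_eq_square field_simps)
    also have "\<dots> \<le> z * real j * (real j / real n)"
      using z mult_right_mono[of z 1 "real j / real n"] by (intro mult_left_mono) auto
    finally have 2: "real (n - j) * A\<^sup>2 \<le> z * real j * (real j / real n)" .
    have "- (z * real j * (\<epsilon> + z + 2 * real j / real n)) =
        z * real j * (1 - \<epsilon> - real j / real n - z) - z * real j * (real j / real n) - real j * z"
      using n by (simp add: field_simps)
    also have "\<dots> \<le> real (n - j) * A - real (n - j) * A\<^sup>2 - real j * z" using 1 2 by linarith
    finally show ?thesis by (simp add: right_diff_distrib)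
  qed
  have "(1 + z) ^ n * exp (- (z * real j * (\<epsilon> + z + 2 * real j / real n)))
      \<le> (1 + z) ^ n * exp (real (n - j) * (A - A\<^sup>2) - real j * z)"
    using expo z by (intro mult_left_mono) auto
  also have "\<dots> = ((1 + z) ^ (n - j) * exp (A - A\<^sup>2) ^ (n - j)) * ((1 + z) ^ j * exp (- z) ^ j)"
  proof -
    have "(1 + z) ^ n = (1 + z) ^ (n - j) * (1 + z) ^ j" using j by (simp flip: power_add)
    moreover have "exp (real (n - j) * (A - A\<^sup>2) - real j * z) = exp (A - A\<^sup>2) ^ (n - j) * exp (- z) ^ j"
      by (simp only: exp_of_nat_mult[symmetric] exp_add[symmetric]) simp
    ultimately show ?thesis by (simp only: mult_ac)
  qed
  also have "\<dots> \<le> ((1 + z) ^ (n - j) * exp (A - A\<^sup>2) ^ (n - j)) * 1"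
  proof (intro mult_left_mono)
    have "((1 + z) * exp (- z)) ^ j \<le> 1 ^ j"
    proof (rule power_mono)
      have "(1 + z) * exp (- z) \<le> exp z * exp (- z)"
        using exp_ge_add_one_self[of z] by (intro mult_right_mono) auto
      then show "(1 + z) * exp (- z) \<le> 1" by (simp flip: exp_add)
    qed (use z in auto)
    then show "(1 + z) ^ j * exp (- z) ^ j \<le> 1" by (simp add: power_mult_distrib)
  qed (use z in auto)
  also have "\<dots> = ((1 + z) * exp (A - A\<^sup>2)) ^ (n - j)" by (simp add: power_mult_distrib)
  also have "\<dots> \<le> (1 + z / (1 - p) ^ j) ^ (n - j)" using base z by (intro power_mono) auto
  finally show ?thesis .
qed

text \<open>Markov's inequality for the transform: on a cluster of size at most \<open>m\<close> the
  averaged term is at least \<open>(1 + z) ^ n * exp (- Q)\<close>, whereas its mean is only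
  \<open>(1 + z) ^ (n - card S)\<close>. The missing factor \<open>(1 + z) ^ card S\<close> is at
  least \<open>exp (card S * z / 2)\<close>.\<close>

lemma cluster_lower_tail:
  assumes S: "S \<subseteq> V" and n: "n > 0" and eps: "0 \<le> \<epsilon>" "\<epsilon> \<le> 1" and pe: "p = (1 - \<epsilon>) / real n"
    and z: "0 < z" "z \<le> 1" and m: "0 \<le> m"
  shows "avg (\<lambda>X. if real (card (cluster X S)) \<le> m then 1 else 0)
    \<le> exp (- (real (card S) * z / 2) + z * m * (\<epsilon> + z + 2 * m / real n))"
proof -
  define Q where "Q = z * m * (\<epsilon> + z + 2 * m / real n)"
  have "(1 + z) ^ n * exp (- Q) * avg (\<lambda>X. if real (card (cluster X S)) \<le> m then 1 else 0)
      \<le> avg (\<lambda>X. (1 + z / (1 - p) ^ card (cluster X S)) ^ (n - card (cluster X S)))"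
    unfolding avg_cmult[symmetric]
  proof (rule avg_mono)
    fix X assume X: "X \<subseteq> E"
    let ?j = "card (cluster X S)"
    show "(1 + z) ^ n * exp (- Q) * (if real ?j \<le> m then 1 else 0) \<le> (1 + z / (1 - p) ^ ?j) ^ (n - ?j)"
    proof (cases "real ?j \<le> m")
      case True
      have "z * real ?j * (\<epsilon> + z + 2 * real ?j / real n) \<le> Q"
        unfolding Q_def using True z eps n m by (intro mult_mono add_mono divide_right_mono) auto
      then have "(1 + z) ^ n * exp (- Q) \<le> (1 + z) ^ n * exp (- (z * real ?j * (\<epsilon> + z + 2 * real ?j / real n)))"
        using z by (intro mult_left_mono) auto
      also have "\<dots> \<le> (1 + z / (1 - p) ^ ?j) ^ (n - ?j)"
        by (rule transform_lower[OF n card_cluster_le[OF X S] eps pe z])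
      finally show ?thesis using True by simp
    next
      case False
      then show ?thesis using z p by simp
    qed
  qed
  also have "\<dots> = (1 + z) ^ (n - card S)" by (rule cluster_transform[OF S])
  finally have "(1 + z) ^ (n - card S) * ((1 + z) ^ card S * exp (- Q) *
      avg (\<lambda>X. if real (card (cluster X S)) \<le> m then 1 else 0)) \<le> (1 + z) ^ (n - card S) * 1"
    using card_mono[OF finite_V S] by (simp add: mult.assoc[symmetric] flip: power_add)
  then have 1: "(1 + z) ^ card S * exp (- Q) * avg (\<lambda>X. if real (card (cluster X S)) \<le> m then 1 else 0) \<le> 1"
    using z by (subst (asm) mult_le_cancel_left_pos) auto
  have "exp (z / 2) \<le> 1 + z"
  proof -
    have "exp (z / 2) \<le> 1 + z / 2 + (z / 2)\<^sup>2" using z by (intro exp_bound) auto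
    also have "(z / 2)\<^sup>2 \<le> z / 2" using z by (simp add: power2_eq_square field_simps)
    finally show ?thesis by simp
  qed
  then have "exp (z / 2) ^ card S \<le> (1 + z) ^ card S" by (intro power_mono) auto
  then have "exp (real (card S) * z / 2) \<le> (1 + z) ^ card S" by (simp flip: exp_of_nat_mult)
  moreover have "0 \<le> avg (\<lambda>X. if real (card (cluster X S)) \<le> m then 1 else 0)"
    using avg_mono[of "\<lambda>_. 0"] by (simp add: avg_const)
  ultimately have "exp (real (card S) * z / 2) * exp (- Q) * avg (\<lambda>X. if real (card (cluster X S)) \<le> m then 1 else 0)
    \<le> (1 + z) ^ card S * exp (- Q) * avg (\<lambda>X. if real (card (cluster X S)) \<le> m then 1 else 0)"
    by (intro mult_right_mono) auto
  with 1 have 2: "exp (real (card S) * z / 2) * exp (- Q) *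
      avg (\<lambda>X. if real (card (cluster X S)) \<le> m then 1 else 0) \<le> 1"
    by linarith
  have cancel: "b \<le> exp (- x)" if "exp x * b \<le> 1" for x b :: real
    using that by (simp add: exp_minus field_simps)
  have "avg (\<lambda>X. if real (card (cluster X S)) \<le> m then 1 else 0) \<le> exp (- (real (card S) * z / 2 + - Q))"
    by (rule cancel) (use 2 in \<open>simp only: exp_add\<close>)
  also have "- (real (card S) * z / 2 + - Q) = - (real (card S) * z / 2) + Q" by simp
  finally show ?thesis by (simp only: Q_def)
qed

text \<open>In terms of \<open>y = z / (1 + z)\<close> a cluster of size \<open>j\<close>
  contributes at most the factor \<open>((1 - y) * exp y) ^ j\<close>. The first-order effects
  cancel in it, and the second-order decay \<open>exp (- (y\<^sup>2 / 16))\<close> per vertex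
  remains; \<open>z / 2 \<le> y\<close> turns 16 into 64.\<close>

lemma transform_upper:
  assumes n: "n > 0" and j: "j \<le> n" and pn: "p \<le> 1 / real n" and z: "0 < z" "z \<le> 1"
  shows "(1 + z / (1 - p) ^ j) ^ (n - j) \<le> (1 + z) ^ n * exp (- (z\<^sup>2 / 64)) ^ j"
proof -
  define y where "y = z / (1 + z)"
  have y: "0 < y" "y \<le> 1 / 2" "z / 2 \<le> y" "1 + z = 1 / (1 - y)"
    using z by (auto simp: y_def field_simps)
  have "1 + z / (1 - p) ^ j = (1 + z) * (1 + y * (1 / (1 - p) ^ j - 1))"
    using z by (simp add: y_def field_simps)
  also have "\<dots> \<le> (1 + z) * exp (y * (1 / (1 - p) ^ j - 1))"
    using z by (intro mult_left_mono exp_ge_add_one_self) auto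
  finally have "(1 + z / (1 - p) ^ j) ^ (n - j) \<le> ((1 + z) * exp (y * (1 / (1 - p) ^ j - 1))) ^ (n - j)"
    using z p by (intro power_mono) auto
  also have "\<dots> = (1 + z) ^ (n - j) * exp (y * (real (n - j) * (1 / (1 - p) ^ j - 1)))"
    by (simp add: power_mult_distrib mult_ac flip: exp_of_nat_mult)
  also have "\<dots> \<le> (1 + z) ^ (n - j) * exp (y * real j)"
  proof -
    have "real n * (1 - real j * (1 / real n)) \<le> real n * (1 - p) ^ j"
    proof (rule mult_left_mono)
      have "1 - real j * (1 / real n) \<le> 1 - real j * p" using pn mult_left_mono[OF pn, of "real j"] by simp
      then show "1 - real j * (1 / real n) \<le> (1 - p) ^ j" using bernoulli_power[of j] by linarith
    qed simp
    moreover have "real n * (1 - real j * (1 / real n)) = real (n - j)"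
      using n j by (simp add: field_simps of_nat_diff)
    ultimately have "real (n - j) \<le> real n * (1 - p) ^ j" by simp
    then have "real (n - j) / (1 - p) ^ j \<le> real n" using p by (simp add: pos_divide_le_eq)
    then have "real (n - j) * (1 / (1 - p) ^ j) \<le> real n" by simp
    then have "real (n - j) * (1 / (1 - p) ^ j - 1) \<le> real j" using j by (simp add: of_nat_diff algebra_simps)
    then show ?thesis using y z by (intro mult_left_mono) auto
  qed
  also have "\<dots> = (1 + z) ^ n * ((1 - y) * exp y) ^ j"
  proof -
    have "(1 + z) ^ n = (1 + z) ^ (n - j) * (1 + z) ^ j" using j by (simp flip: power_add)
    moreover have "(1 + z) ^ j * (1 - y) ^ j = 1" using y by (simp flip: power_mult_distrib)
    ultimately show ?thesis
      by (simp add: power_mult_distrib mult_ac flip: exp_of_nat_mult)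
  qed
  also have "\<dots> \<le> (1 + z) ^ n * exp (- (z\<^sup>2 / 64)) ^ j"
  proof (intro mult_left_mono power_mono)
    have e1: "exp (y / 2) \<le> 1 + y / 2 + (y / 2)\<^sup>2" using y by (intro exp_bound) auto
    have "exp y = exp (y / 2) ^ 2" by (simp add: power2_eq_square flip: exp_add)
    also have "\<dots> \<le> (1 + y / 2 + (y / 2)\<^sup>2)\<^sup>2" using e1 by (intro power_mono) auto
    finally have e2: "exp y \<le> (1 + y / 2 + (y / 2)\<^sup>2)\<^sup>2" .
    have y64: "y\<^sup>2 / 16 \<le> 1"
    proof -
      have "y\<^sup>2 \<le> (1 / 2)\<^sup>2" using y by (intro power_mono) auto
      then show ?thesis by (simp add: power2_eq_square)
    qed
    have "exp (y\<^sup>2 / 16) \<le> 1 + y\<^sup>2 / 16 + (y\<^sup>2 / 16)\<^sup>2" using y64 by (intro exp_bound) auto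
    also have "\<dots> \<le> 1 + y\<^sup>2 / 8"
    proof -
      have "(y\<^sup>2 / 16)\<^sup>2 \<le> y\<^sup>2 / 16"
        using y64 mult_left_mono[of "y\<^sup>2 / 16" 1 "y\<^sup>2 / 16"] by (simp add: power2_eq_square)
      then show ?thesis by simp
    qed
    finally have e3: "exp (y\<^sup>2 / 16) \<le> 1 + y\<^sup>2 / 8" .
    have "(1 - y) * exp y * exp (y\<^sup>2 / 16) \<le> (1 - y) * (1 + y / 2 + (y / 2)\<^sup>2)\<^sup>2 * (1 + y\<^sup>2 / 8)"
      using e2 e3 y by (intro mult_mono) auto
    also have "\<dots> \<le> 1"
    proof -
      have "(1 - y) * (1 + y / 2 + (y / 2)\<^sup>2)\<^sup>2 * (1 + y\<^sup>2 / 8) =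
          1 - y\<^sup>2 * (1 / 8 + y / 2 + y\<^sup>2 * 7 / 32 + y ^ 3 / 8 + y ^ 4 * 3 / 128 + y ^ 5 / 128)"
        by (simp add: field_simps power2_eq_square power3_eq_cube eval_nat_numeral)
      moreover have "0 \<le> y\<^sup>2 * (1 / 8 + y / 2 + y\<^sup>2 * 7 / 32 + y ^ 3 / 8 + y ^ 4 * 3 / 128 + y ^ 5 / 128)"
        using y by (intro mult_nonneg_nonneg add_nonneg_nonneg) auto
      ultimately show ?thesis by linarith
    qed
    finally have "(1 - y) * exp y \<le> exp (- (y\<^sup>2 / 16))"
      by (simp add: exp_minus field_simps)
    also have "\<dots> \<le> exp (- (z\<^sup>2 / 64))"
      using power_mono[OF y(3), of 2] z by (simp add: power_divide)
    finally show "(1 - y) * exp y \<le> exp (- (z\<^sup>2 / 64))" .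
  qed (use y z in auto)
  finally show ?thesis .
qed

text \<open>Heuristically a cluster at \<open>p \<le> 1 / n\<close> exceeds size \<open>j\<close>
  with probability at most of order \<open>1 / sqrt j\<close>, which suggests the order
  \<open>sqrt t\<close>. The transform with \<open>z = 1 / sqrt t\<close> confirms it: for the
  cluster size \<open>M\<close>, the mean of \<open>1 - exp (- (z\<^sup>2 / 64)) ^ M\<close> is at
  most \<open>z\<close>, and for \<open>M < t\<close> this quantity is at least
  \<open>M * z\<^sup>2 / 128\<close>.\<close>

lemma truncated_cluster_mean:
  assumes v: "v \<in> V" and pn: "p \<le> 1 / real n" and t: "t \<ge> 1"
  shows "avg (\<lambda>X. if real (card (cluster X {v})) < t then real (card (cluster X {v})) else 0) \<le> 128 * sqrt t"
proof -
  define z where "z = 1 / sqrt t"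
  have z: "0 < z" "z \<le> 1" "z\<^sup>2 = 1 / t" using t by (auto simp: z_def power_divide)
  have n: "n > 0" using v finite_V card_gt_0_iff by blast
  let ?M = "\<lambda>X. card (cluster X {v})"
  have "(1 + z) ^ (n - 1) = avg (\<lambda>X. (1 + z / (1 - p) ^ ?M X) ^ (n - ?M X))"
    using cluster_transform[of "{v}" z] v by simp
  also have "\<dots> \<le> avg (\<lambda>X. (1 + z) ^ n * exp (- (z\<^sup>2 / 64)) ^ ?M X)"
    by (rule avg_mono, rule transform_upper[OF n _ pn z(1,2)]) (use v card_cluster_le in auto)
  finally have "(1 + z) ^ (n - 1) * 1 \<le> (1 + z) ^ (n - 1) * ((1 + z) * avg (\<lambda>X. exp (- (z\<^sup>2 / 64)) ^ ?M X))"
    using n by (simp add: avg_cmult mult.assoc[symmetric] flip: power_Suc2)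
  then have 1: "1 \<le> (1 + z) * avg (\<lambda>X. exp (- (z\<^sup>2 / 64)) ^ ?M X)"
    using z by (subst (asm) mult_le_cancel_left_pos) auto
  have le1: "avg (\<lambda>X. exp (- (z\<^sup>2 / 64)) ^ ?M X) \<le> 1"
    using avg_mono[of "\<lambda>X. exp (- (z\<^sup>2 / 64)) ^ ?M X" "\<lambda>_. 1"] by (simp add: avg_const power_le_one)
  have 2: "avg (\<lambda>X. 1 - exp (- (z\<^sup>2 / 64)) ^ ?M X) \<le> z"
  proof -
    have "z * avg (\<lambda>X. exp (- (z\<^sup>2 / 64)) ^ ?M X) \<le> z" using mult_left_mono[OF le1, of z] z by simp
    with 1 have "1 - avg (\<lambda>X. exp (- (z\<^sup>2 / 64)) ^ ?M X) \<le> z" by (simp only: distrib_right mult_1_left)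
    then show ?thesis by (simp only: avg_diff avg_const)
  qed
  have "(z\<^sup>2 / 128) * avg (\<lambda>X. if real (?M X) < t then real (?M X) else 0) \<le> avg (\<lambda>X. 1 - exp (- (z\<^sup>2 / 64)) ^ ?M X)"
    unfolding avg_cmult[symmetric]
  proof (rule avg_mono)
    fix X
    define x where "x = real (?M X) * (z\<^sup>2 / 64)"
    have ex: "exp (- (z\<^sup>2 / 64)) ^ ?M X = exp (- x)" by (simp add: x_def flip: exp_of_nat_mult)
    have x0: "0 \<le> x" by (simp add: x_def)
    show "z\<^sup>2 / 128 * (if real (?M X) < t then real (?M X) else 0) \<le> 1 - exp (- (z\<^sup>2 / 64)) ^ ?M X"
    proof (cases "real (?M X) < t")
      case True
      then have "x \<le> t * (z\<^sup>2 / 64)" unfolding x_def by (intro mult_right_mono) auto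
      then have x1: "x \<le> 1" using t z by simp
      have "x * x \<le> x" using x0 x1 mult_left_mono[of x 1 x] by simp
      then have "1 \<le> (1 - x / 2) * (1 + x)" by (simp add: algebra_simps)
      also have "\<dots> \<le> (1 - x / 2) * exp x" using x1 by (intro mult_left_mono) auto
      finally have "exp (- x) \<le> 1 - x / 2" by (simp add: exp_minus field_simps)
      moreover have "z\<^sup>2 / 128 * real (?M X) = x / 2" by (simp add: x_def)
      ultimately show ?thesis unfolding ex using True by simp
    next
      case False
      then show ?thesis unfolding ex using x0 by simp
    qed
  qed
  with 2 have "(z\<^sup>2 / 128) * avg (\<lambda>X. if real (?M X) < t then real (?M X) else 0) \<le> z" by linarith
  then have "z * avg (\<lambda>X. if real (?M X) < t then real (?M X) else 0) \<le> 128"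
    using z by (simp add: power2_eq_square field_simps)
  then show ?thesis using t by (simp add: z_def field_simps)
qed

text \<open>If all components are smaller than \<open>t\<close>, the cluster of \<open>S\<close> is
  a union of such components and its size is at most the sum of the truncated sizes over
  \<open>S\<close>; by Markov's inequality this sum rarely exceeds \<open>y\<close>.
  \<open>S\<close> is an auxiliary set here, not the set of sources.\<close>

lemma large_cluster_exists:
  assumes S: "S \<subseteq> V" and pn: "p \<le> 1 / real n" and t: "t \<ge> 1" and y: "y > 0"
  shows "avg (\<lambda>X. if \<forall>v\<in>V. real (card (cluster X {v})) < t then 1 else 0)
    \<le> avg (\<lambda>X. if real (card (cluster X S)) \<le> y then 1 else 0) + real (card S) * (128 * sqrt t) / y"
proof -
  let ?g = "\<lambda>v X. if real (card (cluster X {v})) < t then real (card (cluster X {v})) else 0"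
  have "avg (\<lambda>X. if \<forall>v\<in>V. real (card (cluster X {v})) < t then 1 else 0)
    \<le> avg (\<lambda>X. (if real (card (cluster X S)) \<le> y then 1 else 0) + 1 / y * (\<Sum>v\<in>S. ?g v X))"
  proof (rule avg_mono)
    fix X assume X: "X \<subseteq> E"
    have s0: "0 \<le> (\<Sum>v\<in>S. ?g v X)" by (intro sum_nonneg) auto
    show "(if \<forall>v\<in>V. real (card (cluster X {v})) < t then 1 else 0)
      \<le> (if real (card (cluster X S)) \<le> y then 1 else 0) + 1 / y * (\<Sum>v\<in>S. ?g v X)"
    proof (cases "(\<forall>v\<in>V. real (card (cluster X {v})) < t) \<and> y < real (card (cluster X S))")
      case True
      have "card (cluster X S) \<le> (\<Sum>v\<in>S. card (cluster X {v}))"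
        unfolding cluster_eq_UN[of X S]
        using finite_subset[OF S finite_V] by (rule card_UN_le)
      then have "real (card (cluster X S)) \<le> (\<Sum>v\<in>S. real (card (cluster X {v})))"
        by (simp flip: of_nat_sum)
      also have "\<dots> = (\<Sum>v\<in>S. ?g v X)" using True S by (intro sum.cong) auto
      finally have "y \<le> (\<Sum>v\<in>S. ?g v X)" using True by linarith
      then have "1 \<le> 1 / y * (\<Sum>v\<in>S. ?g v X)" using y by (simp add: field_simps)
      then show ?thesis using True by auto
    next
      case False
      then show ?thesis using s0 y by auto
    qed
  qed
  also have "\<dots> = avg (\<lambda>X. if real (card (cluster X S)) \<le> y then 1 else 0) + 1 / y * (\<Sum>v\<in>S. avg (?g v))"
    by (simp only: avg_add avg_cmult avg_sum)
  also have "\<dots> \<le> avg (\<lambda>X. if real (card (cluster X S)) \<le> y then 1 else 0) + 1 / y * (\<Sum>v\<in>S. 128 * sqrt t)"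
    using truncated_cluster_mean[OF _ pn t] S y by (intro add_left_mono mult_left_mono sum_mono) auto
  finally show ?thesis by simp
qed

end

subsection \<open>Events determined by the order of the weights\<close>

text \<open>Light edges, Kruskal forests and invasion forests depend on the weights only through the
  pattern recorded here. There are finitely many patterns, so measurability of events built from
  them follows once and for all from \<open>determined_event\<close>.\<close>

definition same_order :: "'e set \<Rightarrow> real \<Rightarrow> ('e \<Rightarrow> real) \<Rightarrow> ('e \<Rightarrow> real) \<Rightarrow> bool" where
  "same_order E p w w' \<longleftrightarrow>
     (\<forall>e\<in>E. \<forall>f\<in>E. w e \<le> w f \<longleftrightarrow> w' e \<le> w' f) \<and> (\<forall>e\<in>E. w e \<le> p \<longleftrightarrow> w' e \<le> p)"

definition determined :: "'e set \<Rightarrow> real \<Rightarrow> (('e \<Rightarrow> real) \<Rightarrow> bool) \<Rightarrow> bool" where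
  "determined E p \<Phi> \<longleftrightarrow> (\<forall>w w'. same_order E p w w' \<longrightarrow> \<Phi> w \<longrightarrow> \<Phi> w')"

lemma same_order_sym: "same_order E p w w' \<Longrightarrow> same_order E p w' w"
  by (auto simp: same_order_def)

lemma determinedD: "determined E p \<Phi> \<Longrightarrow> same_order E p w w' \<Longrightarrow> \<Phi> w \<longleftrightarrow> \<Phi> w'"
  unfolding determined_def using same_order_sym by blast

lemma same_order_less: "same_order E p w w' \<Longrightarrow> e \<in> E \<Longrightarrow> f \<in> E \<Longrightarrow> w e < w f \<longleftrightarrow> w' e < w' f"
  unfolding same_order_def by (meson linorder_not_less)

lemma determined_const: "determined E p (\<lambda>_. b)"
  by (simp add: determined_def)

lemma determined_conj: "determined E p \<Phi> \<Longrightarrow> determined E p \<Psi> \<Longrightarrow> determined E p (\<lambda>w. \<Phi> w \<and> \<Psi> w)"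
  unfolding determined_def by blast

lemma determined_not: "determined E p \<Phi> \<Longrightarrow> determined E p (\<lambda>w. \<not> \<Phi> w)"
  unfolding determined_def using same_order_sym by blast

lemma determined_disj: "determined E p \<Phi> \<Longrightarrow> determined E p \<Psi> \<Longrightarrow> determined E p (\<lambda>w. \<Phi> w \<or> \<Psi> w)"
  unfolding determined_def by blast

lemma determined_ex: "(\<And>i. determined E p (\<Phi> i)) \<Longrightarrow> determined E p (\<lambda>w. \<exists>i. \<Phi> i w)"
  unfolding determined_def by blast

lemma determined_bex: "(\<And>i. determined E p (\<Phi> i)) \<Longrightarrow> determined E p (\<lambda>w. \<exists>i\<in>I. \<Phi> i w)"
  unfolding determined_def by blast

lemma determined_inj: "determined E p (\<lambda>w. inj_on w E)"
  unfolding determined_def same_order_def inj_on_def by (metis order_antisym order_refl)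

lemma determined_light: "determined E p (\<lambda>w. {e \<in> E. w e \<le> p} = X)"
  unfolding determined_def same_order_def by blast

lemma kruskal_same_order:
  assumes "same_order E p w w'"
  shows "kruskal E w T = kruskal E w' T"
proof -
  have b: "below E w (w e) = below E w' (w' e)" if "e \<in> E" for e
    using same_order_less[OF assms _ that] by (auto simp: below_def)
  show ?thesis unfolding kruskal_def by (intro Collect_cong conj_cong refl) (simp only: b)
qed

lemma determined_enters: "determined E p (\<lambda>w. enters E w T u z b)"
  unfolding determined_def
proof (intro allI impI)
  fix w w' assume so: "same_order E p w w'" and "enters E w T u z b"
  then show "enters E w' T u z b" unfolding enters_def kruskal_same_order[OF so] by simp
qed

text \<open>The predicate \<open>is_arg_min\<close> is the same for both weight functions, and the
  chosen edge is a function of that predicate, so even ties are resolved alike.\<close>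

lemma invasion_forest_same_order:
  assumes "same_order E p w w'"
  shows "invasion_forest V E w S = invasion_forest V E w' S"
proof -
  have ne: "next_edge E w I = next_edge E w' I" for I
  proof -
    have "is_arg_min w (\<lambda>e. e \<in> boundary_edges E I) = is_arg_min w' (\<lambda>e. e \<in> boundary_edges E I)"
      unfolding is_arg_min_def fun_eq_iff
      using same_order_less[OF assms] by (auto simp: boundary_edges_def)
    then show ?thesis by (simp add: next_edge_def arg_min_on_def arg_min_def)
  qed
  have "invaded E w S i = invaded E w' S i" for i
    by (induction i) (simp_all add: next_vertex_def ne)
  then show ?thesis by (simp add: invasion_forest_def ne)
qed

lemma determined_forest: "determined E p (\<lambda>w. \<Phi> (invasion_forest V E w S))"
  unfolding determined_def
proof (intro allI impI)
  fix w w' assume so: "same_order E p w w'" and "\<Phi> (invasion_forest V E w S)"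
  then show "\<Phi> (invasion_forest V E w' S)" using invasion_forest_same_order[OF so, of V S] by simp
qed

lemma determined_permute:
  assumes "determined E p \<Phi>" "\<And>e. e \<in> E \<Longrightarrow> \<tau> e \<in> E"
  shows "determined E p (\<lambda>w. \<Phi> (\<lambda>e. w (\<tau> e)))"
proof -
  have "same_order E p (\<lambda>e. w (\<tau> e)) (\<lambda>e. w' (\<tau> e))" if "same_order E p w w'" for w w'
    using that assms(2) by (simp add: same_order_def)
  then show ?thesis using assms(1) unfolding determined_def by blast
qed

text \<open>The event is a finite union of events \<open>pat = c\<close>, each given by finitely
  many comparisons.\<close>

lemma determined_event:
  fixes M :: "'a measure"
  assumes fin: "finite E" and meas: "\<And>e. e \<in> E \<Longrightarrow> U e \<in> borel_measurable M" and \<Phi>: "determined E p \<Phi>"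
  shows "{\<omega> \<in> space M. \<Phi> (\<lambda>e. U e \<omega>)} \<in> sets M"
proof -
  define pat :: "('b \<Rightarrow> real) \<Rightarrow> ('b \<times> 'b) set \<times> 'b set"
    where "pat w = ({ef \<in> E \<times> E. w (fst ef) \<le> w (snd ef)}, {e \<in> E. w e \<le> p})" for w
  have same: "pat w = pat w' \<longleftrightarrow> same_order E p w w'" for w w'
    unfolding pat_def same_order_def by (auto simp: set_eq_iff)
  have ev: "{\<omega> \<in> space M. pat (\<lambda>e. U e \<omega>) = c} \<in> sets M" if "c \<in> Pow (E \<times> E) \<times> Pow E" for c
  proof -
    have "{\<omega> \<in> space M. pat (\<lambda>e. U e \<omega>) = c} =
       {\<omega> \<in> space M. (\<forall>ef\<in>E \<times> E. (U (fst ef) \<omega> \<le> U (snd ef) \<omega>) = (ef \<in> fst c)) \<and>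
          (\<forall>e\<in>E. (U e \<omega> \<le> p) = (e \<in> snd c))}"
      using that unfolding pat_def by (cases c) (auto simp: set_eq_iff)
    also have "\<dots> \<in> sets M"
    proof (intro sets.sets_Collect_conj sets.sets_Collect_finite_All)
      show "{\<omega> \<in> space M. (U (fst ef) \<omega> \<le> U (snd ef) \<omega>) = (ef \<in> fst c)} \<in> sets M" if "ef \<in> E \<times> E" for ef
      proof -
        have [measurable]: "U (fst ef) \<in> borel_measurable M" "U (snd ef) \<in> borel_measurable M"
          using that meas by auto
        show ?thesis by measurable
      qed
      show "{\<omega> \<in> space M. (U e \<omega> \<le> p) = (e \<in> snd c)} \<in> sets M" if "e \<in> E" for e
      proof -
        have [measurable]: "U e \<in> borel_measurable M" using that meas by auto
        show ?thesis by measurable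
      qed
    qed (use fin in auto)
    finally show ?thesis .
  qed
  let ?C = "{c \<in> Pow (E \<times> E) \<times> Pow E. \<exists>w. pat w = c \<and> \<Phi> w}"
  have "{\<omega> \<in> space M. \<Phi> (\<lambda>e. U e \<omega>)} = (\<Union>c\<in>?C. {\<omega> \<in> space M. pat (\<lambda>e. U e \<omega>) = c})"
  proof (intro equalityI subsetI)
    fix \<omega> assume "\<omega> \<in> {\<omega> \<in> space M. \<Phi> (\<lambda>e. U e \<omega>)}"
    moreover have "pat (\<lambda>e. U e \<omega>) \<in> Pow (E \<times> E) \<times> Pow E" by (auto simp: pat_def)
    ultimately show "\<omega> \<in> (\<Union>c\<in>?C. {\<omega> \<in> space M. pat (\<lambda>e. U e \<omega>) = c})" by auto
  next
    fix \<omega> assume "\<omega> \<in> (\<Union>c\<in>?C. {\<omega> \<in> space M. pat (\<lambda>e. U e \<omega>) = c})"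
    then obtain w where "\<omega> \<in> space M" "pat w = pat (\<lambda>e. U e \<omega>)" "\<Phi> w" by auto
    then show "\<omega> \<in> {\<omega> \<in> space M. \<Phi> (\<lambda>e. U e \<omega>)}" using \<Phi> same unfolding determined_def by auto
  qed
  also have "\<dots> \<in> sets M" using fin by (intro sets.finite_UN ev) auto
  finally show ?thesis .
qed

section \<open>The joint law of the weights\<close>

lemma iid_measurable:
  assumes "iid_uniform_weights P n U" "e \<in> complete_edges n"
  shows "U e \<in> borel_measurable P"
  using assms prob_space.indep_vars_def2 unfolding iid_uniform_weights_def
  by (metis (no_types, lifting))

locale random_weights =
  fixes P :: "'a measure" and n :: nat and U :: "nat set \<Rightarrow> 'a \<Rightarrow> real" and p :: real
  assumes iid: "iid_uniform_weights P n U" and n2: "n \<ge> 2" and p01: "0 \<le> p" "p < 1"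
begin

sublocale prob_space P
  using iid by (simp add: iid_uniform_weights_def)

abbreviation "V \<equiv> {1..n}"

sublocale binomial_graph V p
  rewrites "card {1..n} = n"
  by unfold_locales (use p01 in auto)

lemma E_eq: "complete_edges n = E"
  by (simp add: complete_edges_def)

lemma E_nonempty: "E \<noteq> {}"
proof -
  have "{1, 2} \<in> E" using n2 by simp
  then show ?thesis by blast
qed

lemma U_measurable [measurable]: "e \<in> E \<Longrightarrow> U e \<in> borel_measurable P"
  using iid_measurable[OF iid] E_eq by simp

lemma indep: "indep_vars (\<lambda>_. borel) U E"
  using iid by (simp add: iid_uniform_weights_def E_eq)

lemma distr_U: "e \<in> E \<Longrightarrow> distr P borel (U e) = uniform_measure lborel {0..1}"
  using iid by (simp add: iid_uniform_weights_def E_eq)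

definition Pr :: "((nat set \<Rightarrow> real) \<Rightarrow> bool) \<Rightarrow> real" where
  "Pr \<Phi> = prob {\<omega> \<in> space P. \<Phi> (\<lambda>e. U e \<omega>)}"

abbreviation det :: "((nat set \<Rightarrow> real) \<Rightarrow> bool) \<Rightarrow> bool" where
  "det \<equiv> determined E p"

lemma event: "det \<Phi> \<Longrightarrow> {\<omega> \<in> space P. \<Phi> (\<lambda>e. U e \<omega>)} \<in> events"
  by (rule determined_event[OF finite_E U_measurable])

lemma Pr_nonneg: "0 \<le> Pr \<Phi>"
  by (simp add: Pr_def)

lemma Pr_mono: "det \<Psi> \<Longrightarrow> (\<And>w. \<Phi> w \<Longrightarrow> \<Psi> w) \<Longrightarrow> Pr \<Phi> \<le> Pr \<Psi>"
  unfolding Pr_def by (rule finite_measure_mono) (use event in auto)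

lemma Pr_ex_disjoint:
  assumes I: "finite I" and d: "\<And>i. i \<in> I \<Longrightarrow> det (\<Phi> i)"
    and disj: "\<And>w i j. i \<in> I \<Longrightarrow> j \<in> I \<Longrightarrow> \<Phi> i w \<Longrightarrow> \<Phi> j w \<Longrightarrow> i = j"
  shows "Pr (\<lambda>w. \<exists>i\<in>I. \<Phi> i w) = (\<Sum>i\<in>I. Pr (\<Phi> i))"
proof -
  have "{\<omega> \<in> space P. \<exists>i\<in>I. \<Phi> i (\<lambda>e. U e \<omega>)} = (\<Union>i\<in>I. {\<omega> \<in> space P. \<Phi> i (\<lambda>e. U e \<omega>)})" by auto
  moreover have "prob (\<Union>i\<in>I. {\<omega> \<in> space P. \<Phi> i (\<lambda>e. U e \<omega>)}) = (\<Sum>i\<in>I. prob {\<omega> \<in> space P. \<Phi> i (\<lambda>e. U e \<omega>)})"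
  proof (rule finite_measure_finite_Union[OF I])
    show "(\<lambda>i. {\<omega> \<in> space P. \<Phi> i (\<lambda>e. U e \<omega>)}) ` I \<subseteq> events" using event d by auto
    show "disjoint_family_on (\<lambda>i. {\<omega> \<in> space P. \<Phi> i (\<lambda>e. U e \<omega>)}) I"
      unfolding disjoint_family_on_def using disj by blast
  qed
  ultimately show ?thesis by (simp add: Pr_def)
qed

lemma Pr_bex_le:
  assumes I: "finite I" and d: "\<And>i. i \<in> I \<Longrightarrow> det (\<Phi> i)"
  shows "Pr (\<lambda>w. \<exists>i\<in>I. \<Phi> i w) \<le> (\<Sum>i\<in>I. Pr (\<Phi> i))"
proof -
  have "{\<omega> \<in> space P. \<exists>i\<in>I. \<Phi> i (\<lambda>e. U e \<omega>)} = (\<Union>i\<in>I. {\<omega> \<in> space P. \<Phi> i (\<lambda>e. U e \<omega>)})" by auto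
  moreover have "prob (\<Union>i\<in>I. {\<omega> \<in> space P. \<Phi> i (\<lambda>e. U e \<omega>)}) \<le> (\<Sum>i\<in>I. prob {\<omega> \<in> space P. \<Phi> i (\<lambda>e. U e \<omega>)})"
    by (rule finite_measure_subadditive_finite[OF I]) (use event d in auto)
  ultimately show ?thesis by (simp add: Pr_def)
qed

lemma Pr_disj_le: "det \<Phi> \<Longrightarrow> det \<Psi> \<Longrightarrow> Pr (\<lambda>w. \<Phi> w \<or> \<Psi> w) \<le> Pr \<Phi> + Pr \<Psi>"
proof -
  assume d: "det \<Phi>" "det \<Psi>"
  have "{\<omega> \<in> space P. \<Phi> (\<lambda>e. U e \<omega>) \<or> \<Psi> (\<lambda>e. U e \<omega>)} =
     {\<omega> \<in> space P. \<Phi> (\<lambda>e. U e \<omega>)} \<union> {\<omega> \<in> space P. \<Psi> (\<lambda>e. U e \<omega>)}" by auto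
  then show ?thesis unfolding Pr_def using measure_Un_le[OF event[OF d(1)] event[OF d(2)]] by simp
qed

lemma Pr_split: "det \<Phi> \<Longrightarrow> det \<Psi> \<Longrightarrow> Pr \<Phi> = Pr (\<lambda>w. \<Phi> w \<and> \<Psi> w) + Pr (\<lambda>w. \<Phi> w \<and> \<not> \<Psi> w)"
proof -
  assume d: "det \<Phi>" "det \<Psi>"
  have "Pr (\<lambda>w. \<exists>i\<in>UNIV. \<Phi> w \<and> \<Psi> w = i) = (\<Sum>i\<in>UNIV. Pr (\<lambda>w. \<Phi> w \<and> \<Psi> w = i))"
  proof (rule Pr_ex_disjoint)
    show "det (\<lambda>w. \<Phi> w \<and> \<Psi> w = i)" for i
      using determined_conj[OF d] determined_conj[OF d(1) determined_not[OF d(2)]] by (cases i) auto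
  qed auto
  then show ?thesis by (simp add: UNIV_bool)
qed

text \<open>The joint law of the weights is a product measure, hence invariant under permutations of the edges.\<close>

lemma Pr_permute:
  assumes \<tau>: "bij_betw \<tau> E E" and d: "det \<Phi>"
  shows "Pr (\<lambda>w. \<Phi> (\<lambda>e. w (\<tau> e))) = Pr \<Phi>"
proof -
  let ?N = "\<Pi>\<^sub>M e\<in>E. (borel :: real measure)"
  let ?\<mu> = "uniform_measure lborel {0..1::real}"
  let ?W = "\<lambda>\<omega>. \<lambda>e\<in>E. U e \<omega>"
  let ?T = "\<lambda>x. \<lambda>e\<in>E. x (\<tau> e)"
  have \<tau>E: "e \<in> E \<Longrightarrow> \<tau> e \<in> E" for e using \<tau> by (auto simp: bij_betw_def)
  have W: "?W \<in> measurable P ?N" by measurable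
  have "distr P ?N ?W = (\<Pi>\<^sub>M e\<in>E. distr P borel (U e))"
    using indep_vars_iff_distr_eq_PiM'[of E U "\<lambda>_. borel"] E_nonempty indep U_measurable by simp
  also have "\<dots> = (\<Pi>\<^sub>M e\<in>E. ?\<mu>)" by (rule PiM_cong) (simp_all add: distr_U)
  finally have D: "distr P ?N ?W = (\<Pi>\<^sub>M e\<in>E. ?\<mu>)" .
  have pmu: "prob_space ?\<mu>" by (rule prob_space_uniform_measure) simp_all
  have reindex: "distr (\<Pi>\<^sub>M e\<in>E. ?\<mu>) (\<Pi>\<^sub>M e\<in>E. ?\<mu>) ?T = (\<Pi>\<^sub>M e\<in>E. ?\<mu>)"
    using distr_PiM_reindex[of E "\<lambda>_. ?\<mu>" \<tau> E] pmu \<tau> \<tau>E by (auto simp: bij_betw_def)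
  have setsN: "sets (\<Pi>\<^sub>M e\<in>E. ?\<mu>) = sets ?N" by (rule sets_PiM_cong) simp_all
  have T: "?T \<in> measurable ?N ?N"
    using \<tau>E by (intro measurable_restrict) auto
  \<comment> \<open>A determined predicate ignores values outside \<open>E\<close>, so it can be
    evaluated at the restricted functions on which the product measure lives.\<close>
  have restr: "\<Psi> (\<lambda>e. x e) \<longleftrightarrow> \<Psi> (\<lambda>e\<in>E. x e)" if "det \<Psi>" for \<Psi> x
    by (rule determinedD[OF that]) (simp add: same_order_def)
  let ?A = "{x \<in> space ?N. \<Phi> x}"
  have A: "?A \<in> sets ?N"
    using determined_event[OF finite_E _ d, of "\<lambda>e x. x e" ?N] by simp
  have "Pr \<Phi> = measure (distr P ?N ?W) ?A"
    unfolding Pr_def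
    by (subst measure_distr[OF W A], rule arg_cong[where f=prob])
      (use restr[OF d] measurable_space[OF W] in auto)
  also have "\<dots> = measure (distr (distr P ?N ?W) ?N ?T) ?A"
  proof -
    have "distr (distr P ?N ?W) ?N ?T = distr (\<Pi>\<^sub>M e\<in>E. ?\<mu>) (\<Pi>\<^sub>M e\<in>E. ?\<mu>) ?T"
      by (rule distr_cong) (use D setsN in auto)
    then show ?thesis using reindex D by simp
  qed
  also have "\<dots> = prob ((?T \<circ> ?W) -` ?A \<inter> space P)"
    by (subst distr_distr[OF T W]) (rule measure_distr[OF measurable_comp[OF W T] A])
  also have "(?T \<circ> ?W) -` ?A \<inter> space P = {\<omega> \<in> space P. \<Phi> (\<lambda>e. U (\<tau> e) \<omega>)}"
  proof -
    have "\<Phi> ((?T \<circ> ?W) \<omega>) \<longleftrightarrow> \<Phi> (\<lambda>e. U (\<tau> e) \<omega>)" for \<omega>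
      by (rule determinedD[OF d]) (use \<tau>E in \<open>simp add: same_order_def\<close>)
    moreover have "(?T \<circ> ?W) \<omega> \<in> space ?N" if "\<omega> \<in> space P" for \<omega>
      by (rule measurable_space[OF measurable_comp[OF W T] that])
    ultimately show ?thesis by auto
  qed
  finally show ?thesis by (simp add: Pr_def)
qed

lemma prob_U_le:
  assumes "e \<in> E" "0 \<le> x" "x \<le> 1"
  shows "prob {\<omega> \<in> space P. U e \<omega> \<le> x} = x"
proof -
  have "prob {\<omega> \<in> space P. U e \<omega> \<le> x} = measure (distr P borel (U e)) {..x}"
    using assms by (subst measure_distr) (auto intro: arg_cong[where f=prob])
  also have "\<dots> = measure (uniform_measure lborel {0..1}) {..x}" using assms by (simp add: distr_U)
  also have "\<dots> = measure lborel ({0..1} \<inter> {..x}) / measure lborel {0..1::real}"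
    by (rule measure_uniform_measure) auto
  also have "{0..1} \<inter> {..x} = {0..x}" using assms by auto
  finally show ?thesis using assms by simp
qed

lemma prob_U_interval:
  assumes "e \<in> E" "0 \<le> x" "x \<le> y" "y \<le> 1"
  shows "prob {\<omega> \<in> space P. x < U e \<omega> \<and> U e \<omega> \<le> y} = y - x"
proof -
  have "prob ({\<omega> \<in> space P. U e \<omega> \<le> y} - {\<omega> \<in> space P. U e \<omega> \<le> x}) = y - x"
    using assms by (subst finite_measure_Diff) (auto simp: prob_U_le)
  moreover have "{\<omega> \<in> space P. U e \<omega> \<le> y} - {\<omega> \<in> space P. U e \<omega> \<le> x} =
      {\<omega> \<in> space P. x < U e \<omega> \<and> U e \<omega> \<le> y}" by auto
  ultimately show ?thesis by simp
qed

text \<open>The bridge from the weights to the finite sums of \<open>binomial_graph\<close>.\<close>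

lemma Pr_light:
  assumes X: "X \<subseteq> E"
  shows "Pr (\<lambda>w. {e \<in> E. w e \<le> p} = X) = gnp E p X"
proof -
  define A where "A e = (if e \<in> X then {..p} else {p<..})" for e :: "nat set"
  have "{\<omega> \<in> space P. {e \<in> E. U e \<omega> \<le> p} = X} = (\<Inter>e\<in>E. U e -` A e \<inter> space P)"
  proof (rule set_eqI)
    fix \<omega>
    have A_iff: "U e \<omega> \<in> A e \<longleftrightarrow> (U e \<omega> \<le> p \<longleftrightarrow> e \<in> X)" for e by (simp add: A_def not_le)
    have "{e \<in> E. U e \<omega> \<le> p} = X \<longleftrightarrow> (\<forall>e\<in>E. U e \<omega> \<in> A e)"
      unfolding A_iff using X by blast
    then show "\<omega> \<in> {\<omega> \<in> space P. {e \<in> E. U e \<omega> \<le> p} = X} \<longleftrightarrow> \<omega> \<in> (\<Inter>e\<in>E. U e -` A e \<inter> space P)"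
      using E_nonempty by auto
  qed
  then have "Pr (\<lambda>w. {e \<in> E. w e \<le> p} = X) = prob (\<Inter>e\<in>E. U e -` A e \<inter> space P)"
    by (simp add: Pr_def)
  also have "\<dots> = (\<Prod>e\<in>E. prob (U e -` A e \<inter> space P))"
    by (rule indep_varsD[OF indep E_nonempty finite_E]) (auto simp: A_def)
  also have "\<dots> = (\<Prod>e\<in>E. if e \<in> X then p else 1 - p)"
  proof (rule prod.cong[OF refl])
    fix e assume e: "e \<in> E"
    have le: "prob {\<omega> \<in> space P. U e \<omega> \<le> p} = p" using prob_U_le[OF e] p01 by simp
    have gt: "prob (space P - {\<omega> \<in> space P. U e \<omega> \<le> p}) = 1 - p"
      using prob_compl[of "{\<omega> \<in> space P. U e \<omega> \<le> p}"] e le by simp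
    have "U e -` A e \<inter> space P = (if e \<in> X then {\<omega> \<in> space P. U e \<omega> \<le> p}
        else space P - {\<omega> \<in> space P. U e \<omega> \<le> p})"
      by (auto simp: A_def)
    then show "prob (U e -` A e \<inter> space P) = (if e \<in> X then p else 1 - p)" using le gt by simp
  qed
  also have "\<dots> = (\<Prod>e\<in>X. p) * (\<Prod>e\<in>E - X. 1 - p)"
  proof -
    have "E \<inter> {e. e \<in> X} = X" "E \<inter> - {e. e \<in> X} = E - X" using X by auto
    then show ?thesis by (subst prod.If_cases[OF finite_E]) simp
  qed
  finally show ?thesis by (simp add: gnp_def)
qed

text \<open>Equal weights fall into the same one of \<open>N\<close> cells of length
  \<open>1 / N\<close>. By independence this has probability at most
  \<open>N * (1 / N)\<^sup>2\<close>, and \<open>N\<close> is arbitrary.\<close>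

lemma Pr_equal:
  assumes ef: "e \<in> E" "f \<in> E" "e \<noteq> f"
  shows "Pr (\<lambda>w. w e = w f) = 0"
proof -
  have bound: "Pr (\<lambda>w. w e = w f) \<le> 1 / real N" if N: "N > 0" for N :: nat
  proof -
    define J where "J i = {real i / real N <.. real (Suc i) / real N}" for i
    define B where "B i = {\<omega> \<in> space P. U e \<omega> \<in> J i \<and> U f \<omega> \<in> J i}" for i
    let ?O = "space P - {\<omega> \<in> space P. 0 < U e \<omega> \<and> U e \<omega> \<le> 1}"
    have mB: "B i \<in> events" for i
      unfolding B_def J_def using ef by measurable
    have pB: "prob (B i) = (1 / real N) ^ 2" if "i < N" for i
    proof -
      have "prob (\<Inter>g\<in>{e, f}. U g -` J i \<inter> space P) = (\<Prod>g\<in>{e, f}. prob (U g -` J i \<inter> space P))"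
        by (rule indep_varsD[OF indep]) (use ef in \<open>auto simp: J_def\<close>)
      moreover have "(\<Inter>g\<in>{e, f}. U g -` J i \<inter> space P) = B i" by (auto simp: B_def)
      moreover have "prob (U g -` J i \<inter> space P) = 1 / real N" if "g \<in> E" for g
      proof -
        have "U g -` J i \<inter> space P = {\<omega> \<in> space P. real i / real N < U g \<omega> \<and> U g \<omega> \<le> real (Suc i) / real N}"
          by (auto simp: J_def)
        moreover have "real (Suc i) / real N \<le> 1" using \<open>i < N\<close> by (simp add: field_simps)
        ultimately have "prob (U g -` J i \<inter> space P) = real (Suc i) / real N - real i / real N"
          using prob_U_interval[OF that, of "real i / real N" "real (Suc i) / real N"]
          by (simp add: divide_right_mono)
        then show ?thesis by (simp add: add_divide_distrib)
      qed
      ultimately show ?thesis using ef by (simp add: power2_eq_square)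
    qed
    have pO: "prob ?O = 0"
      using prob_compl[of "{\<omega> \<in> space P. 0 < U e \<omega> \<and> U e \<omega> \<le> 1}"] prob_U_interval[OF ef(1), of 0 1] ef by simp
    have sub: "{\<omega> \<in> space P. U e \<omega> = U f \<omega>} \<subseteq> ?O \<union> (\<Union>i<N. B i)"
    proof
      fix \<omega> assume \<omega>: "\<omega> \<in> {\<omega> \<in> space P. U e \<omega> = U f \<omega>}"
      show "\<omega> \<in> ?O \<union> (\<Union>i<N. B i)"
      proof (cases "0 < U e \<omega> \<and> U e \<omega> \<le> 1")
        case True
        \<comment> \<open>The cells are open on the left, so the index of a cell is found by
          rounding up and subtracting one; the value 0 belongs to no cell and is covered by the null
          set \<open>?O\<close>.\<close>
        define i where "i = nat (\<lceil>U e \<omega> * real N\<rceil> - 1)"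
        have pos: "0 < U e \<omega> * real N" using True N by simp
        then have c1: "1 \<le> \<lceil>U e \<omega> * real N\<rceil>" by linarith
        then have ri: "real i = of_int \<lceil>U e \<omega> * real N\<rceil> - 1" by (simp add: i_def)
        have "real i < U e \<omega> * real N" "U e \<omega> * real N \<le> real (Suc i)"
          using ri by (simp_all, linarith+)
        then have "U e \<omega> \<in> J i" using N by (simp add: J_def field_simps)
        moreover have "i < N"
        proof -
          have "U e \<omega> * real N \<le> real N" using True N by (simp add: mult_left_le_one_le)
          then have "real i < real N" using \<open>real i < U e \<omega> * real N\<close> by linarith
          then show ?thesis by simp
        qed
        ultimately show ?thesis using \<omega> by (auto simp: B_def)
      qed (use \<omega> in auto)
    qed
    have mO: "?O \<in> events" using ef by measurable
    have "Pr (\<lambda>w. w e = w f) \<le> prob (?O \<union> (\<Union>i<N. B i))"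
      unfolding Pr_def by (rule finite_measure_mono[OF sub]) (use mO mB in auto)
    also have "\<dots> \<le> prob ?O + prob (\<Union>i<N. B i)" using mO mB by (intro measure_Un_le) auto
    also have "prob (\<Union>i<N. B i) \<le> (\<Sum>i<N. prob (B i))"
      using mB by (intro finite_measure_subadditive_finite) auto
    also have "\<dots> = 1 / real N" using pB N by (simp add: power2_eq_square)
    finally show ?thesis using pO by simp
  qed
  show ?thesis
  proof (rule ccontr)
    assume "Pr (\<lambda>w. w e = w f) \<noteq> 0"
    then have pos: "Pr (\<lambda>w. w e = w f) > 0" using Pr_nonneg by (simp add: order_less_le)
    obtain N :: nat where "N > 0" "1 / real N < Pr (\<lambda>w. w e = w f)"
      using pos nat_approx_posE[OF pos] by (metis zero_less_Suc)
    with bound[of N] show False by linarith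
  qed
qed

lemma Pr_not_inj: "Pr (\<lambda>w. \<not> inj_on w E) = 0"
proof -
  let ?I = "{(e, f) \<in> E \<times> E. e \<noteq> f}"
  have d: "det (\<lambda>w. w (fst i) = w (snd i))" if "i \<in> ?I" for i
  proof -
    have "fst i \<in> E" "snd i \<in> E" using that by auto
    then show ?thesis unfolding determined_def same_order_def by (auto simp: order_eq_iff[where ?'a = real])
  qed
  have finI: "finite ?I" using finite_E by (auto intro: finite_subset[of _ "E \<times> E"])
  have "Pr (\<lambda>w. \<not> inj_on w E) \<le> Pr (\<lambda>w. \<exists>i\<in>?I. w (fst i) = w (snd i))"
  proof (rule Pr_mono)
    show "det (\<lambda>w. \<exists>i\<in>?I. w (fst i) = w (snd i))"
      using d unfolding determined_def by blast
  qed (auto simp: inj_on_def)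
  also have "\<dots> \<le> (\<Sum>i\<in>?I. Pr (\<lambda>w. w (fst i) = w (snd i)))" by (rule Pr_bex_le[OF finI d])
  also have "\<dots> = 0" by (rule sum.neutral) (auto simp: Pr_equal)
  finally show ?thesis using Pr_nonneg[of "\<lambda>w. \<not> inj_on w E"] by linarith
qed

text \<open>Markov's inequality for the number of events \<open>\<Phi> i\<close> that occur.\<close>

lemma Pr_count:
  assumes I: "finite I" and d: "\<And>i. i \<in> I \<Longrightarrow> det (\<Phi> i)" "det \<Psi>" and c: "c > 0"
    and imp: "\<And>w. \<Psi> w \<Longrightarrow> c \<le> real (card {i \<in> I. \<Phi> i w})"
  shows "Pr \<Psi> * c \<le> (\<Sum>i\<in>I. Pr (\<Phi> i))"
proof -
  let ?A = "\<lambda>i. {\<omega> \<in> space P. \<Phi> i (\<lambda>e. U e \<omega>)}" and ?B = "{\<omega> \<in> space P. \<Psi> (\<lambda>e. U e \<omega>)}"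
  have ind: "integrable P (indicator A :: 'a \<Rightarrow> real)" if "A \<in> events" for A
    using that by (intro integrable_real_indicator) (auto simp: emeasure_eq_measure)
  have "Pr \<Psi> * c = (\<integral>\<omega>. indicator ?B \<omega> * c \<partial>P)"
    using event[OF d(2)] by (simp add: Pr_def)
  also have "\<dots> \<le> (\<integral>\<omega>. (\<Sum>i\<in>I. indicator (?A i) \<omega>) \<partial>P)"
  proof (rule integral_mono)
    show "integrable P (\<lambda>\<omega>. indicator ?B \<omega> * c)"
      using ind[OF event[OF d(2)]] by (rule integrable_mult_left)
    show "integrable P (\<lambda>\<omega>. \<Sum>i\<in>I. indicator (?A i) \<omega> :: real)"
      using event[OF d(1)] by (intro Bochner_Integration.integrable_sum ind)
    fix \<omega> assume \<omega>: "\<omega> \<in> space P"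
    have "(\<Sum>i\<in>I. indicator (?A i) \<omega>) = real (card {i \<in> I. \<Phi> i (\<lambda>e. U e \<omega>)})"
      using I \<omega> by (simp add: indicator_def sum.If_cases Int_def)
    then show "indicator ?B \<omega> * c \<le> (\<Sum>i\<in>I. indicator (?A i) \<omega>)"
      using imp[of "\<lambda>e. U e \<omega>"] by (auto simp: indicator_def)
  qed
  also have "\<dots> = (\<Sum>i\<in>I. Pr (\<Phi> i))"
    using event[OF d(1)] by (subst Bochner_Integration.integral_sum) (simp_all add: Pr_def ind)
  finally show ?thesis .
qed

subsection \<open>Uniform entry points\<close>

definition level :: "nat set set \<Rightarrow> (nat set \<Rightarrow> real) \<Rightarrow> bool" where
  "level X w \<longleftrightarrow> inj_on w E \<and> {e \<in> E. w e \<le> p} = X"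

lemma det_level: "det (level X)"
  unfolding level_def by (intro determined_conj determined_inj determined_light)

lemma Pr_level:
  assumes X: "X \<subseteq> E"
  shows "Pr (level X) = gnp E p X"
proof -
  have d: "det (\<lambda>w. {e \<in> E. w e \<le> p} = X)" "det (\<lambda>w. inj_on w E)"
    by (rule determined_light determined_inj)+
  have "Pr (\<lambda>w. {e \<in> E. w e \<le> p} = X \<and> \<not> inj_on w E) \<le> Pr (\<lambda>w. \<not> inj_on w E)"
    by (rule Pr_mono[OF determined_not[OF d(2)]]) simp
  then have "Pr (\<lambda>w. {e \<in> E. w e \<le> p} = X \<and> \<not> inj_on w E) = 0"
    using Pr_nonneg[of "\<lambda>w. {e \<in> E. w e \<le> p} = X \<and> \<not> inj_on w E"] Pr_not_inj by linarith
  then show ?thesis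
    using Pr_split[OF d] Pr_light[OF X] unfolding level_def by (simp add: conj_commute)
qed

text \<open>Exchanging the weights of \<open>{c, z}\<close> and \<open>{b, z}\<close> preserves the
  law and turns entry at \<open>b\<close> into entry at \<open>c\<close>. By \<open>closed\<close>
  neither edge lies in \<open>X\<close>, so both weights exceed \<open>p\<close> and the level is
  preserved too. \<open>R\<close> carries a further event that the exchange respects, such as the
  entry of a second vertex.\<close>

lemma Pr_exchange:
  assumes T: "T \<subseteq> V" and closed: "\<And>x y. x \<in> T \<Longrightarrow> y \<notin> T \<Longrightarrow> {x, y} \<notin> X"
    and bc: "b \<in> T" "c \<in> T" and z: "z \<in> V - T"
    and R: "det R" "\<And>w. R w \<Longrightarrow> R (w \<circ> Transposition.transpose {c, z} {b, z})"
  shows "Pr (\<lambda>w. level X w \<and> enters E w T u z b \<and> R w) \<le> Pr (\<lambda>w. level X w \<and> enters E w T u z c \<and> R w)"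
proof -
  let ?\<tau> = "Transposition.transpose {c, z} {b, z}"
  let ?\<Phi> = "\<lambda>w. level X w \<and> enters E w T u z c \<and> R w"
  have cz: "{c, z} \<in> E" "{b, z} \<in> E" using bc z T by auto
  have \<tau>E: "?\<tau> e \<in> E \<longleftrightarrow> e \<in> E" for e
    using cz by (auto simp: Transposition.transpose_def)
  have \<tau>: "bij_betw ?\<tau> E E"
    unfolding bij_betw_def
  proof
    show "inj_on ?\<tau> E" by (rule inj_on_subset[OF inj_transpose]) simp
    show "?\<tau> ` E = E"
    proof (intro equalityI subsetI)
      fix e assume "e \<in> E"
      then have "e = ?\<tau> (?\<tau> e)" "?\<tau> e \<in> E" using \<tau>E by auto
      then show "e \<in> ?\<tau> ` E" by (rule image_eqI)
    qed (use \<tau>E in auto)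
  qed
  have d: "det ?\<Phi>"
    by (intro determined_conj det_level determined_enters R)
  have "Pr (\<lambda>w. level X w \<and> enters E w T u z b \<and> R w) \<le> Pr (\<lambda>w. ?\<Phi> (\<lambda>e. w (?\<tau> e)))"
  proof (rule Pr_mono)
    show "det (\<lambda>w. ?\<Phi> (\<lambda>e. w (?\<tau> e)))" by (rule determined_permute[OF d]) (use \<tau>E in blast)
    fix w assume w: "level X w \<and> enters E w T u z b \<and> R w"
    interpret edge_exchange E T w c b z
      by unfold_locales (use bc z cz in auto)
    have "inj_on (w \<circ> ?\<tau>) E"
      by (rule comp_inj_on) (use \<tau> w in \<open>auto simp: bij_betw_def level_def\<close>)
    moreover have "{e \<in> E. w (?\<tau> e) \<le> p} = X"
    proof -
      have X: "X = {e \<in> E. w e \<le> p}" using w by (simp add: level_def)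
      have "{c, z} \<notin> X" "{b, z} \<notin> X" using closed bc z by auto
      then have "\<not> w {c, z} \<le> p" "\<not> w {b, z} \<le> p" using X cz by auto
      then have "w (?\<tau> e) \<le> p \<longleftrightarrow> w e \<le> p" for e by (simp add: Transposition.transpose_def)
      then show ?thesis using X by simp
    qed
    moreover have "enters E (w \<circ> ?\<tau>) T u z c"
      by (rule enters_exchanged[of u z b]) (use w in auto)
    moreover have "R (w \<circ> ?\<tau>)" using R(2) w by simp
    ultimately show "?\<Phi> (\<lambda>e. w (?\<tau> e))" by (simp add: level_def o_def)
  qed
  also have "\<dots> = Pr ?\<Phi>" by (rule Pr_permute[OF \<tau> d])
  finally show ?thesis .
qed

text \<open>\<open>Pr_exchange\<close> in both directions makes the entry probabilities at all
  points of \<open>T\<close> equal; as the entry exists and is unique, they add up to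
  \<open>Pr (level X)\<close>.\<close>

lemma entry_uniform:
  assumes T: "T \<subseteq> V" "T \<noteq> {}" and closed: "\<And>x y. x \<in> T \<Longrightarrow> y \<notin> T \<Longrightarrow> {x, y} \<notin> X"
    and u: "u \<in> V - T" and K: "K \<subseteq> T"
  shows "Pr (\<lambda>w. level X w \<and> (\<exists>z. \<exists>b\<in>K. enters E w T u z b)) * real (card T) = real (card K) * Pr (level X)"
proof -
  define h where "h b = (\<Sum>z\<in>V - T. Pr (\<lambda>w. level X w \<and> enters E w T u z b))" for b
  have fT: "finite T" using T finite_subset by auto
  have h_eq: "h b = h c" if "b \<in> T" "c \<in> T" for b c
  proof -
    have "Pr (\<lambda>w. level X w \<and> enters E w T u z b) \<le> Pr (\<lambda>w. level X w \<and> enters E w T u z c)"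
      if "b \<in> T" "c \<in> T" "z \<in> V - T" for b c z
      using Pr_exchange[OF T(1) closed that, of "\<lambda>_. True" u] by (simp add: determined_const)
    then show ?thesis unfolding h_def using that by (intro sum.cong antisym) auto
  qed
  have sum: "Pr (\<lambda>w. level X w \<and> (\<exists>z. \<exists>b\<in>K. enters E w T u z b)) = (\<Sum>b\<in>K. h b)" if K: "K \<subseteq> T" for K
  proof -
    let ?I = "K \<times> (V - T)"
    have "(\<lambda>w. level X w \<and> (\<exists>z. \<exists>b\<in>K. enters E w T u z b)) =
        (\<lambda>w. \<exists>i\<in>?I. level X w \<and> enters E w T u (snd i) (fst i))"
      using enters_in(1) by (fastforce simp: fun_eq_iff)
    moreover have "Pr (\<lambda>w. \<exists>i\<in>?I. level X w \<and> enters E w T u (snd i) (fst i)) =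
        (\<Sum>i\<in>?I. Pr (\<lambda>w. level X w \<and> enters E w T u (snd i) (fst i)))"
    proof (rule Pr_ex_disjoint)
      show "finite ?I" using finite_subset[OF K fT] by auto
      show "det (\<lambda>w. level X w \<and> enters E w T u (snd i) (fst i))" for i
        by (intro determined_conj det_level determined_enters)
      show "i = j" if "level X w \<and> enters E w T u (snd i) (fst i)"
        "level X w \<and> enters E w T u (snd j) (fst j)" for w i j
        using enters_unique[OF finite_V T, of w u "snd i" "fst i" "snd j" "fst j"] that
        by (auto simp: level_def prod_eq_iff)
    qed
    ultimately show ?thesis by (simp add: h_def sum.cartesian_product case_prod_beta)
  qed
  have all: "Pr (\<lambda>w. level X w \<and> (\<exists>z. \<exists>b\<in>T. enters E w T u z b)) = Pr (level X)"
  proof (rule arg_cong[where f=Pr], rule ext)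
    fix w
    have "\<exists>z. \<exists>b\<in>T. enters E w T u z b" if "level X w"
      using enters_exists[OF finite_V T _ u, of w] that by (auto simp: level_def)
    then show "(level X w \<and> (\<exists>z. \<exists>b\<in>T. enters E w T u z b)) = level X w" by blast
  qed
  obtain b0 where b0: "b0 \<in> T" using T by auto
  have const: "(\<Sum>b\<in>K. h b) = real (card K) * h b0" if "K \<subseteq> T" for K
  proof -
    have "(\<Sum>b\<in>K. h b) = (\<Sum>b\<in>K. h b0)" using that b0 by (intro sum.cong h_eq) auto
    then show ?thesis by simp
  qed
  have "Pr (level X) = real (card T) * h b0" using all sum[of T] const[of T] by simp
  then show ?thesis using sum[OF K] const[OF K] by simp
qed

text \<open>For \<open>z \<noteq> z'\<close> an exchange at \<open>z\<close> does not touch the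
  entry through \<open>z'\<close>, so both entry points can be moved separately and all pairs in
  \<open>T \<times> T\<close> are equally likely. It is only an inequality because the exit vertices
  may also coincide.\<close>

lemma entry_pair_bound:
  assumes T: "T \<subseteq> V" "T \<noteq> {}" and closed: "\<And>x y. x \<in> T \<Longrightarrow> y \<notin> T \<Longrightarrow> {x, y} \<notin> X"
    and K: "K \<subseteq> T"
  shows "Pr (\<lambda>w. level X w \<and> (\<exists>z z'. z \<noteq> z' \<and>
      (\<exists>b\<in>K. \<exists>b'\<in>K. enters E w T u z b \<and> enters E w T v z' b'))) * (real (card T))\<^sup>2
    \<le> (real (card K))\<^sup>2 * Pr (level X)"
proof -
  let ?Z = "{(z, z') \<in> (V - T) \<times> (V - T). z \<noteq> z'}"
  let ?f = "\<lambda>u z b v z' b'. Pr (\<lambda>w. level X w \<and> enters E w T u z b \<and> enters E w T v z' b')"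
  define h where "h b b' = (\<Sum>i\<in>?Z. ?f u (fst i) b v (snd i) b')" for b b'
  have fT: "finite T" using T finite_subset by auto
  have fZ: "finite ?Z" by (rule finite_subset[of _ "(V - T) \<times> (V - T)"]) auto
  have left: "?f u z b v z' b' \<le> ?f u z c v z' b'"
    if "b \<in> T" "c \<in> T" "z \<in> V - T" "z \<noteq> z'" for b c z z' b' u v
  proof (rule Pr_exchange[OF T(1) closed that(1-3)])
    show "det (\<lambda>w. enters E w T v z' b')" by (rule determined_enters)
    show "enters E (w \<circ> Transposition.transpose {c, z} {b, z}) T v z' b'" if en: "enters E w T v z' b'" for w
    proof -
      interpret edge_exchange E T w c b z
        by unfold_locales (use \<open>b \<in> T\<close> \<open>c \<in> T\<close> \<open>z \<in> V - T\<close> T in auto)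
      show ?thesis by (rule enters_exchanged[OF en]) (use \<open>z \<noteq> z'\<close> in auto)
    qed
  qed
  have right: "?f u z b v z' b' \<le> ?f u z b v z' c'"
    if "b' \<in> T" "c' \<in> T" "z' \<in> V - T" "z \<noteq> z'" for b z z' b' c'
  proof -
    have "?f u z b v z' b' = Pr (\<lambda>w. level X w \<and> enters E w T v z' b' \<and> enters E w T u z b)" for b'
      by (rule arg_cong[where f=Pr]) auto
    then show ?thesis using left[OF that(1-3), of z v u b] that(4) by auto
  qed
  have h_eq: "h b b' = h c c'" if "b \<in> T" "c \<in> T" "b' \<in> T" "c' \<in> T" for b c b' c'
    unfolding h_def
  proof (rule sum.cong[OF refl])
    fix i assume "i \<in> ?Z"
    then have i: "fst i \<in> V - T" "snd i \<in> V - T" "fst i \<noteq> snd i" by auto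
    have "?f u (fst i) b v (snd i) b' = ?f u (fst i) c v (snd i) b'"
      using left i that by (intro antisym) auto
    also have "\<dots> = ?f u (fst i) c v (snd i) c'"
      using right i that by (intro antisym) auto
    finally show "?f u (fst i) b v (snd i) b' = ?f u (fst i) c v (snd i) c'" .
  qed
  have sum: "Pr (\<lambda>w. level X w \<and> (\<exists>z z'. z \<noteq> z' \<and>
      (\<exists>b\<in>K. \<exists>b'\<in>K. enters E w T u z b \<and> enters E w T v z' b'))) = (\<Sum>b\<in>K. \<Sum>b'\<in>K. h b b')"
    if K: "K \<subseteq> T" for K
  proof -
    let ?I = "(K \<times> K) \<times> ?Z"
    let ?g = "\<lambda>i w. level X w \<and> enters E w T u (fst (snd i)) (fst (fst i)) \<and> enters E w T v (snd (snd i)) (snd (fst i))"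
    have "(\<lambda>w. level X w \<and> (\<exists>z z'. z \<noteq> z' \<and>
        (\<exists>b\<in>K. \<exists>b'\<in>K. enters E w T u z b \<and> enters E w T v z' b'))) = (\<lambda>w. \<exists>i\<in>?I. ?g i w)"
    proof (rule ext, rule iffI)
      fix w assume "level X w \<and> (\<exists>z z'. z \<noteq> z' \<and>
        (\<exists>b\<in>K. \<exists>b'\<in>K. enters E w T u z b \<and> enters E w T v z' b'))"
      then obtain z z' b b' where *: "level X w" "z \<noteq> z'" "b \<in> K" "b' \<in> K"
        "enters E w T u z b" "enters E w T v z' b'" by blast
      then have "((b, b'), (z, z')) \<in> ?I"
        using enters_in(1)[OF *(5)] enters_in(1)[OF *(6)] by auto
      then show "\<exists>i\<in>?I. ?g i w" by (rule bexI[rotated]) (use * in auto)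
    next
      fix w assume "\<exists>i\<in>?I. ?g i w"
      then obtain b b' z z' where "b \<in> K" "b' \<in> K" "z \<noteq> z'" "level X w"
        "enters E w T u z b" "enters E w T v z' b'" by auto
      then show "level X w \<and> (\<exists>z z'. z \<noteq> z' \<and>
        (\<exists>b\<in>K. \<exists>b'\<in>K. enters E w T u z b \<and> enters E w T v z' b'))" by blast
    qed
    moreover have "Pr (\<lambda>w. \<exists>i\<in>?I. ?g i w) = (\<Sum>i\<in>?I. Pr (?g i))"
    proof (rule Pr_ex_disjoint)
      show "finite ?I" using finite_subset[OF K fT] fZ by auto
      show "det (?g i)" for i
        by (intro determined_conj det_level determined_enters)
      show "i = j" if "?g i w" "?g j w" for w i j
        using enters_unique[OF finite_V T, of w u "fst (snd i)" "fst (fst i)" "fst (snd j)" "fst (fst j)"]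
          enters_unique[OF finite_V T, of w v "snd (snd i)" "snd (fst i)" "snd (snd j)" "snd (fst j)"] that
        by (auto simp: level_def prod_eq_iff)
    qed
    moreover have "(\<Sum>b\<in>K. \<Sum>b'\<in>K. h b b') = (\<Sum>i\<in>K \<times> K. h (fst i) (snd i))"
      by (simp add: sum.cartesian_product split_def)
    moreover have "(\<Sum>i\<in>K \<times> K. h (fst i) (snd i)) = (\<Sum>i\<in>?I. Pr (?g i))"
      unfolding h_def by (simp add: sum.cartesian_product split_def)
    ultimately show ?thesis by (simp only:)
  qed
  obtain b0 where b0: "b0 \<in> T" using T by auto
  have const: "(\<Sum>b\<in>K. \<Sum>b'\<in>K. h b b') = (real (card K))\<^sup>2 * h b0 b0" if "K \<subseteq> T" for K
  proof -
    have "(\<Sum>b\<in>K. \<Sum>b'\<in>K. h b b') = (\<Sum>b\<in>K. \<Sum>b'\<in>K. h b0 b0)"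
      using that b0 by (intro sum.cong h_eq refl) auto
    then show ?thesis by (simp add: power2_eq_square)
  qed
  have "(real (card T))\<^sup>2 * h b0 b0 \<le> Pr (level X)"
    unfolding const[OF order_refl, symmetric] sum[OF order_refl, symmetric]
    by (rule Pr_mono[OF det_level]) simp
  then have "(real (card K))\<^sup>2 * ((real (card T))\<^sup>2 * h b0 b0) \<le> (real (card K))\<^sup>2 * Pr (level X)"
    by (rule mult_left_mono) simp
  then show ?thesis unfolding sum[OF K] const[OF K] by (simp add: mult_ac)
qed

end

subsection \<open>Bounds on the largest tree\<close>

lemma component_le_largest:
  assumes "finite V" "x \<in> V"
  shows "card {v \<in> V. (x, v) \<in> (adj F)\<^sup>*} \<le> largest_component_size V F"
  unfolding largest_component_size_def
  by (rule Max_ge) (use assms in \<open>auto simp: components_of_graph_def adj_def\<close>)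

lemma largest_component_attained:
  assumes "finite V" "V \<noteq> {}"
  shows "\<exists>x\<in>V. largest_component_size V F = card {v \<in> V. (x, v) \<in> (adj F)\<^sup>*}"
proof -
  have "largest_component_size V F \<in> card ` components_of_graph V F"
    unfolding largest_component_size_def
    by (rule Max_in) (use assms in \<open>auto simp: components_of_graph_def\<close>)
  then show ?thesis by (auto simp: components_of_graph_def adj_def)
qed

lemma largest_component_le_card:
  assumes "finite V" "V \<noteq> {}"
  shows "largest_component_size V F \<le> card V"
proof -
  obtain x where "largest_component_size V F = card {v \<in> V. (x, v) \<in> (adj F)\<^sup>*}"
    using largest_component_attained[OF assms] by blast
  also have "\<dots> \<le> card V" by (rule card_mono) (use assms in auto)
  finally show ?thesis .
qed

lemma largest_component_square:
  assumes "finite V" "V \<noteq> {}"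
  shows "(real (largest_component_size V F))\<^sup>2 \<le> real (card {i \<in> V \<times> V. (fst i, snd i) \<in> (adj F)\<^sup>*})"
proof -
  obtain x where x: "largest_component_size V F = card {v \<in> V. (x, v) \<in> (adj F)\<^sup>*}"
    using largest_component_attained[OF assms] by blast
  let ?C = "{v \<in> V. (x, v) \<in> (adj F)\<^sup>*}"
  have "?C \<times> ?C \<subseteq> {i \<in> V \<times> V. (fst i, snd i) \<in> (adj F)\<^sup>*}"
  proof
    fix i assume "i \<in> ?C \<times> ?C"
    then have i: "fst i \<in> V" "snd i \<in> V" "(x, fst i) \<in> (adj F)\<^sup>*" "(x, snd i) \<in> (adj F)\<^sup>*" by auto
    from rtrancl_trans[OF rtrancl_adj_sym[OF i(3)] i(4)] i
    show "i \<in> {i \<in> V \<times> V. (fst i, snd i) \<in> (adj F)\<^sup>*}" by (auto simp: mem_Times_iff)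
  qed
  then have "card (?C \<times> ?C) \<le> card {i \<in> V \<times> V. (fst i, snd i) \<in> (adj F)\<^sup>*}"
    by (intro card_mono) (use assms in auto)
  then have "real (card ?C * card ?C) \<le> real (card {i \<in> V \<times> V. (fst i, snd i) \<in> (adj F)\<^sup>*})"
    by (simp only: card_cartesian_product of_nat_le_iff)
  then show ?thesis by (simp add: x power2_eq_square)
qed

text \<open>Every component is counted once for each of its vertices.\<close>

lemma sum_card_clusters_squared:
  assumes "finite V" "X \<subseteq> nsets V 2"
  shows "(\<Sum>K\<in>(\<lambda>x. cluster X {x}) ` V. (real (card K))\<^sup>2) = (\<Sum>x\<in>V. real (card (cluster X {x})))"
proof -
  have "(\<Sum>x\<in>V. real (card (cluster X {x}))) =
      (\<Sum>K\<in>(\<lambda>x. cluster X {x}) ` V. \<Sum>x\<in>{x \<in> V. cluster X {x} = K}. real (card (cluster X {x})))"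
    by (rule sum.image_gen[OF assms(1)])
  also have "\<dots> = (\<Sum>K\<in>(\<lambda>x. cluster X {x}) ` V. (real (card K))\<^sup>2)"
  proof (rule sum.cong[OF refl])
    fix K assume "K \<in> (\<lambda>x. cluster X {x}) ` V"
    then obtain y where y: "y \<in> V" "K = cluster X {y}" by auto
    have "K \<subseteq> V" using cluster_subset[OF assms(2), of "{y}"] y by simp
    then have "{x \<in> V. cluster X {x} = K} = K"
      using y cluster_singleton_eq self_mem_cluster by fastforce
    moreover have "(\<Sum>x\<in>{x \<in> V. cluster X {x} = K}. real (card (cluster X {x}))) =
        (\<Sum>x\<in>{x \<in> V. cluster X {x} = K}. real (card K))" by (rule sum.cong) auto
    ultimately show "(\<Sum>x\<in>{x \<in> V. cluster X {x} = K}. real (card (cluster X {x}))) = (real (card K))\<^sup>2"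
      by (simp add: power2_eq_square)
  qed
  finally show ?thesis ..
qed

section \<open>Tree sizes given the light edges\<close>

context random_weights
begin

abbreviation forest :: "nat set \<Rightarrow> (nat set \<Rightarrow> real) \<Rightarrow> nat set set" where
  "forest S w \<equiv> invasion_forest V E w S"

abbreviation same_tree :: "nat set \<Rightarrow> (nat set \<Rightarrow> real) \<Rightarrow> nat \<Rightarrow> nat \<Rightarrow> bool" where
  "same_tree S w u v \<equiv> (u, v) \<in> (adj (forest S w))\<^sup>*"

lemma det_same_tree: "det (\<lambda>w. same_tree S w u v)"
  by (rule determined_forest[where \<Phi> = "\<lambda>F. (u, v) \<in> (adj F)\<^sup>*"])

lemma det_entry: "det (\<lambda>w. \<exists>z. \<exists>b\<in>K. enters E w T u z b)"
  by (intro determined_ex determined_bex determined_enters)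

text \<open>Conditioning on the light edges: good sets \<open>X\<close> are treated one by one, bad
  ones are charged with their full probability, and coinciding weights cost nothing.\<close>

lemma Pr_le_levels:
  assumes d: "det \<Phi>"
  shows "Pr \<Phi> \<le> (\<Sum>X\<in>{X \<in> Pow E. Q X}. Pr (\<lambda>w. level X w \<and> \<Phi> w)) + avg (\<lambda>X. if Q X then 0 else 1)"
proof -
  let ?G = "{X \<in> Pow E. Q X}" and ?B = "{X \<in> Pow E. \<not> Q X}"
  have fin: "finite ?G" "finite ?B" using finite_E by auto
  have d1: "det (\<lambda>w. level X w \<and> \<Phi> w)" for X by (intro determined_conj det_level d)
  have d2: "det (\<lambda>w. \<exists>X\<in>?B. level X w)" "det (\<lambda>w. \<not> inj_on w E)" "det (\<lambda>w. \<exists>X\<in>?G. level X w \<and> \<Phi> w)"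
    by (intro determined_bex det_level determined_not determined_inj d1)+
  have "Pr \<Phi> \<le> Pr (\<lambda>w. (\<exists>X\<in>?G. level X w \<and> \<Phi> w) \<or> ((\<exists>X\<in>?B. level X w) \<or> \<not> inj_on w E))"
  proof (rule Pr_mono)
    fix w assume "\<Phi> w"
    then show "(\<exists>X\<in>?G. level X w \<and> \<Phi> w) \<or> ((\<exists>X\<in>?B. level X w) \<or> \<not> inj_on w E)"
      by (cases "Q {e \<in> E. w e \<le> p}") (auto simp: level_def)
  qed (intro determined_disj d2)
  also have "\<dots> \<le> Pr (\<lambda>w. \<exists>X\<in>?G. level X w \<and> \<Phi> w) + Pr (\<lambda>w. (\<exists>X\<in>?B. level X w) \<or> \<not> inj_on w E)"
    by (intro Pr_disj_le determined_disj d2)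
  also have "\<dots> \<le> (\<Sum>X\<in>?G. Pr (\<lambda>w. level X w \<and> \<Phi> w)) + (\<Sum>X\<in>?B. Pr (level X))"
    using Pr_bex_le[OF fin(1), of "\<lambda>X w. level X w \<and> \<Phi> w", OF d1] Pr_bex_le[OF fin(2), of level, OF det_level] Pr_disj_le[OF d2(1,2)] Pr_not_inj
    by linarith
  also have "(\<Sum>X\<in>?B. Pr (level X)) = (\<Sum>X\<in>?B. gnp E p X)"
    by (intro sum.cong Pr_level) auto
  also have "\<dots> = avg (\<lambda>X. if Q X then 0 else 1)"
    unfolding avg_def using finite_E by (intro sum.mono_neutral_cong_left) auto
  finally show ?thesis .
qed

lemma cluster_union_closed:
  "x \<in> cluster X A \<union> cluster X B \<Longrightarrow> y \<notin> cluster X A \<union> cluster X B \<Longrightarrow> {x, y} \<notin> X"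
proof
  assume *: "x \<in> cluster X A \<union> cluster X B" "y \<notin> cluster X A \<union> cluster X B" "{x, y} \<in> X"
  then have "(x, y) \<in> (adj X)\<^sup>*" by (auto simp: adj_def)
  with * show False using cluster_step[of x X _ y] by blast
qed

text \<open>Union bound over the cases of \<open>same_tree_cases\<close>. Every contracted set
  contains the cluster of \<open>S\<close>, so each entry probability has a denominator of at least
  \<open>d\<close>, whatever the component.\<close>

lemma same_tree_bound:
  assumes X: "X \<subseteq> E" and S: "S \<subseteq> V" "S \<noteq> {}" and uv: "u \<in> V" "v \<in> V"
  defines "d \<equiv> real (card (cluster X S))"
  shows "Pr (\<lambda>w. level X w \<and> same_tree S w u v) \<le>
    ((if v \<in> cluster X {u} then 1 else 0) + real (card (cluster X {u})) / d + real (card (cluster X {v})) / d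
     + (\<Sum>K\<in>(\<lambda>x. cluster X {x}) ` V. (real (card K))\<^sup>2) / d\<^sup>2) * Pr (level X)"
proof -
  let ?D = "cluster X S" and ?KK = "(\<lambda>x. cluster X {x}) ` V"
  let ?e = "\<lambda>w K u. \<exists>z. \<exists>b\<in>K. enters E w (K \<union> ?D) u z b"
  let ?ee = "\<lambda>w K. \<exists>z z'. z \<noteq> z' \<and>
      (\<exists>b\<in>K. \<exists>b'\<in>K. enters E w (K \<union> ?D) u z b \<and> enters E w (K \<union> ?D) v z' b')"
  have DV: "?D \<subseteq> V" by (rule cluster_subset[OF X S(1)])
  have SD: "S \<subseteq> ?D" by (rule subset_cluster)
  have fD: "finite ?D" using DV finite_V by (rule finite_subset)
  have "?D \<noteq> {}" using SD S(2) by auto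
  then have d0: "0 < d" using fD by (simp add: d_def card_gt_0_iff)
  have KV: "cluster X {x} \<subseteq> V" if "x \<in> V" for x using cluster_subset[OF X, of "{x}"] that by simp
  have dT: "d \<le> real (card (K \<union> ?D))" if "K \<subseteq> V" for K
  proof -
    have "finite (K \<union> ?D)" using that DV finite_V finite_subset by blast
    then show ?thesis unfolding d_def by (simp add: card_mono)
  qed
  have ee_det: "det (\<lambda>w. ?ee w K)" for K
    by (intro determined_ex determined_bex determined_conj determined_const determined_enters)
  have single: "Pr (\<lambda>w. level X w \<and> ?e w (cluster X {x}) y) \<le> real (card (cluster X {x})) / d * Pr (level X)"
    if xy: "x \<in> V" "y \<in> V" for x y
  proof (cases "y \<in> cluster X {x} \<union> ?D")
    case True
    then have "(\<lambda>w. level X w \<and> ?e w (cluster X {x}) y) = (\<lambda>w. False)"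
      by (auto simp: enters_def fun_eq_iff)
    moreover have "Pr (\<lambda>w. False) = 0" by (simp add: Pr_def)
    ultimately show ?thesis using d0 Pr_nonneg by simp
  next
    case False
    let ?T = "cluster X {x} \<union> ?D"
    have "Pr (\<lambda>w. level X w \<and> ?e w (cluster X {x}) y) * real (card ?T) = real (card (cluster X {x})) * Pr (level X)"
    proof (rule entry_uniform)
      show "{y, y'} \<notin> X" if "y \<in> ?T" "y' \<notin> ?T" for y y' using that by (rule cluster_union_closed)
    qed (use KV[OF xy(1)] DV False xy SD S in auto)
    then have "Pr (\<lambda>w. level X w \<and> ?e w (cluster X {x}) y) = real (card (cluster X {x})) * Pr (level X) / real (card ?T)"
      using d0 dT[OF KV[OF xy(1)]] by (simp add: field_simps)
    also have "\<dots> \<le> real (card (cluster X {x})) * Pr (level X) / d"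
      using d0 dT[OF KV[OF xy(1)]] Pr_nonneg by (intro divide_left_mono mult_nonneg_nonneg) auto
    finally show ?thesis by simp
  qed
  have pair: "Pr (\<lambda>w. level X w \<and> ?ee w K) \<le> (real (card K))\<^sup>2 / d\<^sup>2 * Pr (level X)" if K: "K \<in> ?KK" for K
  proof -
    obtain x where x: "x \<in> V" "K = cluster X {x}" using K by blast
    let ?T = "K \<union> ?D"
    have "Pr (\<lambda>w. level X w \<and> ?ee w K) * (real (card ?T))\<^sup>2 \<le> (real (card K))\<^sup>2 * Pr (level X)"
      unfolding x(2)
    proof (rule entry_pair_bound)
      show "{y, y'} \<notin> X" if "y \<in> cluster X {x} \<union> ?D" "y' \<notin> cluster X {x} \<union> ?D" for y y'
        using that by (rule cluster_union_closed)
    qed (use KV[OF x(1)] DV SD S in auto)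
    moreover have "d\<^sup>2 \<le> (real (card ?T))\<^sup>2" using dT[of K] KV[OF x(1)] x(2) d0 by (intro power_mono) auto
    ultimately have "Pr (\<lambda>w. level X w \<and> ?ee w K) * d\<^sup>2 \<le> (real (card K))\<^sup>2 * Pr (level X)"
      using Pr_nonneg mult_left_mono order_trans by blast
    then show ?thesis using d0 by (simp add: field_simps)
  qed
  have d1: "det (\<lambda>w. level X w \<and> v \<in> cluster X {u})" "det (\<lambda>w. level X w \<and> ?e w (cluster X {x}) y)"
    "det (\<lambda>w. \<exists>K\<in>?KK. level X w \<and> ?ee w K)" for x y
    by (intro determined_conj det_level determined_const det_entry determined_bex ee_det)+
  have "Pr (\<lambda>w. level X w \<and> same_tree S w u v) \<le>
    Pr (\<lambda>w. (level X w \<and> v \<in> cluster X {u}) \<or> ((level X w \<and> ?e w (cluster X {u}) v) \<or>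
      ((level X w \<and> ?e w (cluster X {v}) u) \<or> (\<exists>K\<in>?KK. level X w \<and> ?ee w K))))"
  proof (rule Pr_mono)
    fix w assume w: "level X w \<and> same_tree S w u v"
    obtain par rank where tree: "invasion_tree V S w par rank"
      and F: "forest S w = (\<lambda>v. {v, par v}) ` (V - S)"
      using invasion_tree_exists[OF finite_V S] by metis
    have "inj_on w E" "X = {e \<in> E. w e \<le> p}" using w by (auto simp: level_def)
    from invasion_tree.same_tree_cases[OF tree this(2) refl this(1) uv]
    show "(level X w \<and> v \<in> cluster X {u}) \<or> ((level X w \<and> ?e w (cluster X {u}) v) \<or>
      ((level X w \<and> ?e w (cluster X {v}) u) \<or> (\<exists>K\<in>?KK. level X w \<and> ?ee w K)))"
      using w by (simp only: F) blast
  qed (intro determined_disj d1)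
  also have "\<dots> \<le> Pr (\<lambda>w. level X w \<and> v \<in> cluster X {u}) + (Pr (\<lambda>w. level X w \<and> ?e w (cluster X {u}) v) +
      (Pr (\<lambda>w. level X w \<and> ?e w (cluster X {v}) u) + Pr (\<lambda>w. \<exists>K\<in>?KK. level X w \<and> ?ee w K)))"
    by (intro order_trans[OF Pr_disj_le] add_mono order_refl determined_disj d1)
  also have "\<dots> \<le> (if v \<in> cluster X {u} then 1 else 0) * Pr (level X) +
     (real (card (cluster X {u})) / d * Pr (level X) + (real (card (cluster X {v})) / d * Pr (level X) +
      (\<Sum>K\<in>?KK. (real (card K))\<^sup>2 / d\<^sup>2 * Pr (level X))))"
  proof (intro add_mono single uv)
    have "Pr (\<lambda>w. False) = 0" by (simp add: Pr_def)
    then show "Pr (\<lambda>w. level X w \<and> v \<in> cluster X {u}) \<le> (if v \<in> cluster X {u} then 1 else 0) * Pr (level X)"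
      by (cases "v \<in> cluster X {u}") auto
    have "Pr (\<lambda>w. \<exists>K\<in>?KK. level X w \<and> ?ee w K) \<le> (\<Sum>K\<in>?KK. Pr (\<lambda>w. level X w \<and> ?ee w K))"
    proof (rule Pr_bex_le)
      show "det (\<lambda>w. level X w \<and> ?ee w K)" for K by (intro determined_conj det_level ee_det)
    qed simp
    also have "\<dots> \<le> (\<Sum>K\<in>?KK. (real (card K))\<^sup>2 / d\<^sup>2 * Pr (level X))" by (rule sum_mono[OF pair])
    finally show "Pr (\<lambda>w. \<exists>K\<in>?KK. level X w \<and> ?ee w K) \<le> (\<Sum>K\<in>?KK. (real (card K))\<^sup>2 / d\<^sup>2 * Pr (level X))" .
  qed
  also have "\<dots> = ((if v \<in> cluster X {u} then 1 else 0) + real (card (cluster X {u})) / d + real (card (cluster X {v})) / d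
     + (\<Sum>K\<in>?KK. (real (card K))\<^sup>2) / d\<^sup>2) * Pr (level X)"
    by (simp add: distrib_right sum_distrib_right sum_divide_distrib add.assoc)
  finally show ?thesis .
qed

text \<open>Summed over all pairs, the terms give \<open>Y\<close>, twice \<open>n * Y / d\<close>,
  and \<open>n\<^sup>2 * Y / d\<^sup>2\<close>. The last dominates because \<open>d \<le> n\<close>,
  whence the factor 4.\<close>

lemma same_tree_sum_bound:
  assumes X: "X \<subseteq> E" and S: "S \<subseteq> V" "S \<noteq> {}"
  defines "d \<equiv> real (card (cluster X S))"
  shows "(\<Sum>i\<in>V \<times> V. Pr (\<lambda>w. level X w \<and> same_tree S w (fst i) (snd i))) \<le>
    4 * (real n)\<^sup>2 / d\<^sup>2 * (\<Sum>x\<in>V. real (card (cluster X {x}))) * Pr (level X)"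
proof -
  define Y where "Y = (\<Sum>x\<in>V. real (card (cluster X {x})))"
  have Y0: "0 \<le> Y" by (simp add: Y_def sum_nonneg)
  have DV: "cluster X S \<subseteq> V" by (rule cluster_subset[OF X S(1)])
  have fD: "finite (cluster X S)" using DV finite_V by (rule finite_subset)
  have "cluster X S \<noteq> {}" using subset_cluster[of S X] S(2) by auto
  then have d0: "0 < d" using fD by (simp add: d_def card_gt_0_iff)
  have dn: "d \<le> real n" using card_cluster_le[OF X S(1)] by (simp add: d_def)
  let ?g = "\<lambda>u v. (if v \<in> cluster X {u} then 1 else 0) + real (card (cluster X {u})) / d
      + real (card (cluster X {v})) / d + Y / d\<^sup>2"
  have "(\<Sum>i\<in>V \<times> V. Pr (\<lambda>w. level X w \<and> same_tree S w (fst i) (snd i))) \<le>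
      (\<Sum>i\<in>V \<times> V. ?g (fst i) (snd i) * Pr (level X))"
  proof (rule sum_mono)
    fix i assume "i \<in> V \<times> V"
    then show "Pr (\<lambda>w. level X w \<and> same_tree S w (fst i) (snd i)) \<le> ?g (fst i) (snd i) * Pr (level X)"
      using same_tree_bound[OF X S, of "fst i" "snd i"]
      unfolding Y_def d_def sum_card_clusters_squared[OF finite_V X] by auto
  qed
  also have "\<dots> = (\<Sum>u\<in>V. \<Sum>v\<in>V. ?g u v) * Pr (level X)"
    by (simp add: sum.cartesian_product case_prod_beta sum_distrib_right)
  also have "(\<Sum>u\<in>V. \<Sum>v\<in>V. ?g u v) = Y + real n * Y / d + real n * Y / d + (real n)\<^sup>2 * Y / d\<^sup>2"
  proof -
    have "(\<Sum>v\<in>V. if v \<in> cluster X {u} then 1 else 0) = real (card (cluster X {u}))" if "u \<in> V" for u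
    proof -
      have "V \<inter> cluster X {u} = cluster X {u}" using cluster_subset[OF X, of "{u}"] that by auto
      then show ?thesis using finite_V by (simp add: sum.If_cases Int_def)
    qed
    then have "(\<Sum>u\<in>V. \<Sum>v\<in>V. if v \<in> cluster X {u} then 1 else 0) = Y" by (simp add: Y_def)
    then show ?thesis
      by (simp add: sum.distrib power2_eq_square Y_def sum_distrib_left sum_divide_distrib mult.assoc flip: sum_distrib_right)
  qed
  also have "\<dots> \<le> 4 * (real n)\<^sup>2 / d\<^sup>2 * Y"
  proof -
    have r: "1 \<le> real n / d" using d0 dn by simp
    have r2: "real n / d \<le> (real n / d)\<^sup>2" using r mult_left_mono[of 1 "real n / d" "real n / d"] by (simp add: power2_eq_square)
    define R where "R = (real n / d)\<^sup>2"
    have f1: "Y \<le> R * Y" using r r2 Y0 mult_right_mono[of 1 R Y] by (simp add: R_def)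
    have f2: "real n / d * Y \<le> R * Y" unfolding R_def using r2 Y0 by (rule mult_right_mono)
    have "Y + real n * Y / d + real n * Y / d + (real n)\<^sup>2 * Y / d\<^sup>2 =
        Y + real n / d * Y + real n / d * Y + R * Y" by (simp add: R_def power_divide)
    also have "\<dots> \<le> R * Y + R * Y + R * Y + R * Y" by (intro add_mono f1 f2 order_refl)
    also have "\<dots> = 4 * (real n)\<^sup>2 / d\<^sup>2 * Y" by (simp add: R_def power_divide)
    finally show ?thesis .
  qed
  finally show ?thesis using Pr_nonneg by (simp add: Y_def mult_right_mono)
qed

text \<open>As \<open>k = n * \<epsilon>\<^sup>2\<close>, with \<open>z = \<epsilon>\<close> and
  \<open>m = \<epsilon> * n / 8\<close> both parts of the exponent in
  \<open>cluster_lower_tail\<close> are multiples of \<open>n * \<epsilon> ^ 3\<close>, with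
  coefficients -1/2 and 9/32. The divisor 8 makes their sum negative; it also produces 256 as
  \<open>4 * 8\<^sup>2\<close>.\<close>

lemma many_sources_bound:
  assumes S: "S \<subseteq> V" "S \<noteq> {}" and k: "k = card S" and eps: "\<epsilon> = sqrt (real k / real n)"
    and pe: "p = (1 - \<epsilon>) / real n" and \<delta>: "\<delta> > 0"
  shows "Pr (\<lambda>w. \<delta> * real n < real (largest_component_size V (forest S w))) \<le>
    256 / (\<delta>\<^sup>2 * (real n * \<epsilon> ^ 3)) + exp (- (7 / 32) * (real n * \<epsilon> ^ 3))"
proof -
  define m where "m = \<epsilon> * real n / 8"
  define \<Phi> where "\<Phi> w \<longleftrightarrow> \<delta> * real n < real (largest_component_size V (forest S w))" for w
  let ?Y = "\<lambda>X. \<Sum>x\<in>V. real (card (cluster X {x}))"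
  let ?Q = "\<lambda>X. m < real (card (cluster X S))"
  have fS: "finite S" using S finite_V finite_subset by blast
  have kn: "0 < k" "k \<le> n" using S fS card_mono[OF finite_V S(1)] by (auto simp: k card_gt_0_iff)
  have n0: "0 < real n" using n2 by simp
  have e: "0 < \<epsilon>" "\<epsilon> \<le> 1" using kn by (auto simp: eps)
  have e2: "\<epsilon>\<^sup>2 = real k / real n" by (simp add: eps)
  have m0: "0 < m" using e n0 by (simp add: m_def)
  have d: "det \<Phi>" unfolding \<Phi>_def by (rule determined_forest)
  have perX: "Pr (\<lambda>w. level X w \<and> \<Phi> w) \<le> gnp E p X * (4 / (\<delta>\<^sup>2 * m\<^sup>2) * ?Y X)"
    if X: "X \<subseteq> E" "?Q X" for X
  proof -
    \<comment> \<open>A tree with more than \<open>\<delta> * n\<close> vertices supplies more than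
      \<open>(\<delta> * n)\<^sup>2\<close> ordered pairs in the same tree.\<close>
    have "Pr (\<lambda>w. level X w \<and> \<Phi> w) * (\<delta> * real n)\<^sup>2 \<le>
        (\<Sum>i\<in>V \<times> V. Pr (\<lambda>w. level X w \<and> same_tree S w (fst i) (snd i)))"
    proof (rule Pr_count)
      show "det (\<lambda>w. level X w \<and> same_tree S w (fst i) (snd i))" for i
        by (intro determined_conj det_level det_same_tree)
      show "det (\<lambda>w. level X w \<and> \<Phi> w)" by (intro determined_conj det_level d)
      show "0 < (\<delta> * real n)\<^sup>2" using \<delta> n0 by simp
      fix w assume w: "level X w \<and> \<Phi> w"
      then have "(\<delta> * real n)\<^sup>2 \<le> (real (largest_component_size V (forest S w)))\<^sup>2"
        using \<delta> by (intro power_mono) (auto simp: \<Phi>_def)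
      also have "\<dots> \<le> real (card {i \<in> V \<times> V. same_tree S w (fst i) (snd i)})"
        by (rule largest_component_square) (use n2 in auto)
      finally show "(\<delta> * real n)\<^sup>2 \<le> real (card {i \<in> V \<times> V. level X w \<and> same_tree S w (fst i) (snd i)})"
        using w by simp
    qed simp
    also have "\<dots> \<le> 4 * (real n)\<^sup>2 / (real (card (cluster X S)))\<^sup>2 * ?Y X * Pr (level X)"
      by (rule same_tree_sum_bound[OF X(1) S])
    also have "\<dots> \<le> 4 * (real n)\<^sup>2 / m\<^sup>2 * ?Y X * Pr (level X)"
      using X(2) m0 Pr_nonneg
      by (intro mult_right_mono divide_left_mono power_mono mult_pos_pos zero_less_power) (auto intro: sum_nonneg)
    finally have "Pr (\<lambda>w. level X w \<and> \<Phi> w) \<le> Pr (level X) * (4 / (\<delta>\<^sup>2 * m\<^sup>2) * ?Y X)"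
      using \<delta> n0 m0 by (simp add: field_simps power_mult_distrib)
    then show ?thesis by (simp add: Pr_level[OF X(1)])
  qed
  have Y0: "0 \<le> ?Y X" for X by (rule sum_nonneg) simp
  have "(\<Sum>X\<in>{X \<in> Pow E. ?Q X}. Pr (\<lambda>w. level X w \<and> \<Phi> w)) \<le>
      (\<Sum>X\<in>{X \<in> Pow E. ?Q X}. gnp E p X * (4 / (\<delta>\<^sup>2 * m\<^sup>2) * ?Y X))"
    by (rule sum_mono) (use perX in auto)
  also have "\<dots> \<le> avg (\<lambda>X. 4 / (\<delta>\<^sup>2 * m\<^sup>2) * ?Y X)"
    unfolding avg_def using finite_E p01 gnp_nonneg[of p E] Y0
    by (intro sum_mono2) (auto intro!: mult_nonneg_nonneg divide_nonneg_nonneg)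
  also have "\<dots> = 4 / (\<delta>\<^sup>2 * m\<^sup>2) * (\<Sum>x\<in>V. avg (\<lambda>X. real (card (cluster X {x}))))"
    by (simp only: avg_cmult avg_sum)
  also have "\<dots> \<le> 4 / (\<delta>\<^sup>2 * m\<^sup>2) * (\<Sum>x\<in>V. 1 / \<epsilon>)"
  proof (intro mult_left_mono sum_mono)
    fix x assume "x \<in> V"
    then show "avg (\<lambda>X. real (card (cluster X {x}))) \<le> 1 / \<epsilon>"
      using cluster_mean[of "{x}" \<epsilon>] e pe n2 by simp
  qed simp
  also have "\<dots> = 256 / (\<delta>\<^sup>2 * (real n * \<epsilon> ^ 3))"
    using e n0 \<delta> by (simp add: m_def field_simps power2_eq_square power3_eq_cube)
  finally have good: "(\<Sum>X\<in>{X \<in> Pow E. ?Q X}. Pr (\<lambda>w. level X w \<and> \<Phi> w)) \<le> 256 / (\<delta>\<^sup>2 * (real n * \<epsilon> ^ 3))" .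
  have "avg (\<lambda>X. if ?Q X then 0 else 1) = avg (\<lambda>X. if real (card (cluster X S)) \<le> m then 1 else 0)"
    by (rule avg_cong) auto
  also have "\<dots> \<le> exp (- (real (card S) * \<epsilon> / 2) + \<epsilon> * m * (\<epsilon> + \<epsilon> + 2 * m / real n))"
    by (rule cluster_lower_tail[OF S(1) _ _ _ pe]) (use e m0 n2 in auto)
  also have "- (real (card S) * \<epsilon> / 2) + \<epsilon> * m * (\<epsilon> + \<epsilon> + 2 * m / real n) = - (7 / 32) * (real n * \<epsilon> ^ 3)"
  proof -
    have "real (card S) = real n * \<epsilon>\<^sup>2" using e2 n0 by (simp add: k)
    then show ?thesis using n0 by (simp add: m_def field_simps power2_eq_square power3_eq_cube)
  qed
  finally have bad: "avg (\<lambda>X. if ?Q X then 0 else 1) \<le> exp (- (7 / 32) * (real n * \<epsilon> ^ 3))" .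
  show ?thesis
    using Pr_le_levels[OF d, of ?Q] good bad unfolding \<Phi>_def by linarith
qed

text \<open>Vertices of \<open>L\<close> never fail, those of \<open>D\<close> are given up, and a
  vertex outside \<open>T\<close> fails with probability at most \<open>card D / card T\<close>. The
  total \<open>card D + (n - card T) * (card D / card T)\<close> is exactly
  \<open>n * (card D / card T)\<close>.\<close>

lemma large_cluster_captures:
  assumes X: "X \<subseteq> E" and S: "S \<subseteq> V" "S \<noteq> {}" and x: "x \<in> V"
    and big: "card (cluster X S) < card (cluster X {x})"
  shows "(\<Sum>v\<in>V. Pr (\<lambda>w. level X w \<and> \<not> same_tree S w x v)) \<le>
    real n * (real (card (cluster X S)) / real (card (cluster X {x}))) * Pr (level X)"
proof -
  define L where "L = cluster X {x}"
  define D where "D = cluster X S"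
  define T where "T = L \<union> D"
  have LV: "L \<subseteq> V" and DV: "D \<subseteq> V"
    using cluster_subset[OF X] x S by (auto simp: L_def D_def)
  have fin: "finite L" "finite D" using LV DV finite_V finite_subset by blast+
  have SD: "S \<subseteq> D" by (simp add: D_def subset_cluster)
  have disj: "L \<inter> D = {}"
  proof (rule ccontr)
    assume "L \<inter> D \<noteq> {}"
    then obtain y where y: "y \<in> L" "y \<in> D" by auto
    have "L \<subseteq> D"
    proof
      fix v assume "v \<in> L"
      then have "v \<in> cluster X {y}" using y(1) cluster_singleton_eq[of y X x] by (simp add: L_def)
      then show "v \<in> D" using y(2) cluster_step[of y X S v] by (simp add: D_def mem_cluster_singleton)
    qed
    then have "card L \<le> card D" by (rule card_mono[OF fin(2)])
    with big show False by (simp add: L_def D_def)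
  qed
  have TV: "T \<subseteq> V" using LV DV by (simp add: T_def)
  have cT: "card T = card L + card D" unfolding T_def by (rule card_Un_disjoint[OF fin disj])
  have xL: "x \<in> L" by (simp add: L_def self_mem_cluster)
  then have L0: "0 < card L" using fin by (auto simp: card_gt_0_iff)
  have tree: "same_tree S w x v"
    if w: "level X w" and v: "v \<in> L \<or> (\<exists>z. \<exists>b\<in>L. enters E w T v z b)" for w v
  proof -
    obtain par rank where tree: "invasion_tree V S w par rank"
      and F: "forest S w = (\<lambda>v. {v, par v}) ` (V - S)"
      using invasion_tree_exists[OF finite_V S] by metis
    have "inj_on w E" "X = {e \<in> E. w e \<le> p}" using w by (auto simp: level_def)
    moreover have "L \<inter> S = {}" "S \<subseteq> T" using disj SD by (auto simp: T_def)
    ultimately show ?thesis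
      unfolding F using invasion_tree.cluster_same_tree[OF tree _ refl _ L_def x _ _ v] by blast
  qed
  have zero: "Pr (\<lambda>w. False) = 0" by (simp add: Pr_def)
  have inL: "Pr (\<lambda>w. level X w \<and> \<not> same_tree S w x v) = 0" if "v \<in> L" for v
  proof -
    have "(\<lambda>w. level X w \<and> \<not> same_tree S w x v) = (\<lambda>w. False)" using tree that by (auto simp: fun_eq_iff)
    then show ?thesis using zero by simp
  qed
  have inD: "Pr (\<lambda>w. level X w \<and> \<not> same_tree S w x v) \<le> Pr (level X)" for v
    by (rule Pr_mono[OF det_level]) simp
  have out: "Pr (\<lambda>w. level X w \<and> \<not> same_tree S w x v) \<le> real (card D) / real (card T) * Pr (level X)"
    if v: "v \<in> V - T" for v
  proof -
    let ?en = "\<lambda>w. \<exists>z. \<exists>b\<in>L. enters E w T v z b"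
    have "Pr (\<lambda>w. level X w \<and> ?en w) * real (card T) = real (card L) * Pr (level X)"
    proof (rule entry_uniform)
      show "{y, y'} \<notin> X" if "y \<in> T" "y' \<notin> T" for y y'
        using that unfolding T_def L_def D_def by (rule cluster_union_closed)
    qed (use v TV xL in \<open>auto simp: T_def\<close>)
    then have en: "Pr (\<lambda>w. level X w \<and> ?en w) = real (card L) / real (card T) * Pr (level X)"
      using cT L0 by (simp add: field_simps)
    have "Pr (\<lambda>w. level X w \<and> \<not> same_tree S w x v) \<le> Pr (\<lambda>w. level X w \<and> \<not> ?en w)"
    proof (rule Pr_mono)
      show "det (\<lambda>w. level X w \<and> \<not> ?en w)"
        by (intro determined_conj det_level determined_not det_entry)
    qed (use tree in blast)
    also have "\<dots> = Pr (level X) - real (card L) / real (card T) * Pr (level X)"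
      using Pr_split[OF det_level[of X] det_entry[of L T v]] en by linarith
    also have "\<dots> = real (card D) / real (card T) * Pr (level X)"
      using cT L0 by (simp add: field_simps)
    finally show ?thesis .
  qed
  let ?P = "\<lambda>v. Pr (\<lambda>w. level X w \<and> \<not> same_tree S w x v)"
  have "(\<Sum>v\<in>V. ?P v) = (\<Sum>v\<in>L. ?P v) + ((\<Sum>v\<in>D. ?P v) + (\<Sum>v\<in>V - T. ?P v))"
  proof -
    have "(\<Sum>v\<in>V. ?P v) = (\<Sum>v\<in>T. ?P v) + (\<Sum>v\<in>V - T. ?P v)"
      using sum.subset_diff[OF TV finite_V] by (simp add: add.commute)
    moreover have "(\<Sum>v\<in>T. ?P v) = (\<Sum>v\<in>L. ?P v) + (\<Sum>v\<in>D. ?P v)"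
      unfolding T_def by (rule sum.union_disjoint[OF fin disj])
    ultimately show ?thesis by simp
  qed
  also have "\<dots> \<le> 0 + ((\<Sum>v\<in>D. Pr (level X)) + (\<Sum>v\<in>V - T. real (card D) / real (card T) * Pr (level X)))"
    using inL by (intro add_mono sum_mono sum_nonpos inD out) auto
  also have "\<dots> = real n * (real (card D) / real (card T)) * Pr (level X)"
  proof -
    have "real (card (V - T)) = real n - real (card T)"
      using card_Diff_subset[OF finite_subset[OF TV finite_V] TV] card_mono[OF finite_V TV] by simp
    moreover have "c * P' + (m - t) * (c / t * P') = m * (c / t) * P'" if "t \<noteq> 0" for c P' m t :: real
      using that by (simp add: field_simps)
    moreover have "real (card T) \<noteq> 0" using cT L0 by simp
    ultimately show ?thesis by (simp only: sum_constant add_0)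
  qed
  also have "\<dots> \<le> real n * (real (card D) / real (card L)) * Pr (level X)"
    using cT L0 Pr_nonneg by (intro mult_right_mono mult_left_mono divide_left_mono) auto
  finally show ?thesis by (simp add: D_def L_def)
qed

text \<open>\<open>s\<close> stands for \<open>n powr (1 / 3)\<close>, and the small constant
  \<open>a\<close> sets the scales: a component of size \<open>t = a ^ 4 * s\<^sup>2\<close> counts
  as large, while the cluster of the auxiliary set \<open>{1..s}\<close> is likely to exceed
  \<open>y = a * s\<^sup>2\<close>. The term \<open>128 * a\<close> is
  \<open>s * (128 * sqrt t) / y\<close>. The ratio of \<open>D\<close> to the large component is
  kept below \<open>\<eta>\<close> by Markov's inequality.\<close>

lemma few_sources_bound:
  assumes S: "S \<subseteq> V" "S \<noteq> {}" and s: "1 \<le> s" "s ^ 3 \<le> n" and pe: "p = (1 - 1 / real s) / real n"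
    and a: "0 < a" "a \<le> 1" "1 \<le> 4 * a * real s" "1 \<le> a ^ 4 * (real s)\<^sup>2"
    and \<delta>: "0 < \<delta>" and \<eta>: "0 < \<eta>" "\<eta> < 1"
  shows "Pr (\<lambda>w. real (largest_component_size V (forest S w)) < (1 - \<delta>) * real n) \<le>
    \<eta> / \<delta> + (real (card S) / (\<eta> * a ^ 4 * real s) + (exp (1 - 1 / (16 * a)) + 128 * a))"
proof -
  define t where "t = a ^ 4 * (real s)\<^sup>2"
  define y where "y = a * (real s)\<^sup>2"
  define \<Phi> where "\<Phi> w \<longleftrightarrow> real (largest_component_size V (forest S w)) < (1 - \<delta>) * real n" for w
  let ?Q = "\<lambda>X. (\<exists>x\<in>V. t \<le> real (card (cluster X {x}))) \<and> real (card (cluster X S)) \<le> \<eta> * t"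
  have n0: "0 < real n" using n2 by simp
  have s0: "0 < real s" using s by simp
  have t1: "1 \<le> t" using a by (simp add: t_def)
  have y0: "0 < y" using a s0 by (simp add: y_def)
  have e: "0 < 1 / real s" "1 / real s \<le> 1" using s by auto
  have s3: "(real s) ^ 3 \<le> real n" using s(2) by (simp flip: of_nat_power)
  have "s \<le> s ^ 3" using s(1) by (simp add: self_le_power)
  then have sn: "s \<le> n" using s(2) by simp
  have d: "det \<Phi>" unfolding \<Phi>_def by (rule determined_forest)
  have perX: "Pr (\<lambda>w. level X w \<and> \<Phi> w) \<le> \<eta> / \<delta> * Pr (level X)" if X: "X \<subseteq> E" "?Q X" for X
  proof -
    obtain x where x: "x \<in> V" "t \<le> real (card (cluster X {x}))" using X(2) by blast
    have "real (card (cluster X S)) \<le> \<eta> * t" using X(2) by simp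
    also have "\<dots> < t" using \<eta> t1 by simp
    finally have lt: "card (cluster X S) < card (cluster X {x})" using x(2) by linarith
    have "Pr (\<lambda>w. level X w \<and> \<Phi> w) * (\<delta> * real n) \<le> (\<Sum>v\<in>V. Pr (\<lambda>w. level X w \<and> \<not> same_tree S w x v))"
    proof (rule Pr_count[OF finite_V])
      show "det (\<lambda>w. level X w \<and> \<not> same_tree S w x v)" for v
        by (intro determined_conj det_level determined_not det_same_tree)
      show "det (\<lambda>w. level X w \<and> \<Phi> w)" by (intro determined_conj det_level d)
      show "0 < \<delta> * real n" using \<delta> n0 by simp
      fix w assume w: "level X w \<and> \<Phi> w"
      have "card {v \<in> V. same_tree S w x v} + card {v \<in> V. \<not> same_tree S w x v} = n"
      proof -
        have "card ({v \<in> V. same_tree S w x v} \<union> {v \<in> V. \<not> same_tree S w x v}) =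
            card {v \<in> V. same_tree S w x v} + card {v \<in> V. \<not> same_tree S w x v}"
          by (rule card_Un_disjoint) auto
        moreover have "{v \<in> V. same_tree S w x v} \<union> {v \<in> V. \<not> same_tree S w x v} = V" by auto
        ultimately show ?thesis by simp
      qed
      moreover have "card {v \<in> V. same_tree S w x v} \<le> largest_component_size V (forest S w)"
        by (rule component_le_largest[OF finite_V x(1)])
      ultimately have "real n \<le> real (largest_component_size V (forest S w)) + real (card {v \<in> V. \<not> same_tree S w x v})"
        by linarith
      then show "\<delta> * real n \<le> real (card {v \<in> V. level X w \<and> \<not> same_tree S w x v})"
        using w by (simp add: \<Phi>_def algebra_simps)
    qed
    also have "\<dots> \<le> real n * (real (card (cluster X S)) / real (card (cluster X {x}))) * Pr (level X)"
      by (rule large_cluster_captures[OF X(1) S x(1) lt])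
    also have "\<dots> \<le> real n * \<eta> * Pr (level X)"
    proof (intro mult_right_mono mult_left_mono)
      have "real (card (cluster X S)) \<le> \<eta> * real (card (cluster X {x}))"
        using X(2) x(2) \<eta> mult_left_mono[OF x(2), of \<eta>] by linarith
      moreover have "0 < real (card (cluster X {x}))" using x(2) t1 by linarith
      ultimately show "real (card (cluster X S)) / real (card (cluster X {x})) \<le> \<eta>"
        by (simp add: pos_divide_le_eq)
    qed (use Pr_nonneg in auto)
    finally show ?thesis using \<delta> n0 by (simp add: field_simps)
  qed
  have "(\<Sum>X\<in>{X \<in> Pow E. ?Q X}. Pr (\<lambda>w. level X w \<and> \<Phi> w)) \<le> (\<Sum>X\<in>{X \<in> Pow E. ?Q X}. \<eta> / \<delta> * gnp E p X)"
    using perX Pr_level by (intro sum_mono) auto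
  also have "\<dots> \<le> (\<Sum>X\<in>Pow E. \<eta> / \<delta> * gnp E p X)"
    using finite_E p01 gnp_nonneg[of p E] \<eta> \<delta> by (intro sum_mono2) auto
  also have "\<dots> = \<eta> / \<delta> * (\<Sum>X\<in>Pow E. gnp E p X)" by (simp only: sum_distrib_left)
  also have "\<dots> = \<eta> / \<delta>" by (simp only: sum_gnp[OF finite_E] mult_1_right)
  finally have good: "(\<Sum>X\<in>{X \<in> Pow E. ?Q X}. Pr (\<lambda>w. level X w \<and> \<Phi> w)) \<le> \<eta> / \<delta>" .
  have mean: "avg (\<lambda>X. real (card (cluster X S))) \<le> real (card S) * real s"
    using cluster_mean[OF S(1) _ e pe] n2 by simp
  have ht: "0 < \<eta> * t" using \<eta> t1 by simp
  have "avg (\<lambda>X. if ?Q X then 0 else 1) \<le>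
      avg (\<lambda>X. 1 / (\<eta> * t) * real (card (cluster X S)) + (if \<forall>v\<in>V. real (card (cluster X {v})) < t then 1 else 0))"
  proof (rule avg_mono)
    fix X
    have "1 \<le> 1 / (\<eta> * t) * real (card (cluster X S))" if "\<eta> * t < real (card (cluster X S))"
      using that ht by (simp add: field_simps)
    moreover have "0 \<le> 1 / (\<eta> * t) * real (card (cluster X S))" using ht by simp
    ultimately show "(if ?Q X then 0 else 1) \<le> 1 / (\<eta> * t) * real (card (cluster X S)) +
        (if \<forall>v\<in>V. real (card (cluster X {v})) < t then 1 else 0)"
      by (auto simp: not_le not_less)
  qed
  also have "\<dots> = 1 / (\<eta> * t) * avg (\<lambda>X. real (card (cluster X S))) +
      avg (\<lambda>X. if \<forall>v\<in>V. real (card (cluster X {v})) < t then 1 else 0)"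
    by (simp only: avg_add avg_cmult)
  also have "\<dots> \<le> real (card S) / (\<eta> * a ^ 4 * real s) + (exp (1 - 1 / (16 * a)) + 128 * a)"
  proof (rule add_mono)
    have "1 / (\<eta> * t) * avg (\<lambda>X. real (card (cluster X S))) \<le> 1 / (\<eta> * t) * (real (card S) * real s)"
      using mean ht by (intro mult_left_mono) auto
    also have "\<dots> = real (card S) / (\<eta> * a ^ 4 * real s)"
      using s0 a \<eta> by (simp add: t_def field_simps power2_eq_square)
    finally show "1 / (\<eta> * t) * avg (\<lambda>X. real (card (cluster X S))) \<le> real (card S) / (\<eta> * a ^ 4 * real s)" .
    have pn: "p \<le> 1 / real n" using n0 e by (simp add: pe divide_right_mono)
    have SS: "{1..s} \<subseteq> V" using sn by auto
    have "avg (\<lambda>X. if \<forall>v\<in>V. real (card (cluster X {v})) < t then 1 else 0) \<le>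
        avg (\<lambda>X. if real (card (cluster X {1..s})) \<le> y then 1 else 0) + real (card {1..s}) * (128 * sqrt t) / y"
      by (rule large_cluster_exists[OF SS pn t1 y0])
    also have "\<dots> \<le> exp (1 - 1 / (16 * a)) + 128 * a"
    proof (rule add_mono)
      \<comment> \<open>This \<open>z\<close> makes the quadratic term \<open>z * y * z\<close>
        equal to \<open>1 / (16 * a)\<close>, half of the gain
        \<open>s * z / 2 = 1 / (8 * a)\<close>; the other two error terms stay bounded.\<close>
      define z where "z = 1 / (4 * a * real s)"
      have z: "0 < z" "z \<le> 1" using a s0 by (auto simp: z_def)
      have "avg (\<lambda>X. if real (card (cluster X {1..s})) \<le> y then 1 else 0) \<le>
          exp (- (real (card {1..s}) * z / 2) + z * y * (1 / real s + z + 2 * y / real n))"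
        by (rule cluster_lower_tail[OF SS _ _ _ pe z]) (use e y0 n2 in auto)
      also have "\<dots> \<le> exp (1 - 1 / (16 * a))"
      proof -
        have "z * y * (2 * y / real n) = a / 2 * ((real s) ^ 3 / real n)"
          using a s0 by (simp add: z_def y_def field_simps power2_eq_square power3_eq_cube)
        also have "\<dots> \<le> a / 2 * 1" using a s3 n0 by (intro mult_left_mono) auto
        finally have 1: "z * y * (2 * y / real n) \<le> 1 / 2" using a by simp
        have 2: "z * y * (1 / real s) = 1 / 4" "z * y * z = 1 / (16 * a)" "real (card {1..s}) * z / 2 = 1 / (8 * a)"
          using a s0 by (simp_all add: z_def y_def field_simps power2_eq_square)
        have "z * y * (1 / real s + z + 2 * y / real n) = z * y * (1 / real s) + z * y * z + z * y * (2 * y / real n)"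
          by (simp only: distrib_left)
        also have "\<dots> \<le> 1 / 4 + 1 / (16 * a) + 1 / 2" using 1 2 by linarith
        finally have "- (real (card {1..s}) * z / 2) + z * y * (1 / real s + z + 2 * y / real n) \<le>
            - (1 / (8 * a)) + (1 / 4 + 1 / (16 * a) + 1 / 2)" using 2(3) by linarith
        also have "\<dots> \<le> 1 - 1 / (16 * a)" using a by (simp add: field_simps)
        finally show ?thesis by simp
      qed
      finally show "avg (\<lambda>X. if real (card (cluster X {1..s})) \<le> y then 1 else 0) \<le> exp (1 - 1 / (16 * a))" .
      have "sqrt t = a\<^sup>2 * real s"
      proof (rule real_sqrt_unique)
        show "(a\<^sup>2 * real s)\<^sup>2 = t" by (simp add: t_def power_mult_distrib flip: power_mult)
      qed (use a in auto)
      then show "real (card {1..s}) * (128 * sqrt t) / y \<le> 128 * a"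
        using a s0 by (simp add: y_def field_simps power2_eq_square)
    qed
    finally show "avg (\<lambda>X. if \<forall>v\<in>V. real (card (cluster X {v})) < t then 1 else 0)
        \<le> exp (1 - 1 / (16 * a)) + 128 * a" .
  qed
  finally have bad: "avg (\<lambda>X. if ?Q X then 0 else 1) \<le>
      real (card S) / (\<eta> * a ^ 4 * real s) + (exp (1 - 1 / (16 * a)) + 128 * a)" .
  show ?thesis
    using Pr_le_levels[OF d, of ?Q] good bad unfolding \<Phi>_def by linarith
qed

end

subsection \<open>Convergence in probability\<close>

lemma max_tree_size_measurable:
  assumes "iid_uniform_weights P n U"
  shows "(\<lambda>\<omega>. real (max_tree_size n k U \<omega>) / real n) \<in> borel_measurable P"
proof -
  let ?E = "nsets {1..n} 2"
  have "max_tree_size n k U \<in> measurable P (count_space UNIV)"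
  proof (subst measurable_count_space_eq2_countable, intro conjI ballI)
    fix m
    have "{\<omega> \<in> space P. largest_component_size {1..n} (invasion_forest {1..n} ?E (\<lambda>e. U e \<omega>) {1..k}) = m}
        \<in> sets P"
    proof (rule determined_event)
      show "finite ?E" by (rule finite_imp_finite_nsets) simp
      show "U e \<in> borel_measurable P" if "e \<in> ?E" for e
        using iid_measurable[OF assms] that by (simp add: complete_edges_def)
      show "determined ?E 0 (\<lambda>w. largest_component_size {1..n} (invasion_forest {1..n} ?E w {1..k}) = m)"
        by (rule determined_forest)
    qed
    moreover have "max_tree_size n k U -` {m} \<inter> space P =
        {\<omega> \<in> space P. largest_component_size {1..n} (invasion_forest {1..n} ?E (\<lambda>e. U e \<omega>) {1..k}) = m}"
      by (auto simp: max_tree_size_def complete_edges_def)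
    ultimately show "max_tree_size n k U -` {m} \<inter> space P \<in> sets P" by simp
  qed auto
  then have "(\<lambda>\<omega>. real (max_tree_size n k U \<omega>)) \<in> borel_measurable P"
    by (rule measurable_compose) simp
  then show ?thesis by simp
qed

lemma cube_root_power:
  assumes "n \<ge> 1"
  shows "(real n powr (1 / 3)) ^ 3 = real n"
  using assms by (simp add: powr_powr flip: powr_realpow)

lemma many_sources_probability:
  assumes iid: "iid_uniform_weights P n U" and n: "n \<ge> 2" and k: "1 \<le> k" "k \<le> n" and \<delta>: "\<delta> > 0"
    and r: "r = real k / real n powr (1 / 3)" "1 \<le> r"
  shows "measure P {\<omega> \<in> space P. \<bar>real (max_tree_size n k U \<omega>) / real n - 0\<bar> > \<delta>}
    \<le> (256 / \<delta>\<^sup>2 + 5) * inverse r"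
proof -
  define \<epsilon> where "\<epsilon> = sqrt (real k / real n)"
  define p where "p = (1 - \<epsilon>) / real n"
  define x where "x = real n * \<epsilon> ^ 3"
  have n0: "0 < real n" using n by simp
  have e: "0 < \<epsilon>" "\<epsilon> \<le> 1" "\<epsilon>\<^sup>2 = real k / real n" using k n by (auto simp: \<epsilon>_def)
  have "0 \<le> p" "p < 1" using e n by (auto simp: p_def field_simps)
  then interpret random_weights P n U p by unfold_locales (use iid n in auto)
  have "Pr (\<lambda>w. \<delta> * real n < real (largest_component_size V (forest {1..k} w))) \<le>
      256 / (\<delta>\<^sup>2 * x) + exp (- (7 / 32) * x)"
    unfolding x_def by (rule many_sources_bound[of "{1..k}" k]) (use k \<delta> in \<open>auto simp: \<epsilon>_def p_def\<close>)
  moreover have "measure P {\<omega> \<in> space P. \<bar>real (max_tree_size n k U \<omega>) / real n - 0\<bar> > \<delta>} =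
      Pr (\<lambda>w. \<delta> * real n < real (largest_component_size V (forest {1..k} w)))"
    unfolding Pr_def max_tree_size_def complete_edges_def
    using n0 by (intro arg_cong[where f = prob] Collect_cong) (simp add: pos_less_divide_eq)
  \<comment> \<open>In fact \<open>x = r powr (3 / 2)\<close>, since
    \<open>r ^ 3 = k ^ 3 / n = x\<^sup>2\<close>.\<close>
  moreover have rx: "r \<le> x"
  proof (rule power2_le_imp_le)
    have "r ^ 3 = real k ^ 3 / real n"
      using cube_root_power[of n] n by (simp add: r power_divide)
    also have "\<dots> = (real n)\<^sup>2 * (\<epsilon>\<^sup>2) ^ 3"
      unfolding e(3) using n0 by (simp add: power_divide field_simps power2_eq_square power3_eq_cube)
    also have "\<dots> = x\<^sup>2" by (simp add: x_def power_mult_distrib flip: power_mult)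
    finally have "r ^ 3 = x\<^sup>2" .
    moreover have "r\<^sup>2 \<le> r ^ 3" using r by (intro power_increasing) auto
    ultimately show "r\<^sup>2 \<le> x\<^sup>2" by simp
    show "0 \<le> x" using e by (simp add: x_def)
  qed
  moreover have "256 / (\<delta>\<^sup>2 * x) \<le> 256 / \<delta>\<^sup>2 * inverse r"
  proof -
    have "256 / (\<delta>\<^sup>2 * x) \<le> 256 / (\<delta>\<^sup>2 * r)"
      using rx r \<delta> by (intro divide_left_mono mult_left_mono mult_pos_pos) auto
    then show ?thesis by (simp add: divide_inverse mult_ac)
  qed
  moreover have "exp (- (7 / 32) * x) \<le> 5 * inverse r"
  proof -
    have "7 / 32 * r \<le> exp (7 / 32 * x)"
      using rx exp_ge_add_one_self[of "7 / 32 * x"] by linarith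
    then have "inverse (exp (7 / 32 * x)) \<le> inverse (7 / 32 * r)"
      using r(2) by (intro le_imp_inverse_le) auto
    also have "\<dots> = 32 / 7 * inverse r" by (subst inverse_mult_distrib) simp
    also have "\<dots> \<le> 5 * inverse r" using r(2) by (intro mult_right_mono) auto
    finally show ?thesis by (simp add: exp_minus)
  qed
  ultimately show ?thesis by (simp add: distrib_right)
qed

text \<open>The lower bound on \<open>n powr (1 / 3)\<close> survives rounding down to
  \<open>s\<close> as \<open>1 \<le> a\<^sup>2 * s\<close>, which yields both conditions linking
  \<open>a\<close> and \<open>s\<close> in \<open>few_sources_bound\<close>. The constant 176 is 128
  + 48.\<close>

lemma few_sources_probability:
  assumes iid: "iid_uniform_weights P n U" and n: "n \<ge> 2" and k: "1 \<le> k" "k \<le> n"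
    and a: "0 < a" "a \<le> 1" "2 / a\<^sup>2 \<le> real n powr (1 / 3)"
    and \<delta>: "0 < \<delta>" and \<eta>: "0 < \<eta>" "\<eta> < 1"
  shows "measure P {\<omega> \<in> space P. \<bar>real (max_tree_size n k U \<omega>) / real n - 1\<bar> > \<delta>}
    \<le> \<eta> / \<delta> + (2 * (real k / real n powr (1 / 3)) / (\<eta> * a ^ 4) + 176 * a)"
proof -
  define x where "x = real n powr (1 / 3)"
  define s where "s = nat \<lfloor>x\<rfloor>"
  define p where "p = (1 - 1 / real s) / real n"
  have x3: "x ^ 3 = real n" unfolding x_def by (rule cube_root_power) (use n in simp)
  have n0: "0 < real n" using n by simp
  have a2: "a\<^sup>2 \<le> 1" using a by (simp add: power_le_one)
  have "1 \<le> 1 / a\<^sup>2" using a a2 by simp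
  then have x2: "2 \<le> x" using a(3) unfolding x_def by (simp add: field_simps)
  have sx: "real s \<le> x" "x / 2 \<le> real s"
  proof -
    have s: "real s = of_int \<lfloor>x\<rfloor>" using x2 by (simp add: s_def)
    then show "real s \<le> x" by simp
    show "x / 2 \<le> real s" using s x2 by linarith
  qed
  have s1: "1 \<le> s" using sx(2) x2 by linarith
  have as: "1 / a\<^sup>2 \<le> real s" using a(3) sx(2) unfolding x_def by simp
  have "s ^ 3 \<le> n"
  proof -
    have "(real s) ^ 3 \<le> x ^ 3" using sx by (intro power_mono) auto
    then show ?thesis unfolding x3 by (simp flip: of_nat_power)
  qed
  have "0 \<le> p" using s1 by (simp add: p_def)
  moreover have "p < 1"
  proof -
    have "1 - 1 / real s < real n" using n s1 by (simp add: less_le_trans[of _ 1])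
    then show ?thesis using n0 by (simp add: p_def)
  qed
  ultimately have "0 \<le> p" "p < 1" .
  then interpret random_weights P n U p by unfold_locales (use iid n in auto)
  have as1: "1 \<le> a\<^sup>2 * real s" using as a by (simp add: field_simps)
  have "a\<^sup>2 \<le> a" using a by (simp add: power2_eq_square)
  then have "a\<^sup>2 * real s \<le> a * real s" by (rule mult_right_mono) simp
  with as1 have as2: "1 \<le> 4 * a * real s" by linarith
  have "1 \<le> (a\<^sup>2 * real s)\<^sup>2" using as1 by (simp add: one_le_power)
  then have as3: "1 \<le> a ^ 4 * (real s)\<^sup>2" by (simp add: power_mult_distrib flip: power_mult)
  have "Pr (\<lambda>w. real (largest_component_size V (forest {1..k} w)) < (1 - \<delta>) * real n) \<le>
      \<eta> / \<delta> + (real (card {1..k}) / (\<eta> * a ^ 4 * real s) + (exp (1 - 1 / (16 * a)) + 128 * a))"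
    by (rule few_sources_bound[OF _ _ s1 \<open>s ^ 3 \<le> n\<close> p_def a(1,2) as2 as3 \<delta> \<eta>]) (use k in auto)
  moreover have "measure P {\<omega> \<in> space P. \<bar>real (max_tree_size n k U \<omega>) / real n - 1\<bar> > \<delta>} =
      Pr (\<lambda>w. real (largest_component_size V (forest {1..k} w)) < (1 - \<delta>) * real n)"
  proof -
    have "\<bar>real m / real n - 1\<bar> > \<delta> \<longleftrightarrow> real m < (1 - \<delta>) * real n" if "m \<le> n" for m
    proof -
      have "\<bar>real m / real n - 1\<bar> = 1 - real m / real n" using that n0 by simp
      then have "\<bar>real m / real n - 1\<bar> > \<delta> \<longleftrightarrow> real m / real n < 1 - \<delta>" by auto
      then show ?thesis using n0 by (simp add: pos_divide_less_eq)
    qed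
    moreover have "largest_component_size V F \<le> n" for F
      using largest_component_le_card[OF finite_V, of F] n by simp
    ultimately show ?thesis
      unfolding Pr_def max_tree_size_def complete_edges_def by simp
  qed
  moreover have "real (card {1..k}) / (\<eta> * a ^ 4 * real s) \<le> 2 * (real k / x) / (\<eta> * a ^ 4)"
  proof -
    have "real k / real s \<le> real k / (x / 2)"
      using sx x2 s1 by (intro divide_left_mono mult_pos_pos) auto
    then have "real k / real s / (\<eta> * a ^ 4) \<le> real k / (x / 2) / (\<eta> * a ^ 4)"
      using \<eta> a by (intro divide_right_mono) auto
    then show ?thesis by (simp add: mult_ac)
  qed
  \<comment> \<open>\<open>exp (1 - y) \<le> 3 / y\<close> with \<open>y = 1 / (16 * a)\<close>
    turns the exponential into a multiple of \<open>a\<close>.\<close>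
  moreover have "exp (1 - 1 / (16 * a)) \<le> 48 * a"
  proof -
    define y where "y = 1 / (16 * a)"
    have "y \<le> exp y" using exp_ge_add_one_self[of y] by linarith
    then have "exp (1 - y) * y \<le> exp (1 - y) * exp y" by (intro mult_left_mono) auto
    also have "\<dots> = exp 1" by (simp flip: exp_add)
    also have "\<dots> \<le> 3" by (rule exp_le)
    finally have "exp (1 - y) * y \<le> 3" .
    moreover have "0 < y" using a by (simp add: y_def)
    ultimately have "exp (1 - y) \<le> 3 / y" by (simp only: pos_le_divide_eq)
    then show ?thesis by (simp add: y_def)
  qed
  ultimately show ?thesis unfolding x_def by linarith
qed

lemma eventually_cube_root_ge:
  assumes "0 < C"
  shows "eventually (\<lambda>n. C \<le> real n powr (1 / 3)) sequentially"
  using eventually_ge_at_top[of "nat \<lceil>C ^ 3\<rceil>"]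
proof eventually_elim
  case (elim n)
  then have "C ^ 3 \<le> real n" by linarith
  then have "(C ^ 3) powr (1 / 3) \<le> real n powr (1 / 3)" using assms by (intro powr_mono2) auto
  moreover have "(C ^ 3) powr (1 / 3) = C"
  proof -
    have "C ^ 3 = C powr 3" using assms by simp
    then show ?thesis using assms by (simp only: powr_powr) simp
  qed
  ultimately show ?case by simp
qed

theorem theorem1p1:
  fixes k :: "nat \<Rightarrow> nat"
    and P :: "nat \<Rightarrow> 'a measure"
    and U :: "nat \<Rightarrow> nat set \<Rightarrow> 'a \<Rightarrow> real"
  assumes k: "\<And>n. n \<ge> 1 \<Longrightarrow> 1 \<le> k n \<and> k n \<le> n"
    and weights: "\<And>n. n \<ge> 1 \<Longrightarrow> iid_uniform_weights (P n) n (U n)"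
  shows "((\<lambda>n. real (k n) / real n powr (1 / 3)) \<longlonglongrightarrow> 0 \<longrightarrow>
            converges_in_prob P (\<lambda>n \<omega>. real (max_tree_size n (k n) (U n) \<omega>) / real n) 1) \<and>
         (filterlim (\<lambda>n. real (k n) / real n powr (1 / 3)) at_top sequentially \<longrightarrow>
            converges_in_prob P (\<lambda>n \<omega>. real (max_tree_size n (k n) (U n) \<omega>) / real n) 0)"
proof (intro conjI impI)
  let ?r = "\<lambda>n. real (k n) / real n powr (1 / 3)"
  assume r0: "?r \<longlonglongrightarrow> 0"
  show "converges_in_prob P (\<lambda>n \<omega>. real (max_tree_size n (k n) (U n) \<omega>) / real n) 1"
    unfolding converges_in_prob_def
  proof (intro conjI allI impI)
    show "(\<lambda>\<omega>. real (max_tree_size n (k n) (U n) \<omega>) / real n) \<in> borel_measurable (P n)" if "1 \<le> n" for n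
      by (rule max_tree_size_measurable[OF weights[OF that]])
    fix \<delta> :: real assume \<delta>: "0 < \<delta>"
    let ?m = "\<lambda>n. measure (P n) {\<omega> \<in> space (P n). \<delta> < \<bar>real (max_tree_size n (k n) (U n) \<omega>) / real n - 1\<bar>}"
    show "?m \<longlonglongrightarrow> 0"
    proof (rule order_tendstoI)
      show "eventually (\<lambda>n. b < ?m n) sequentially" if "b < 0" for b
        using that by (intro always_eventually allI) (simp add: less_le_trans[OF _ measure_nonneg])
      fix \<tau> :: real assume \<tau>: "0 < \<tau>"
      \<comment> \<open>The error budget is \<open>\<tau> / 8\<close> for
        \<open>\<eta> / \<delta>\<close>, \<open>\<tau> / 4\<close> for the term with
        \<open>?r n\<close>, and \<open>176 * \<tau> / 1000\<close> for \<open>176 * a\<close>. Both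
        \<open>a\<close> and \<open>\<eta>\<close> are fixed before \<open>n\<close> grows, so
        \<open>?r n\<close> can be made small compared with \<open>\<eta> * a ^ 4\<close>.\<close>
      define a where "a = min 1 (\<tau> / 1000)"
      define \<eta> where "\<eta> = min (1 / 2) (\<delta> * \<tau> / 8)"
      have a: "0 < a" "a \<le> 1" "a \<le> \<tau> / 1000" using \<tau> by (auto simp: a_def)
      have \<eta>: "0 < \<eta>" "\<eta> < 1" "\<eta> \<le> \<delta> * \<tau> / 8" using \<tau> \<delta> by (auto simp: \<eta>_def)
      have c: "0 < \<eta> * a ^ 4 * \<tau> / 8" using \<eta> a \<tau> by simp
      have "eventually (\<lambda>n. ?r n < \<eta> * a ^ 4 * \<tau> / 8) sequentially"
        by (rule order_tendstoD(2)[OF r0 c])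
      moreover have "eventually (\<lambda>n. 2 / a\<^sup>2 \<le> real n powr (1 / 3)) sequentially"
        by (rule eventually_cube_root_ge) (use a in simp)
      ultimately show "eventually (\<lambda>n. ?m n < \<tau>) sequentially"
        using eventually_ge_at_top[of 2]
      proof eventually_elim
        case (elim n)
        have "?m n \<le> \<eta> / \<delta> + (2 * ?r n / (\<eta> * a ^ 4) + 176 * a)"
          by (rule few_sources_probability[OF weights elim(3) _ _ a(1,2) elim(2) \<delta> \<eta>(1,2)])
            (use k[of n] elim(3) in auto)
        moreover have "\<eta> / \<delta> \<le> \<tau> / 8" using \<eta>(3) \<delta> by (simp add: field_simps)
        moreover have "2 * ?r n / (\<eta> * a ^ 4) \<le> \<tau> / 4"
        proof -
          have "2 * ?r n \<le> 2 * (\<eta> * a ^ 4 * \<tau> / 8)" using elim(1) by (intro mult_left_mono) auto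
          then have "2 * ?r n \<le> \<tau> / 4 * (\<eta> * a ^ 4)" by (simp add: mult_ac)
          moreover have "0 < \<eta> * a ^ 4" using \<eta> a by simp
          ultimately show ?thesis by (simp only: pos_divide_le_eq)
        qed
        ultimately show ?case using a(3) \<tau> by linarith
      qed
    qed
  qed
next
  let ?r = "\<lambda>n. real (k n) / real n powr (1 / 3)"
  assume rinf: "filterlim ?r at_top sequentially"
  show "converges_in_prob P (\<lambda>n \<omega>. real (max_tree_size n (k n) (U n) \<omega>) / real n) 0"
    unfolding converges_in_prob_def
  proof (intro conjI allI impI)
    show "(\<lambda>\<omega>. real (max_tree_size n (k n) (U n) \<omega>) / real n) \<in> borel_measurable (P n)" if "1 \<le> n" for n
      by (rule max_tree_size_measurable[OF weights[OF that]])
    fix \<delta> :: real assume \<delta>: "0 < \<delta>"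
    let ?m = "\<lambda>n. measure (P n) {\<omega> \<in> space (P n). \<delta> < \<bar>real (max_tree_size n (k n) (U n) \<omega>) / real n - 0\<bar>}"
    show "?m \<longlonglongrightarrow> 0"
    proof (rule tendsto_sandwich)
      show "(\<lambda>_. 0) \<longlonglongrightarrow> (0 :: real)" by simp
      show "(\<lambda>n. (256 / \<delta>\<^sup>2 + 5) * inverse (?r n)) \<longlonglongrightarrow> 0"
        by (rule tendsto_mult_right_zero[OF tendsto_inverse_0_at_top[OF rinf]])
      show "eventually (\<lambda>n. 0 \<le> ?m n) sequentially" by simp
      have "eventually (\<lambda>n. 1 \<le> ?r n) sequentially"
        using rinf by (simp add: filterlim_at_top)
      then show "eventually (\<lambda>n. ?m n \<le> (256 / \<delta>\<^sup>2 + 5) * inverse (?r n)) sequentially"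
        using eventually_ge_at_top[of 2]
      proof eventually_elim
        case (elim n)
        show ?case
          by (rule many_sources_probability[OF weights elim(2) _ _ \<delta> refl elim(1)])
            (use k[of n] elim(2) in auto)
      qed
    qed
  qed
qed

end
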